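(* Fix integers $n_1 \geq 2$ and $m_2 \geq 1$, and let $r = r_{n_1,m_2}$ be the number defined in the context. Then there is a function $\epsilon(m_1)$ with $\epsilon(m_1) \in o(m_1)$ as $m_1 \to \infty$ such that, for all sufficiently large $m_1$ and all positive integers $n_2$, the graph $K_{m_1(n_1), m_2(n_2)}$ has a distinguishing partition if and only if $n_2 \leq r m_1 + \epsilon(m_1)$.
   Context: For positive integers $m_1,n_1,m_2,n_2$, $K_{m_1(n_1),m_2(n_2)}$ denotes the complete multipartite graph whose maximal independent sets (parts) are $m_1$ sets of size $n_1$ and $m_2$ sets of size $n_2$. For a graph $X$ with automorphism group $\mathrm{aut}(X)$ acting on $V(X)$, and a partition $P=\{P_1,\dots,P_t\}$ of $V(X)$, put $\gamma(P)=\{\gamma(P_1),\dots,\gamma(P_t)\}$ for $\gamma\in\mathrm{aut}(X)$, where $\gamma(P_i)=\{\gamma(x):x\in P_i\}$. $P$ is a distinguishing partition if $\gamma(P)\neq P$ for every nontrivial $\gamma\in\mathrm{aut}(X)$. Definition of $r_{n_1,m_2}$: $r_{2,m_2}=1$ (and one sets $j=-1$ when $n_1=2$). For $n_1 \geq 3$, let $j=j_{n_1,m_2}\ge 0$ and $k=k_{n_1,m_2}\ge 0$ be the integers with $n_1 = 2 + \binom{m_2}{0} + \binom{m_2}{1} + \cdots + \binom{m_2}{j} + k$ and either ($j < \lfloor (m_2-1)/2 \rfloor$ and $0 \leq k < \binom{m_2}{j+1}$) or ($j = \lfloor (m_2-1)/2 \rfloor$ and $k \geq 0$). If $j < \lfloor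 (m_2-1)/2 \rfloor$, then $r = 1 + \sum_{i=0}^{j}\frac{m_2-i}{m_2}\binom{m_2}{i} + \frac{m_2 - j - 1}{m_2}k$; if $j = \lfloor (m_2-1)/2 \rfloor$, then $r = 1 + \sum_{i=0}^{j}\frac{m_2-i}{m_2}\binom{m_2}{i} + \frac{1}{2}k$. *)

theory Defs
  imports
    Complex_Main
    "HOL-Library.Disjoint_Sets"
    "HOL-Library.Landau_Symbols"
    "HOL-Combinatorics.Permutations"
    "Graph_Theory.Pair_Digraph"
begin

section \<open>The graph $K_{m_1(n_1),m_2(n_2)}$\<close>

text \<open>
  The vertex \<open>(i, x)\<close> is the \<open>x\<close>-th vertex of the \<open>i\<close>-th part; parts \<open>0, \<dots>, m1 - 1\<close> have
  size \<open>n1\<close> and parts \<open>m1, \<dots>, m1 + m2 - 1\<close> have size \<open>n2\<close>. An undirected graph is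
  represented, as in \<open>Graph_Theory\<close>, by a symmetric loop-free set of arcs.
\<close>

definition part :: "nat \<Rightarrow> nat \<Rightarrow> nat \<Rightarrow> nat \<Rightarrow> (nat \<times> nat) set" where
  "part m1 n1 n2 i = {i} \<times> {..<(if i < m1 then n1 else n2)}"

definition complete_multipartite ::
    "nat \<Rightarrow> nat \<Rightarrow> nat \<Rightarrow> nat \<Rightarrow> (nat \<times> nat) pair_pre_digraph" where
  "complete_multipartite m1 n1 m2 n2 =
     (let V = (\<Union>i<m1 + m2. part m1 n1 n2 i)
      in \<lparr> pverts = V, parcs = {(u, v). u \<in> V \<and> v \<in> V \<and> fst u \<noteq> fst v} \<rparr>)"

definition independent_set :: "'a pair_pre_digraph \<Rightarrow> 'a set \<Rightarrow> bool" where
  "independent_set G S \<longleftrightarrow> S \<subseteq> pverts G \<and> (\<forall>u\<in>S. \<forall>v\<in>S. (u, v) \<notin> parcs G)"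

definition maximal_independent_set :: "'a pair_pre_digraph \<Rightarrow> 'a set \<Rightarrow> bool" where
  "maximal_independent_set G S \<longleftrightarrow>
     independent_set G S \<and> (\<forall>T. independent_set G T \<and> S \<subseteq> T \<longrightarrow> T = S)"

lemma card_part: "card (part m1 n1 n2 i) = (if i < m1 then n1 else n2)"
  by (simp add: part_def card_cartesian_product)

lemma pair_graph_complete_multipartite: "pair_graph (complete_multipartite m1 n1 m2 n2)"
proof -
  let ?V = "\<Union>i<m1 + m2. part m1 n1 n2 i"
  have "finite ?V" by (auto simp: part_def)
  moreover have "{(u, v). u \<in> ?V \<and> v \<in> ?V \<and> fst u \<noteq> fst v} \<subseteq> ?V \<times> ?V" by auto
  ultimately have "finite {(u, v). u \<in> ?V \<and> v \<in> ?V \<and> fst u \<noteq> fst v}"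
    by (meson finite_SigmaI finite_subset)
  with \<open>finite ?V\<close> show ?thesis
    unfolding complete_multipartite_def Let_def
    by unfold_locales (auto simp: symmetric_def sym_def)
qed

lemma maximal_independent_set_complete_multipartite:
  assumes "0 < m1" "0 < n1" "0 < m2" "0 < n2"
  shows "maximal_independent_set (complete_multipartite m1 n1 m2 n2) S \<longleftrightarrow>
           (\<exists>i<m1 + m2. S = part m1 n1 n2 i)"
    (is "maximal_independent_set ?G S \<longleftrightarrow> _")
proof -
  have ind: "independent_set ?G T \<longleftrightarrow>
      T \<subseteq> (\<Union>i<m1 + m2. part m1 n1 n2 i) \<and> (\<forall>u\<in>T. \<forall>v\<in>T. fst u = fst v)" for T
  proof -
    define V where "V = (\<Union>i<m1 + m2. part m1 n1 n2 i)"
    have "?G = \<lparr> pverts = V, parcs = {(u, v). u \<in> V \<and> v \<in> V \<and> fst u \<noteq> fst v} \<rparr>"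
      by (simp add: complete_multipartite_def V_def Let_def)
    then show ?thesis
      unfolding V_def[symmetric] by (simp add: independent_set_def) blast
  qed
  have ind_part: "independent_set ?G (part m1 n1 n2 i)" if "i < m1 + m2" for i
    using that unfolding ind by (auto simp: part_def)
  have ne: "part m1 n1 n2 i \<noteq> {}" for i using assms by (auto simp: part_def)
  have sub: "T \<subseteq> part m1 n1 n2 i"
    if T: "independent_set ?G T" and u: "u \<in> T" "u \<in> part m1 n1 n2 i" for T u i
  proof
    fix v assume "v \<in> T"
    then have "v \<in> (\<Union>i<m1 + m2. part m1 n1 n2 i)" "fst v = fst u"
      using T u unfolding ind by blast+
    then show "v \<in> part m1 n1 n2 i" using u by (auto simp: part_def split: if_splits)
  qed
  show ?thesis
  proof
    assume S: "maximal_independent_set ?G S"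
    have I: "independent_set ?G S" using S by (simp add: maximal_independent_set_def)
    have "\<exists>i<m1 + m2. S \<subseteq> part m1 n1 n2 i"
    proof (cases "S = {}")
      case True
      then show ?thesis using assms by auto
    next
      case False
      then obtain u where "u \<in> S" by blast
      then obtain i where "i < m1 + m2" "u \<in> part m1 n1 n2 i" using I unfolding ind by blast
      then show ?thesis using sub[OF I \<open>u \<in> S\<close>] by blast
    qed
    then show "\<exists>i<m1 + m2. S = part m1 n1 n2 i"
      using S ind_part unfolding maximal_independent_set_def by blast
  next
    assume "\<exists>i<m1 + m2. S = part m1 n1 n2 i"
    then obtain i where i: "i < m1 + m2" "S = part m1 n1 n2 i" by auto
    from ne obtain u where "u \<in> part m1 n1 n2 i" by blast
    then show "maximal_independent_set ?G S"
      unfolding maximal_independent_set_def using i ind_part sub by blast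
  qed
qed


section \<open>Distinguishing partitions\<close>

text \<open>
  An automorphism is a permutation of the vertex set, extended to the whole type by the
  identity, so that the trivial automorphism is exactly \<open>id\<close>.
\<close>

definition aut :: "'a pair_pre_digraph \<Rightarrow> ('a \<Rightarrow> 'a) set" where
  "aut G = {\<gamma>. \<gamma> permutes pverts G \<and>
     (\<forall>u\<in>pverts G. \<forall>v\<in>pverts G. (\<gamma> u, \<gamma> v) \<in> parcs G \<longleftrightarrow> (u, v) \<in> parcs G)}"

definition distinguishing_partition :: "'a pair_pre_digraph \<Rightarrow> 'a set set \<Rightarrow> bool" where
  "distinguishing_partition G P \<longleftrightarrow>
     partition_on (pverts G) P \<and> (\<forall>\<gamma>\<in>aut G. \<gamma> \<noteq> id \<longrightarrow> (\<lambda>C. \<gamma> ` C) ` P \<noteq> P)"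


section \<open>The constant $r_{n_1,m_2}$\<close>

text \<open>For \<open>m2 \<ge> 1\<close>, \<open>(m2 - 1) div 2\<close> is $\lfloor (m_2 - 1)/2 \rfloor$.\<close>

definition jk_decomposition :: "nat \<Rightarrow> nat \<Rightarrow> nat \<Rightarrow> nat \<Rightarrow> bool" where
  "jk_decomposition n1 m2 j k \<longleftrightarrow>
     n1 = 2 + (\<Sum>i=0..j. m2 choose i) + k \<and>
     (j < (m2 - 1) div 2 \<and> k < m2 choose (j + 1) \<or> j = (m2 - 1) div 2)"

definition jk_index :: "nat \<Rightarrow> nat \<Rightarrow> nat \<times> nat" where
  "jk_index n1 m2 = (THE p. jk_decomposition n1 m2 (fst p) (snd p))"

definition r_const :: "nat \<Rightarrow> nat \<Rightarrow> real" where
  "r_const n1 m2 =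
     (if n1 = 2 then 1
      else let j = fst (jk_index n1 m2); k = snd (jk_index n1 m2) in
        1 + (\<Sum>i=0..j. (real m2 - real i) / real m2 * real (m2 choose i)) +
        (if j < (m2 - 1) div 2 then (real m2 - real j - 1) / real m2 * real k
         else 1 / 2 * real k))"

lemma jk_decomposition_unique:
  assumes "jk_decomposition n1 m2 j k" "jk_decomposition n1 m2 j' k'"
  shows "j = j' \<and> k = k'"
proof -
  have aux: "\<not> j < j'" if "jk_decomposition n1 m2 j k" "jk_decomposition n1 m2 j' k'" for j k j' k'
  proof
    assume "j < j'"
    have "(\<Sum>i=0..Suc j. m2 choose i) \<le> (\<Sum>i=0..j'. m2 choose i)"
      using \<open>j < j'\<close> by (intro sum_mono2) auto
    then show False using that \<open>j < j'\<close> by (auto simp: jk_decomposition_def)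
  qed
  from aux assms have "j = j'" by (meson linorder_neqE_nat)
  with assms show ?thesis by (auto simp: jk_decomposition_def)
qed

lemma jk_decomposition_exists:
  assumes "n1 \<ge> 3"
  shows "\<exists>j k. jk_decomposition n1 m2 j k"
proof -
  have "(\<exists>j k. jk_decomposition n1 m2 j k) \<or> 2 + (\<Sum>i=0..l. m2 choose i) \<le> n1"
    if "l \<le> (m2 - 1) div 2" for l
    using that
  proof (induction l)
    case 0
    then show ?case using assms by simp
  next
    case (Suc l)
    show ?case
    proof (cases "2 + (\<Sum>i=0..Suc l. m2 choose i) \<le> n1")
      case False
      have "2 + (\<Sum>i=0..l. m2 choose i) \<le> n1 \<Longrightarrow>
          jk_decomposition n1 m2 l (n1 - (2 + (\<Sum>i=0..l. m2 choose i)))"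
        using False Suc.prems by (auto simp: jk_decomposition_def)
      then show ?thesis using Suc by fastforce
    qed simp
  qed
  from this[of "(m2 - 1) div 2"] show ?thesis
  proof
    assume "2 + (\<Sum>i=0..(m2 - 1) div 2. m2 choose i) \<le> n1"
    then have "jk_decomposition n1 m2 ((m2 - 1) div 2) (n1 - (2 + (\<Sum>i=0..(m2 - 1) div 2. m2 choose i)))"
      by (simp add: jk_decomposition_def)
    then show ?thesis by blast
  qed simp
qed

lemma jk_index_eqI: "jk_decomposition n1 m2 j k \<Longrightarrow> jk_index n1 m2 = (j, k)"
  unfolding jk_index_def
  by (rule the_equality) (auto dest: jk_decomposition_unique intro: prod_eqI)

lemma jk_decomposition_jk_index:
  "n1 \<ge> 3 \<Longrightarrow> jk_decomposition n1 m2 (fst (jk_index n1 m2)) (snd (jk_index n1 m2))"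
proof -
  assume "n1 \<ge> 3"
  then obtain j k where "jk_decomposition n1 m2 j k" using jk_decomposition_exists by blast
  then show ?thesis by (simp add: jk_index_eqI)
qed

end

theory Submission
  imports Defs
begin

text \<open>
  Collapse every part to a point, with \<open>A\<close> the set of the \<open>m1\<close> parts of size \<open>n1\<close> and \<open>B\<close> the set
  of the \<open>m2\<close> other parts. For \<open>n1 \<noteq> n2\<close> a partition is distinguishing iff every class meets each
  part at most once, the classes are determined by the parts that they meet, and the resulting
  family of pairs \<open>(S, T)\<close> with \<open>S \<subseteq> A\<close> and \<open>T \<subseteq> B\<close> is rigid. So one asks for which \<open>n2\<close> there is a
  rigid family in which the elements of \<open>A\<close> have degree \<open>n1\<close> and those of \<open>B\<close> have degree \<open>n2\<close>.

  Upper bound: the classes with a given first component \<open>{a}\<close> have distinct second components, all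
  other classes use up at least two incidences with \<open>A\<close>, and the connected components of the family
  are pairwise non-isomorphic by rigidity; hence there are only \<open>o(m1)\<close> of them, and nearly \<open>m1\<close>
  incidences are spent on connecting \<open>A\<close>.
  The linear program left over has the value \<open>r * m1\<close>. The bound is attained up to a constant by
  putting the largest possible sets \<open>T\<close> on the singletons and adding an asymmetric hypergraph on \<open>A\<close>
  whose edges are coloured by \<open>B\<close>, except that each \<open>b \<in> B\<close> is the colour of an edge of its own.

  Close to the optimum \<open>n2\<close> can be lowered by one: either a part of the family that is connected like
  a tree is rebuilt as a coloured path, or the classes \<open>({y}, B)\<close> and \<open>({z}, B)\<close> are merged into
  \<open>({y, z}, B)\<close>, where the distance of \<open>y\<close> and \<open>z\<close> makes the new edge recognisable. Since \<open>n2 = n1\<close>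
  is always possible for large \<open>m1\<close>, the admissible \<open>n2\<close> form an interval, and \<open>\<epsilon> m1\<close> is the
  difference between its maximum and \<open>r * m1\<close>.
\<close>

text \<open>An exact threshold asks for more than matching bounds: below it every \<open>n2\<close>
  must be admissible. Up to \<open>r * m1 - C\<close> this comes from the construction; beyond that
  nothing is known of a given family except that it nearly attains the bound, and it has to be
  altered without losing rigidity. The balance
  \<open>card (coloured F A) + card A - n1 * card A\<close> decides how. Each connected component
  contributes at most 1 to it. If the total is at least 2, some union of components has balance
  exactly 1, which is the right number of coloured classes for a path. If it is at most 1, the
  duality inequality has only bounded slack, so for \<open>n1 \<ge> 3\<close> all but boundedly many
  points \<open>a\<close> carry \<open>({a}, B)\<close> and all first components have bounded size;
  hence some point is far from every irregularity, and the merged edge can be recognised there. For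
  \<open>n1 = 2\<close> the price is \<open>card B\<close>, the slack says nothing about these
  points, and all of \<open>A\<close> becomes one path. The value \<open>n2 = n1\<close> is special
  because automorphisms may then exchange \<open>A\<close> and \<open>B\<close>; it lies below
  \<open>r * m1 - C\<close>, so the descent never meets it.\<close>

section \<open>Rigid families of pairs and the propagation of fixed points\<close>

definition act :: "('a \<Rightarrow> 'a) \<Rightarrow> ('b \<Rightarrow> 'b) \<Rightarrow> 'a set \<times> 'b set \<Rightarrow> 'a set \<times> 'b set" where
  "act \<pi> \<beta> X = (\<pi> ` fst X, \<beta> ` snd X)"

text \<open>Inclusion is enough here: for finite \<open>F\<close> and permutations,
  \<open>act\<close> is injective and maps \<open>F\<close> onto itself
  (\<open>act_image_eq\<close>).\<close>

definition rigid :: "'a set \<Rightarrow> 'b set \<Rightarrow> ('a set \<times> 'b set) set \<Rightarrow> bool" where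
  "rigid A B F \<longleftrightarrow>
     (\<forall>\<pi> \<beta>. \<pi> permutes A \<and> \<beta> permutes B \<and> act \<pi> \<beta> ` F \<subseteq> F \<longrightarrow> \<pi> = id \<and> \<beta> = id)"

definition realizes ::
    "'a set \<Rightarrow> 'b set \<Rightarrow> nat \<Rightarrow> nat \<Rightarrow> ('a set \<times> 'b set) set \<Rightarrow> bool" where
  "realizes A B n1 n2 F \<longleftrightarrow>
     F \<subseteq> Pow A \<times> Pow B \<and> ({}, {}) \<notin> F \<and>
     (\<forall>a\<in>A. card {X \<in> F. a \<in> fst X} = n1) \<and>
     (\<forall>b\<in>B. card {X \<in> F. b \<in> snd X} = n2) \<and> rigid A B F"

lemma act_Pair [simp]: "act \<pi> \<beta> (S, T) = (\<pi> ` S, \<beta> ` T)"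
  by (simp add: act_def)

lemma fst_act [simp]: "fst (act \<pi> \<beta> X) = \<pi> ` fst X"
  and snd_act [simp]: "snd (act \<pi> \<beta> X) = \<beta> ` snd X"
  by (simp_all add: act_def)

lemma family_subset:
  assumes "F \<subseteq> Pow A \<times> Pow B" "X \<in> F"
  shows "fst X \<subseteq> A" "snd X \<subseteq> B"
proof -
  have "X \<in> Pow A \<times> Pow B" using assms by blast
  then show "fst X \<subseteq> A" "snd X \<subseteq> B" by (simp_all add: mem_Times_iff)
qed

lemma act_inj: "inj \<pi> \<Longrightarrow> inj \<beta> \<Longrightarrow> inj (act \<pi> \<beta>)"
  by (auto simp: inj_def act_def inj_image_eq_iff prod_eq_iff)

lemma act_image_eq:
  assumes "finite F" "inj \<pi>" "inj \<beta>" "act \<pi> \<beta> ` F \<subseteq> F"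
  shows "act \<pi> \<beta> ` F = F"
  by (meson assms act_inj endo_inj_surj inj_on_subset subset_UNIV)

lemma realizes_finite:
  assumes "realizes A B n1 n2 F" "finite A" "finite B"
  shows "finite F"
  using assms unfolding realizes_def by (meson finite_Pow_iff finite_SigmaI finite_subset)

lemma rigidD:
  assumes "rigid A B F" "\<pi> permutes A" "\<beta> permutes B" "\<And>X. X \<in> F \<Longrightarrow> act \<pi> \<beta> X \<in> F"
  shows "\<pi> = id" "\<beta> = id"
  using assms unfolding rigid_def by blast+

text \<open>The image of \<open>S\<close> is a member through the fixed point \<open>e v\<close> of
  the same size as \<open>S\<close>, so it lies among \<open>e 0\<close>, ..., \<open>e t\<close>.
  Hence \<open>\<pi> (e t) = e t'\<close> with \<open>t' \<le> t\<close>, and \<open>t' < t\<close>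
  would contradict injectivity because \<open>e t'\<close> is already fixed. Comparing sizes lets
  members of other sizes be ignored.\<close>

lemma growth:
  fixes e :: "nat \<Rightarrow> 'a"
  assumes inj: "inj_on e {..<M}" and pi: "inj \<pi>"
    and act: "\<And>X. X \<in> F \<Longrightarrow> act \<pi> \<beta> X \<in> F"
    and base: "\<And>t. t < t0 \<Longrightarrow> t < M \<Longrightarrow> \<pi> (e t) = e t"
    and step: "\<And>t. t0 \<le> t \<Longrightarrow> t < M \<Longrightarrow> \<exists>v<t. \<exists>S T. (S, T) \<in> F \<and> e v \<in> S \<and> e t \<in> S \<and>
        (\<forall>S' T'. (S', T') \<in> F \<and> e v \<in> S' \<and> card S' = card S \<longrightarrow> S' \<subseteq> e ` {..t})"
    and "t < M"
  shows "\<pi> (e t) = e t"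
  using \<open>t < M\<close>
proof (induction t rule: less_induct)
  case (less t)
  show ?case
  proof (cases "t < t0")
    case True
    then show ?thesis using base less.prems by blast
  next
    case False
    then obtain v S T where v: "v < t" "(S, T) \<in> F" "e v \<in> S" "e t \<in> S"
      "\<And>S' T'. (S', T') \<in> F \<Longrightarrow> e v \<in> S' \<Longrightarrow> card S' = card S \<Longrightarrow> S' \<subseteq> e ` {..t}"
      using step[of t] less.prems by (metis not_less)
    have "\<pi> (e v) = e v" using less v(1) by simp
    then have "e v \<in> \<pi> ` S" using v(3) by (metis imageI)
    moreover have "(\<pi> ` S, \<beta> ` T) \<in> F" using act[OF v(2)] by simp
    moreover have "card (\<pi> ` S) = card S" using pi by (meson card_image inj_on_subset subset_UNIV)
    ultimately have "\<pi> ` S \<subseteq> e ` {..t}" using v(5) by blast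
    then obtain t' where t': "t' \<le> t" "\<pi> (e t) = e t'" using v(4) by blast
    show ?thesis
    proof (cases "t' = t")
      case False
      then have "t' < t" using t' by simp
      then have "\<pi> (e t') = e t'" using less by simp
      then have "e t = e t'" using t' pi by (metis injD)
      then have "t = t'" using inj less.prems \<open>t' < t\<close> by (auto dest: inj_onD)
      then show ?thesis using \<open>t' < t\<close> by simp
    qed (use t' in simp)
  qed
qed

section \<open>Distinguishing partitions as asymmetric set systems\<close>

definition asymmetric :: "nat \<Rightarrow> nat set set \<Rightarrow> bool" where
  "asymmetric N H \<longleftrightarrow> (\<forall>\<sigma>. \<sigma> permutes {..<N} \<and> (\<lambda>X. \<sigma> ` X) ` H \<subseteq> H \<longrightarrow> \<sigma> = id)"

text \<open>Points of the system are the parts, \<open>sz i\<close> is the size of part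
  \<open>i\<close>, and a member is the set of parts met by one class. In contrast to
  \<open>realizes\<close> the two kinds of parts are not separated, which also covers
  \<open>n1 = n2\<close>.\<close>

definition set_system :: "nat \<Rightarrow> (nat \<Rightarrow> nat) \<Rightarrow> nat set set \<Rightarrow> bool" where
  "set_system N sz H \<longleftrightarrow> H \<subseteq> Pow {..<N} \<and> {} \<notin> H \<and>
     (\<forall>i<N. card {X \<in> H. i \<in> X} = sz i) \<and> asymmetric N H"

abbreviation part_size :: "nat \<Rightarrow> nat \<Rightarrow> nat \<Rightarrow> nat \<Rightarrow> nat" where
  "part_size m1 n1 n2 i \<equiv> (if i < m1 then n1 else n2)"

lemma filter_image:
  assumes "\<And>x. x \<in> S \<Longrightarrow> P (f x) \<longleftrightarrow> Q x"
  shows "{y \<in> f ` S. P y} = f ` {x \<in> S. Q x}"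
  using assms by blast

lemma image_ex: "z \<in> f ` S \<Longrightarrow> \<exists>x\<in>S. z = f x"
  by blast

lemma permutes_inj_endo:
  assumes "finite S" "inj_on f S" "f ` S \<subseteq> S" "\<And>x. x \<notin> S \<Longrightarrow> f x = x"
  shows "f permutes S"
  using assms by (intro bij_imp_permutes) (auto simp: bij_betw_def endo_inj_surj)

lemma mem_pverts:
  "v \<in> pverts (complete_multipartite m1 n1 m2 n2) \<longleftrightarrow> fst v < m1 + m2 \<and> snd v < part_size m1 n1 n2 (fst v)"
  by (cases v) (auto simp: complete_multipartite_def part_def Let_def)

lemma mem_parcs:
  "(u, v) \<in> parcs (complete_multipartite m1 n1 m2 n2) \<longleftrightarrow>
     u \<in> pverts (complete_multipartite m1 n1 m2 n2) \<and> v \<in> pverts (complete_multipartite m1 n1 m2 n2) \<and> fst u \<noteq> fst v"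
  by (simp add: complete_multipartite_def Let_def)

lemma finite_pverts: "finite (pverts (complete_multipartite m1 n1 m2 n2))"
  by (auto simp: complete_multipartite_def part_def Let_def)

text \<open>Matching the vertices of part \<open>i\<close> with the members through \<open>i\<close>
  turns every member \<open>X\<close> into a class that meets exactly the parts in \<open>X\<close>,
  once each. Automorphisms permute the parts, since these are the classes of non-adjacency; once the
  parts are fixed so is every class, and a vertex is determined by its part and its class.\<close>

lemma distinguishing_partition_of_set_system:
  assumes n: "1 \<le> n1" "1 \<le> n2" and H: "set_system (m1 + m2) (part_size m1 n1 n2) H"
  shows "\<exists>P. distinguishing_partition (complete_multipartite m1 n1 m2 n2) P"
proof -
  let ?G = "complete_multipartite m1 n1 m2 n2" and ?N = "m1 + m2" and ?sz = "part_size m1 n1 n2"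
  let ?V = "pverts ?G"
  have sz: "?sz i \<ge> 1" for i using n by simp
  have HN: "H \<subseteq> Pow {..<?N}" "{} \<notin> H" using H by (auto simp: set_system_def)
  have finH: "finite H" using HN(1) finite_subset by blast
  have ex_g: "\<exists>g. bij_betw g {..<?sz i} {X \<in> H. i \<in> X}" if "i < ?N" for i
  proof -
    have 1: "card {X \<in> H. i \<in> X} = ?sz i" using H that by (simp add: set_system_def)
    have "finite {X \<in> H. i \<in> X}" using finH by simp
    then obtain g where "bij_betw g {0..<card {X \<in> H. i \<in> X}} {X \<in> H. i \<in> X}"
      using ex_bij_betw_nat_finite by blast
    then show ?thesis unfolding 1 atLeast0LessThan by blast
  qed
  have "\<exists>g. i < ?N \<longrightarrow> bij_betw g {..<?sz i} {X \<in> H. i \<in> X}" for i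
    by (cases "i < ?N") (use ex_g in simp_all)
  then have "\<forall>i. \<exists>g. i < ?N \<longrightarrow> bij_betw g {..<?sz i} {X \<in> H. i \<in> X}" by (rule allI)
  from choice[OF this] obtain g where g: "\<And>i. i < ?N \<Longrightarrow> bij_betw (g i) {..<?sz i} {X \<in> H. i \<in> X}" by blast
  define h where "h v = g (fst v) (snd v)" for v
  have h: "h v \<in> H" "fst v \<in> h v" if "v \<in> ?V" for v
  proof -
    have v: "fst v < ?N" "snd v < ?sz (fst v)" using that by (auto simp: mem_pverts)
    then have "h v \<in> {X \<in> H. fst v \<in> X}" using g[OF v(1)] unfolding h_def bij_betw_def by auto
    then show "h v \<in> H" "fst v \<in> h v" by auto
  qed
  have h_inj: "u = v" if "u \<in> ?V" "v \<in> ?V" "fst u = fst v" "h u = h v" for u v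
  proof -
    have v: "fst v < ?N" "snd v \<in> {..<?sz (fst v)}" "snd u \<in> {..<?sz (fst v)}" using that by (auto simp: mem_pverts)
    have "inj_on (g (fst v)) {..<?sz (fst v)}" using g[OF v(1)] by (simp add: bij_betw_def)
    then have "snd u = snd v" using that v unfolding h_def by (auto dest: inj_onD)
    then show ?thesis using that(3) by (simp add: prod_eq_iff)
  qed
  define C where "C X = {v \<in> ?V. h v = X}" for X
  have fst_C: "fst ` C X = X" if X: "X \<in> H" for X
  proof (intro equalityI subsetI)
    fix i assume "i \<in> fst ` C X"
    then show "i \<in> X" using h(2) by (auto simp: C_def)
  next
    fix i assume i: "i \<in> X"
    then have iN: "i < ?N" using X HN by blast
    have "X \<in> g i ` {..<?sz i}" using g[OF iN] X i by (auto simp: bij_betw_def)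
    then obtain x where "x < ?sz i" "g i x = X" by blast
    then have "(i, x) \<in> C X" using iN by (simp add: C_def mem_pverts h_def)
    then show "i \<in> fst ` C X" by force
  qed
  have part: "partition_on ?V (C ` H)"
  proof (rule partition_onI)
    show "\<Union>(C ` H) = ?V" using h(1) by (auto simp: C_def)
    show "{} \<notin> C ` H"
    proof
      assume "{} \<in> C ` H"
      then obtain X where "X \<in> H" "C X = {}" by blast
      then show False using fst_C[of X] HN(2) by simp
    qed
    show "disjnt p q" if "p \<in> C ` H" "q \<in> C ` H" "p \<noteq> q" for p q
      using that by (auto simp: C_def disjnt_def)
  qed
  have "\<gamma> = id" if \<gamma>: "\<gamma> \<in> aut ?G" and P: "(\<lambda>C. \<gamma> ` C) ` C ` H = C ` H" for \<gamma>
  proof -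
    have perm: "\<gamma> permutes ?V" and arc: "\<And>u v. u \<in> ?V \<Longrightarrow> v \<in> ?V \<Longrightarrow> fst (\<gamma> u) \<noteq> fst (\<gamma> v) \<longleftrightarrow> fst u \<noteq> fst v"
      using \<gamma> permutes_in_image[of \<gamma> ?V] unfolding aut_def by (auto simp: mem_parcs)
    \<comment> \<open>The vertex \<open>(i, 0)\<close> represents part \<open>i\<close>; it exists
      because part sizes are positive.\<close>
    define \<sigma> where "\<sigma> i = (if i < ?N then fst (\<gamma> (i, 0)) else i)" for i
    have i0: "(i, 0) \<in> ?V" if "i < ?N" for i using that sz[of i] by (simp add: mem_pverts)
    have \<sigma>: "fst (\<gamma> v) = \<sigma> (fst v)" if "v \<in> ?V" for v
    proof -
      have "fst v < ?N" using that by (simp add: mem_pverts)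
      then show ?thesis using arc[OF that i0] by (simp add: \<sigma>_def)
    qed
    have "\<sigma> permutes {..<?N}"
    proof (rule permutes_inj_endo)
      show "inj_on \<sigma> {..<?N}" using arc i0 by (force simp: inj_on_def \<sigma>_def)
      show "\<sigma> ` {..<?N} \<subseteq> {..<?N}"
        using permutes_in_image[OF perm] i0 by (force simp: \<sigma>_def mem_pverts)
    qed (auto simp: \<sigma>_def)
    moreover have img: "\<exists>Y\<in>H. \<gamma> ` C X = C Y \<and> Y = \<sigma> ` X" if X: "X \<in> H" for X
    proof -
      have "\<gamma> ` C X \<in> C ` H" using P X by blast
      then obtain Y where Y: "Y \<in> H" "\<gamma> ` C X = C Y" by blast
      have "Y = fst ` \<gamma> ` C X" using fst_C[OF Y(1)] Y(2) by simp
      also have "\<dots> = \<sigma> ` fst ` C X" unfolding image_image by (rule image_cong) (auto simp: C_def \<sigma>)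
      finally show ?thesis using Y fst_C[OF X] by auto
    qed
    ultimately have \<sigma>id: "\<sigma> = id" using H unfolding set_system_def asymmetric_def by blast
    have "\<gamma> v = v" if v: "v \<in> ?V" for v
    proof -
      have "\<gamma> ` C (h v) = C (h v)" using img[OF h(1)[OF v]] \<sigma>id by auto
      moreover have "v \<in> C (h v)" using v by (simp add: C_def)
      ultimately have "\<gamma> v \<in> C (h v)" by blast
      then have "\<gamma> v \<in> ?V" "h (\<gamma> v) = h v" by (auto simp: C_def)
      then show ?thesis using h_inj \<sigma>[OF v] \<sigma>id v by simp
    qed
    then have "\<gamma> v = id v" for v using permutes_not_in[OF perm] by (cases "v \<in> ?V") simp_all
    then show ?thesis by (rule ext)
  qed
  then show ?thesis using part unfolding distinguishing_partition_def by blast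
qed

text \<open>Two vertices of one part in a common class could be transposed, so a class meets each
  part at most once. Every compatible pair of permutations of parts and of classes then lifts to an
  automorphism; this is \<open>key\<close>, from which it follows both that classes are determined
  by their sets of parts and that the resulting system is asymmetric.\<close>

lemma set_system_of_distinguishing_partition:
  assumes n: "1 \<le> n1" "1 \<le> n2" and P: "distinguishing_partition (complete_multipartite m1 n1 m2 n2) P"
  shows "\<exists>H. set_system (m1 + m2) (part_size m1 n1 n2) H"
proof -
  let ?G = "complete_multipartite m1 n1 m2 n2" and ?N = "m1 + m2" and ?sz = "part_size m1 n1 n2"
  let ?V = "pverts ?G"
  have part: "partition_on ?V P" and dist: "\<And>\<gamma>. \<gamma> \<in> aut ?G \<Longrightarrow> (\<lambda>C. \<gamma> ` C) ` P = P \<Longrightarrow> \<gamma> = id"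
    using P by (auto simp: distinguishing_partition_def)
  have finV: "finite ?V" by (rule finite_pverts)
  have PV: "\<Union>P = ?V" and disj: "\<And>C D x. C \<in> P \<Longrightarrow> D \<in> P \<Longrightarrow> x \<in> C \<Longrightarrow> x \<in> D \<Longrightarrow> C = D" and ne: "{} \<notin> P"
    using part by (auto simp: partition_on_def disjoint_def)
  have autI: "\<gamma> \<in> aut ?G" if "\<gamma> permutes ?V" "\<And>u v. u \<in> ?V \<Longrightarrow> v \<in> ?V \<Longrightarrow> fst (\<gamma> u) = fst (\<gamma> v) \<longleftrightarrow> fst u = fst v" for \<gamma>
    using that permutes_in_image[OF that(1)] by (auto simp: aut_def mem_parcs)
  have inj: "u = v" if C: "C \<in> P" "u \<in> C" "v \<in> C" "fst u = fst v" for C u v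
  proof (rule ccontr)
    assume uv: "u \<noteq> v"
    have uvV: "u \<in> ?V" "v \<in> ?V" using C PV by auto
    let ?\<gamma> = "transpose u v"
    have "?\<gamma> permutes ?V" using uvV by (rule permutes_swap_id)
    moreover have "fst (?\<gamma> w) = fst w" for w using C(4) by (simp add: transpose_def)
    ultimately have "?\<gamma> \<in> aut ?G" by (intro autI) auto
    moreover have "?\<gamma> ` D = D" if D: "D \<in> P" for D
    proof -
      have "u \<in> D \<longleftrightarrow> v \<in> D" using disj[OF C(1) D] C by blast
      then show ?thesis by (auto simp: transpose_image_eq)
    qed
    then have "(\<lambda>C. ?\<gamma> ` C) ` P = P" by simp
    ultimately have "?\<gamma> = id" by (rule dist)
    then show False using uv by (metis id_apply transpose_apply_first)
  qed
  have "\<exists>C\<in>P. v \<in> C" if "v \<in> ?V" for v using PV that by blast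
  then have "\<forall>v. \<exists>C. v \<in> ?V \<longrightarrow> C \<in> P \<and> v \<in> C" by blast
  from choice[OF this] obtain cl where cl: "\<And>v. v \<in> ?V \<Longrightarrow> cl v \<in> P \<and> v \<in> cl v" by blast
  have cl_eq: "cl v = C" if "C \<in> P" "v \<in> C" for C v
    using that cl[of v] disj PV by blast
  have key: "\<sigma> = id \<and> (\<forall>C\<in>P. \<theta> C = C)"
    if \<sigma>: "\<sigma> permutes {..<?N}" and \<theta>: "bij_betw \<theta> P P" and \<sigma>\<theta>: "\<And>C. C \<in> P \<Longrightarrow> fst ` \<theta> C = \<sigma> ` fst ` C" for \<sigma> \<theta>
  proof -
    have \<theta>P: "\<theta> C \<in> P" if "C \<in> P" for C using \<theta> that by (auto simp: bij_betw_def)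
    \<comment> \<open>The lift sends \<open>v\<close> to the vertex of the class
      \<open>\<theta> (cl v)\<close> that lies in the part \<open>\<sigma> (fst v)\<close>.\<close>
    have "\<exists>w. w \<in> \<theta> (cl v) \<and> fst w = \<sigma> (fst v)" if v: "v \<in> ?V" for v
    proof -
      have "\<sigma> (fst v) \<in> fst ` \<theta> (cl v)" using \<sigma>\<theta>[of "cl v"] cl[OF v] by simp
      then show ?thesis by force
    qed
    then have "\<forall>v. \<exists>w. v \<in> ?V \<longrightarrow> w \<in> \<theta> (cl v) \<and> fst w = \<sigma> (fst v)" by blast
    from choice[OF this] obtain g where g: "\<And>v. v \<in> ?V \<Longrightarrow> g v \<in> \<theta> (cl v) \<and> fst (g v) = \<sigma> (fst v)" by blast
    define \<gamma> where "\<gamma> v = (if v \<in> ?V then g v else v)" for v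
    have \<gamma>: "\<gamma> v \<in> \<theta> (cl v)" "fst (\<gamma> v) = \<sigma> (fst v)" if "v \<in> ?V" for v using g[OF that] that by (auto simp: \<gamma>_def)
    have \<gamma>V: "\<gamma> v \<in> ?V" if "v \<in> ?V" for v using \<gamma>(1)[OF that] \<theta>P cl[OF that] PV by blast
    have \<sigma>inj: "inj \<sigma>" by (rule permutes_inj[OF \<sigma>])
    have perm: "\<gamma> permutes ?V"
    proof (rule permutes_inj_endo[OF finV])
      show "inj_on \<gamma> ?V"
      proof (rule inj_onI)
        fix u v assume uv: "u \<in> ?V" "v \<in> ?V" "\<gamma> u = \<gamma> v"
        then have "\<theta> (cl u) = \<theta> (cl v)" using \<gamma>(1) \<theta>P cl disj by metis
        moreover have "inj_on \<theta> P" using \<theta> by (simp add: bij_betw_def)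
        ultimately have "cl u = cl v" using cl uv(1,2) by (meson inj_onD)
        moreover have "fst u = fst v" using \<gamma>(2) uv \<sigma>inj by (metis injD)
        ultimately show "u = v" using inj[of "cl u" u v] cl uv by metis
      qed
    qed (use \<gamma>V in \<open>auto simp: \<gamma>_def\<close>)
    have "\<gamma> \<in> aut ?G" by (rule autI[OF perm]) (use \<gamma>(2) \<sigma>inj in \<open>auto simp: inj_eq\<close>)
    moreover have img: "\<gamma> ` C = \<theta> C" if C: "C \<in> P" for C
    proof (intro equalityI subsetI)
      fix w assume "w \<in> \<gamma> ` C"
      then obtain v where v: "v \<in> C" "w = \<gamma> v" by blast
      then have vV: "v \<in> ?V" "cl v = C" using C PV cl_eq by auto
      show "w \<in> \<theta> C" using \<gamma>(1)[OF vV(1)] unfolding vV(2) v(2) .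
    next
      fix w assume w: "w \<in> \<theta> C"
      then have "fst w \<in> \<sigma> ` fst ` C" using \<sigma>\<theta>[OF C] by blast
      then obtain v where v: "v \<in> C" "fst w = \<sigma> (fst v)" by blast
      then have vV: "v \<in> ?V" "cl v = C" using C PV cl_eq by auto
      then have "\<gamma> v \<in> \<theta> C" "fst (\<gamma> v) = fst w" using \<gamma>[OF vV(1)] v by auto
      then have "\<gamma> v = w" using inj[OF \<theta>P[OF C]] w by blast
      then show "w \<in> \<gamma> ` C" using v by blast
    qed
    moreover have "(\<lambda>C. \<gamma> ` C) ` P = P"
    proof -
      have "(\<lambda>C. \<gamma> ` C) ` P = \<theta> ` P" by (rule image_cong) (use img in auto)
      then show ?thesis using \<theta> by (simp add: bij_betw_def)
    qed
    ultimately have id: "\<gamma> = id" using dist by blast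
    have "\<sigma> i = i" for i
    proof (cases "i < ?N")
      case True
      then have "(i, 0) \<in> ?V" using n by (simp add: mem_pverts)
      then show ?thesis using \<gamma>(2)[of "(i, 0)"] id by simp
    next
      case False
      then show ?thesis using \<sigma> by (simp add: permutes_def)
    qed
    then show ?thesis using img id by auto
  qed
  let ?g = "\<lambda>C. fst ` C"
  have g_inj: "inj_on ?g P"
  proof (rule inj_onI, rule ccontr)
    fix C D assume CD: "C \<in> P" "D \<in> P" "fst ` C = fst ` D" "C \<noteq> D"
    have "transpose C D permutes P" using CD(1,2) by (rule permutes_swap_id)
    then have "bij_betw (transpose C D) P P" by (rule permutes_imp_bij)
    moreover have "fst ` transpose C D E = id ` fst ` E" for E using CD(3) by (simp add: transpose_def)
    ultimately have "transpose C D C = C" using key[OF permutes_id, of "transpose C D"] CD(1) by blast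
    then show False using CD(4) by simp
  qed
  let ?H = "?g ` P"
  have bij: "bij_betw ?g P ?H" using g_inj by (simp add: bij_betw_def)
  have HN: "?H \<subseteq> Pow {..<?N}"
  proof
    fix X assume "X \<in> ?H"
    then obtain C where C: "C \<in> P" "X = fst ` C" by blast
    have "fst v < ?N" if "v \<in> C" for v using C PV that mem_pverts by blast
    then show "X \<in> Pow {..<?N}" using C by auto
  qed
  have finH: "finite ?H" using HN finite_subset by blast
  have deg: "card {X \<in> ?H. i \<in> X} = ?sz i" if i: "i < ?N" for i
  proof -
    have "bij_betw (\<lambda>x. fst ` cl (i, x)) {..<?sz i} {X \<in> ?H. i \<in> X}"
    proof (rule bij_betwI')
      fix x y assume "x \<in> {..<?sz i}" "y \<in> {..<?sz i}"
      then have V: "(i, x) \<in> ?V" "(i, y) \<in> ?V" using i by (auto simp: mem_pverts)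
      show "fst ` cl (i, x) = fst ` cl (i, y) \<longleftrightarrow> x = y"
      proof
        assume "fst ` cl (i, x) = fst ` cl (i, y)"
        then have "cl (i, x) = cl (i, y)" using g_inj cl V by (metis inj_onD)
        then have "(i, x) = (i, y)" using inj[of "cl (i, x)" "(i, x)" "(i, y)"] cl[OF V(1)] cl[OF V(2)] by simp
        then show "x = y" by simp
      qed simp
    next
      fix x assume "x \<in> {..<?sz i}"
      then have V: "(i, x) \<in> ?V" using i by (simp add: mem_pverts)
      then show "fst ` cl (i, x) \<in> {X \<in> ?H. i \<in> X}" using cl[OF V] by force
    next
      fix X assume "X \<in> {X \<in> ?H. i \<in> X}"
      then obtain C v where C: "C \<in> P" "X = fst ` C" "v \<in> C" "i = fst v" by auto
      then have "v \<in> ?V" using PV by blast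
      then have "snd v < ?sz i" using C by (simp add: mem_pverts)
      moreover have "cl (i, snd v) = C" using C cl_eq by (metis prod.collapse)
      ultimately show "\<exists>x\<in>{..<?sz i}. X = fst ` cl (i, x)" using C(2) by blast
    qed
    from bij_betw_same_card[OF this] show ?thesis unfolding card_lessThan by (rule sym)
  qed
  have "asymmetric ?N ?H" unfolding asymmetric_def
  proof (intro allI impI, elim conjE)
    fix \<sigma> assume \<sigma>: "\<sigma> permutes {..<?N}" and H: "(\<lambda>X. \<sigma> ` X) ` ?H \<subseteq> ?H"
    have inj\<sigma>: "inj_on (\<lambda>X. \<sigma> ` X) ?H" using permutes_inj[OF \<sigma>] by (auto simp: inj_on_def inj_image_eq_iff)
    then have "bij_betw (\<lambda>X. \<sigma> ` X) ?H ?H" using H finH by (simp add: bij_betw_def endo_inj_surj)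
    then have "bij_betw ((\<lambda>X. \<sigma> ` X) \<circ> ?g) P ?H" using bij bij_betw_trans by blast
    then have "bij_betw (inv_into P ?g \<circ> ((\<lambda>X. \<sigma> ` X) \<circ> ?g)) P P"
      using bij_betw_inv_into[OF bij] bij_betw_trans by blast
    moreover have "fst ` (inv_into P ?g \<circ> ((\<lambda>X. \<sigma> ` X) \<circ> ?g)) C = \<sigma> ` fst ` C" if "C \<in> P" for C
    proof -
      have "\<sigma> ` fst ` C \<in> ?H" using H that by blast
      then show ?thesis using f_inv_into_f[of "\<sigma> ` fst ` C" ?g P] by simp
    qed
    ultimately show "\<sigma> = id" using key[OF \<sigma>] by blast
  qed
  then have "set_system ?N ?sz ?H" using HN ne deg by (auto simp: set_system_def)
  then show ?thesis by blast
qed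

text \<open>Members are cut along \<open>A\<close> and \<open>B\<close>; permutations of
  \<open>A\<close> and of \<open>B\<close> combine into one permutation of all parts, so asymmetry
  gives rigidity.\<close>

lemma realizes_of_set_system:
  assumes H: "set_system (m1 + m2) (part_size m1 n1 n2) H"
  shows "\<exists>F. realizes {..<m1} {m1..<m1 + m2} n1 n2 F"
proof -
  let ?A = "{..<m1}" and ?B = "{m1..<m1 + m2}" and ?N = "m1 + m2"
  let ?f = "\<lambda>X. (X \<inter> ?A, X \<inter> ?B)"
  let ?F = "?f ` H"
  have HN: "H \<subseteq> Pow {..<?N}" "{} \<notin> H" using H by (auto simp: set_system_def)
  have AB: "X = X \<inter> ?A \<union> X \<inter> ?B" if "X \<in> H" for X
  proof -
    have "X \<subseteq> {..<?N}" using HN that by blast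
    moreover have "{..<?N} = ?A \<union> ?B" by auto
    ultimately show ?thesis by blast
  qed
  have inj: "inj_on ?f H" by (rule inj_onI) (metis AB prod.inject)
  have deg: "card {X \<in> H. i \<in> X} = part_size m1 n1 n2 i" if "i < ?N" for i
    using H that by (simp add: set_system_def)
  have "card {Y \<in> ?F. a \<in> fst Y} = n1" if "a \<in> ?A" for a
  proof -
    have "{Y \<in> ?F. a \<in> fst Y} = ?f ` {X \<in> H. a \<in> X}" by (rule filter_image) (use that in simp)
    also have "card \<dots> = card {X \<in> H. a \<in> X}" by (rule card_image[OF inj_on_subset[OF inj]]) auto
    finally show ?thesis using deg[of a] that by simp
  qed
  moreover have "card {Y \<in> ?F. b \<in> snd Y} = n2" if "b \<in> ?B" for b
  proof -
    have "{Y \<in> ?F. b \<in> snd Y} = ?f ` {X \<in> H. b \<in> X}" by (rule filter_image) (use that in simp)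
    also have "card \<dots> = card {X \<in> H. b \<in> X}" by (rule card_image[OF inj_on_subset[OF inj]]) auto
    finally show ?thesis using deg[of b] that by simp
  qed
  moreover have "rigid ?A ?B ?F" unfolding rigid_def
  proof (intro allI impI, elim conjE)
    fix \<pi> \<beta> assume \<pi>: "\<pi> permutes ?A" and \<beta>: "\<beta> permutes ?B" and img: "act \<pi> \<beta> ` ?F \<subseteq> ?F"
    let ?\<sigma> = "\<pi> \<circ> \<beta>"
    have "\<pi> permutes {..<?N}" "\<beta> permutes {..<?N}" using \<pi> \<beta> by (auto intro: permutes_subset)
    then have "?\<sigma> permutes {..<?N}" by (metis permutes_compose)
    have \<sigma>A: "?\<sigma> a = \<pi> a" if "a \<in> ?A" for a using \<beta> that by (simp add: permutes_def)
    have \<sigma>B: "?\<sigma> b = \<beta> b" if "b \<in> ?B" for b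
      using \<pi> permutes_in_image[OF \<beta>, of b] that by (simp add: permutes_def)
    have "(\<lambda>X. ?\<sigma> ` X) ` H \<subseteq> H"
    proof
      fix Z assume "Z \<in> (\<lambda>X. ?\<sigma> ` X) ` H"
      then obtain X where X: "X \<in> H" "Z = ?\<sigma> ` X" by blast
      have "act \<pi> \<beta> (?f X) \<in> ?F" using img X(1) by blast
      then obtain Y where Y: "Y \<in> H" "\<pi> ` (X \<inter> ?A) = Y \<inter> ?A" "\<beta> ` (X \<inter> ?B) = Y \<inter> ?B" by auto
      have "?\<sigma> ` X = ?\<sigma> ` (X \<inter> ?A) \<union> ?\<sigma> ` (X \<inter> ?B)" using AB[OF X(1)] by (metis image_Un)
      also have "?\<sigma> ` (X \<inter> ?A) = \<pi> ` (X \<inter> ?A)" by (rule image_cong) (use \<sigma>A in auto)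
      also have "?\<sigma> ` (X \<inter> ?B) = \<beta> ` (X \<inter> ?B)" by (rule image_cong) (use \<sigma>B in auto)
      finally have "Z = Y" using Y X(2) AB[OF Y(1)] by simp
      then show "Z \<in> H" using Y by simp
    qed
    then have \<sigma>id: "?\<sigma> = id"
      using H \<open>?\<sigma> permutes {..<?N}\<close> unfolding set_system_def asymmetric_def by blast
    have "\<pi> x = x" for x using \<sigma>A[of x] \<sigma>id \<pi> by (cases "x \<in> ?A") (auto simp: permutes_def)
    moreover have "\<beta> x = x" for x using \<sigma>B[of x] \<sigma>id \<beta> by (cases "x \<in> ?B") (auto simp: permutes_def)
    ultimately show "\<pi> = id \<and> \<beta> = id" by auto
  qed
  moreover have "?F \<subseteq> Pow ?A \<times> Pow ?B" by auto
  moreover have "({}, {}) \<notin> ?F"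
  proof
    assume "({}, {}) \<in> ?F"
    then obtain X where X: "X \<in> H" "X \<inter> ?A = {}" "X \<inter> ?B = {}" by auto
    then have "X = {}" using AB[OF X(1)] by simp
    then show False using X(1) HN(2) by simp
  qed
  ultimately show ?thesis unfolding realizes_def by blast
qed

text \<open>The degrees \<open>n1\<close> and \<open>n2\<close> tell \<open>A\<close> from
  \<open>B\<close>, so an automorphism of the united system splits into permutations of
  \<open>A\<close> and of \<open>B\<close>. The alternative \<open>m2 = 0\<close> serves the case of
  equal part sizes, where all parts are put into \<open>A\<close>.\<close>

lemma set_system_of_realizes:
  assumes F: "realizes {..<m1} {m1..<m1 + m2} n1 n2 F" and n: "n1 \<noteq> n2 \<or> m2 = 0"
  shows "\<exists>H. set_system (m1 + m2) (part_size m1 n1 n2) H"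
proof -
  let ?A = "{..<m1}" and ?B = "{m1..<m1 + m2}" and ?N = "m1 + m2"
  let ?f = "\<lambda>X. fst X \<union> snd X"
  let ?H = "?f ` F"
  have sub: "F \<subseteq> Pow ?A \<times> Pow ?B" using F by (simp add: realizes_def)
  have finF: "finite F" using F realizes_finite by blast
  have FA: "fst X = ?f X \<inter> ?A" "snd X = ?f X \<inter> ?B" if "X \<in> F" for X
  proof -
    have "fst X \<subseteq> ?A" "snd X \<subseteq> ?B" using family_subset[OF sub that] .
    then show "fst X = ?f X \<inter> ?A" "snd X = ?f X \<inter> ?B" by fastforce+
  qed
  have inj: "inj_on ?f F"
  proof (rule inj_onI)
    fix X Y assume XY: "X \<in> F" "Y \<in> F" "?f X = ?f Y"
    have "fst X = fst Y" "snd X = snd Y" using FA[OF XY(1)] FA[OF XY(2)] XY(3) by simp_all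
    then show "X = Y" by (rule prod_eqI)
  qed
  have deg: "card {Z \<in> ?H. i \<in> Z} = part_size m1 n1 n2 i" if i: "i < ?N" for i
  proof (cases "i < m1")
    case True
    have "{Z \<in> ?H. i \<in> Z} = ?f ` {X \<in> F. i \<in> fst X}"
    proof (rule filter_image)
      fix X assume "X \<in> F"
      then show "i \<in> ?f X \<longleftrightarrow> i \<in> fst X" using family_subset(2)[OF sub, of X] True by auto
    qed
    also have "card \<dots> = card {X \<in> F. i \<in> fst X}" by (rule card_image[OF inj_on_subset[OF inj]]) auto
    finally show ?thesis using F True by (simp add: realizes_def)
  next
    case False
    have "{Z \<in> ?H. i \<in> Z} = ?f ` {X \<in> F. i \<in> snd X}"
    proof (rule filter_image)
      fix X assume "X \<in> F"
      then show "i \<in> ?f X \<longleftrightarrow> i \<in> snd X" using family_subset(1)[OF sub, of X] False by auto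
    qed
    also have "card \<dots> = card {X \<in> F. i \<in> snd X}" by (rule card_image[OF inj_on_subset[OF inj]]) auto
    finally show ?thesis using F False i by (simp add: realizes_def)
  qed
  have "asymmetric ?N ?H" unfolding asymmetric_def
  proof (intro allI impI, elim conjE)
    fix \<sigma> assume \<sigma>: "\<sigma> permutes {..<?N}" and img: "(\<lambda>X. \<sigma> ` X) ` ?H \<subseteq> ?H"
    have inj\<sigma>: "inj \<sigma>" by (rule permutes_inj[OF \<sigma>])
    have injI: "inj (\<lambda>X. \<sigma> ` X)" using inj\<sigma> by (simp add: inj_def inj_image_eq_iff)
    have eq: "(\<lambda>X. \<sigma> ` X) ` ?H = ?H"
      by (rule endo_inj_surj[OF _ img]) (use finF injI inj_on_subset in auto)
    have "card {Z \<in> ?H. \<sigma> i \<in> Z} = card {Z \<in> ?H. i \<in> Z}" for i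
    proof -
      have "{Z \<in> ?H. \<sigma> i \<in> Z} = (\<lambda>X. \<sigma> ` X) ` {Z \<in> ?H. i \<in> Z}"
      proof (intro equalityI subsetI)
        fix Z assume Z: "Z \<in> {Z \<in> ?H. \<sigma> i \<in> Z}"
        then have "Z \<in> (\<lambda>X. \<sigma> ` X) ` ?H" using eq by simp
        from image_ex[OF this] obtain Y where "Y \<in> ?H" "Z = \<sigma> ` Y" by (elim bexE)
        then show "Z \<in> (\<lambda>X. \<sigma> ` X) ` {Z \<in> ?H. i \<in> Z}"
          using Z inj_image_mem_iff[OF inj\<sigma>] by blast
      next
        fix Z assume "Z \<in> (\<lambda>X. \<sigma> ` X) ` {Z \<in> ?H. i \<in> Z}"
        then obtain Y where "Y \<in> ?H" "i \<in> Y" "Z = \<sigma> ` Y" by blast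
        moreover from this have "Z \<in> ?H" using subsetD[OF img imageI] by metis
        ultimately show "Z \<in> {Z \<in> ?H. \<sigma> i \<in> Z}" by simp
      qed
      moreover have "inj_on (\<lambda>X. \<sigma> ` X) {Z \<in> ?H. i \<in> Z}" using injI by (rule inj_on_subset) simp
      ultimately show ?thesis by (simp only: card_image)
    qed
    then have A_iff: "\<sigma> i < m1 \<longleftrightarrow> i < m1" if "i < ?N" for i
      using deg[OF that] deg[of "\<sigma> i"] permutes_in_image[OF \<sigma>, of i] that n by (auto split: if_splits)
    define \<pi> where "\<pi> i = (if i \<in> ?A then \<sigma> i else i)" for i
    define \<beta> where "\<beta> i = (if i \<in> ?B then \<sigma> i else i)" for i
    have N: "\<sigma> i < ?N" if "i < ?N" for i using permutes_in_image[OF \<sigma>, of i] that by simp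
    have \<pi>: "\<pi> permutes ?A"
    proof (rule permutes_inj_endo)
      show "inj_on \<pi> ?A"
      proof (rule inj_onI)
        fix x y assume "x \<in> ?A" "y \<in> ?A" "\<pi> x = \<pi> y"
        then have "\<sigma> x = \<sigma> y" by (simp add: \<pi>_def)
        then show "x = y" by (rule injD[OF inj\<sigma>])
      qed
      show "\<pi> ` ?A \<subseteq> ?A"
      proof
        fix y assume "y \<in> \<pi> ` ?A"
        then obtain x where "x < m1" "y = \<pi> x" by blast
        then show "y \<in> ?A" using A_iff[of x] by (simp add: \<pi>_def)
      qed
    qed (auto simp: \<pi>_def)
    have \<beta>: "\<beta> permutes ?B"
    proof (rule permutes_inj_endo)
      show "inj_on \<beta> ?B"
      proof (rule inj_onI)
        fix x y assume "x \<in> ?B" "y \<in> ?B" "\<beta> x = \<beta> y"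
        then have "\<sigma> x = \<sigma> y" by (simp add: \<beta>_def)
        then show "x = y" by (rule injD[OF inj\<sigma>])
      qed
      show "\<beta> ` ?B \<subseteq> ?B"
      proof
        fix y assume "y \<in> \<beta> ` ?B"
        then obtain x where "x \<in> ?B" "y = \<beta> x" by blast
        then show "y \<in> ?B" using A_iff[of x] N[of x] by (simp add: \<beta>_def)
      qed
    qed (auto simp: \<beta>_def)
    have "act \<pi> \<beta> X \<in> F" if X: "X \<in> F" for X
    proof -
      have XAB: "fst X \<subseteq> ?A" "snd X \<subseteq> ?B" using family_subset[OF sub X] .
      have "\<sigma> ` ?f X \<in> ?H" using img X by blast
      then obtain Y where Y: "Y \<in> F" "\<sigma> ` ?f X = ?f Y" by blast
      have 1: "\<pi> ` fst X = \<sigma> ` fst X" by (rule image_cong) (use XAB in \<open>auto simp: \<pi>_def\<close>)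
      have 2: "\<beta> ` snd X = \<sigma> ` snd X" by (rule image_cong) (use XAB in \<open>auto simp: \<beta>_def\<close>)
      have s1: "\<sigma> ` fst X \<subseteq> ?A" using permutes_image[OF \<pi>] XAB(1) 1 by blast
      have s2: "\<sigma> ` snd X \<subseteq> ?B" using permutes_image[OF \<beta>] XAB(2) 2 by blast
      have "?f Y = \<sigma> ` fst X \<union> \<sigma> ` snd X" using Y(2) by (simp add: image_Un)
      then have "fst Y = (\<sigma> ` fst X \<union> \<sigma> ` snd X) \<inter> ?A" "snd Y = (\<sigma> ` fst X \<union> \<sigma> ` snd X) \<inter> ?B"
        using FA[OF Y(1)] by simp_all
      moreover have "(\<sigma> ` fst X \<union> \<sigma> ` snd X) \<inter> ?A = \<sigma> ` fst X" "(\<sigma> ` fst X \<union> \<sigma> ` snd X) \<inter> ?B = \<sigma> ` snd X"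
        using s1 s2 by fastforce+
      ultimately have "act \<pi> \<beta> X = Y" using 1 2 by (simp add: act_def prod_eq_iff)
      then show ?thesis using Y(1) by simp
    qed
    moreover have "rigid ?A ?B F" using F by (simp add: realizes_def)
    ultimately have id: "\<pi> = id" "\<beta> = id" using rigidD[OF _ \<pi> \<beta>] by blast+
    show "\<sigma> = id"
    proof
      fix i
      show "\<sigma> i = id i"
      proof (cases "i < ?N")
        case True
        then show ?thesis using fun_cong[OF id(1), of i] fun_cong[OF id(2), of i] by (auto simp: \<pi>_def \<beta>_def split: if_splits)
      next
        case False
        then show ?thesis using \<sigma> by (simp add: permutes_def)
      qed
    qed
  qed
  moreover have "?H \<subseteq> Pow {..<?N}"
  proof
    fix Z assume "Z \<in> ?H"
    then obtain X where X: "X \<in> F" "Z = ?f X" by blast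
    then show "Z \<in> Pow {..<?N}" using family_subset[OF sub X(1)] by fastforce
  qed
  moreover have "{} \<notin> ?H" using F by (auto simp: realizes_def)
  ultimately have "set_system ?N (part_size m1 n1 n2) ?H" using deg by (simp add: set_system_def)
  then show ?thesis by blast
qed

lemma distinguishing_partition_iff_realizes:
  assumes "1 \<le> n1" "1 \<le> n2" "n1 \<noteq> n2"
  shows "(\<exists>P. distinguishing_partition (complete_multipartite m1 n1 m2 n2) P) \<longleftrightarrow>
    (\<exists>F. realizes {..<m1} {m1..<m1 + m2} n1 n2 F)"
  using assms distinguishing_partition_of_set_system set_system_of_distinguishing_partition
    realizes_of_set_system set_system_of_realizes by metis

text \<open>Here automorphisms may mix the two kinds of parts, so all \<open>m1 + m2\<close> parts
  of the common size form \<open>A\<close>, and \<open>B\<close> is empty.\<close>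

lemma distinguishing_partition_equal_parts:
  assumes "1 \<le> n" "realizes {..<m1 + m2} ({} :: nat set) n n' F"
  shows "\<exists>P. distinguishing_partition (complete_multipartite m1 n m2 n) P"
proof -
  have "realizes {..<m1 + m2} {m1 + m2..<m1 + m2 + 0} n n' F" using assms(2) by simp
  then obtain H where "set_system (m1 + m2 + 0) (part_size (m1 + m2) n n') H"
    using set_system_of_realizes by blast
  then have "set_system (m1 + m2) (part_size m1 n n) H" by (simp add: set_system_def)
  then show ?thesis using distinguishing_partition_of_set_system assms(1) by blast
qed

section \<open>Connected components and their counting bounds\<close>

definition closed_in :: "'a set \<Rightarrow> ('a set \<times> 'b set) set \<Rightarrow> 'a set \<Rightarrow> bool" where
  "closed_in A F D \<longleftrightarrow> D \<subseteq> A \<and> (\<forall>X\<in>F. fst X \<inter> D \<noteq> {} \<longrightarrow> fst X \<subseteq> D)"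

text \<open>Connectivity is encoded by closed sets instead of walks: these are stable under
  intersection and difference, and the component is the least one around \<open>a\<close>.\<close>

definition component :: "'a set \<Rightarrow> ('a set \<times> 'b set) set \<Rightarrow> 'a \<Rightarrow> 'a set" where
  "component A F a = \<Inter>{D. closed_in A F D \<and> a \<in> D}"

definition comps :: "'a set \<Rightarrow> ('a set \<times> 'b set) set \<Rightarrow> 'a set set" where
  "comps A F = component A F ` A"

definition meeting :: "('a set \<times> 'b set) set \<Rightarrow> 'a set \<Rightarrow> ('a set \<times> 'b set) set" where
  "meeting F D = {X \<in> F. fst X \<inter> D \<noteq> {}}"

text \<open>These are the classes counted by the duality inequality: a class with empty second
  component uses incidences with \<open>A\<close> and yields none with \<open>B\<close>.\<close>

definition coloured :: "('a set \<times> 'b set) set \<Rightarrow> 'a set \<Rightarrow> ('a set \<times> 'b set) set" where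
  "coloured F D = {X \<in> F. fst X \<inter> D \<noteq> {} \<and> snd X \<noteq> {}}"

lemma closed_inD: "closed_in A F D \<Longrightarrow> X \<in> F \<Longrightarrow> fst X \<inter> D \<noteq> {} \<Longrightarrow> fst X \<subseteq> D"
  by (simp add: closed_in_def)

lemma closed_in_subset: "closed_in A F D \<Longrightarrow> D \<subseteq> A"
  by (simp add: closed_in_def)

lemma closed_in_Diff: "closed_in A F D \<Longrightarrow> closed_in A F E \<Longrightarrow> closed_in A F (D - E)"
  unfolding closed_in_def by blast

lemma closed_in_Union: "(\<And>D. D \<in> \<D> \<Longrightarrow> closed_in A F D) \<Longrightarrow> closed_in A F (\<Union>\<D>)"
  unfolding closed_in_def by blast

lemma closed_in_component:
  assumes "F \<subseteq> Pow A \<times> Pow B" "a \<in> A"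
  shows "closed_in A F (component A F a)"
proof -
  have "closed_in A F A" using family_subset(1)[OF assms(1)] by (auto simp: closed_in_def)
  then have "component A F a \<subseteq> A" using assms(2) by (auto simp: component_def)
  moreover have "fst X \<subseteq> component A F a" if X: "X \<in> F" "fst X \<inter> component A F a \<noteq> {}" for X
    unfolding component_def
  proof (rule Inter_greatest)
    fix D assume D: "D \<in> {D. closed_in A F D \<and> a \<in> D}"
    then have "component A F a \<subseteq> D" by (auto simp: component_def)
    then have "fst X \<inter> D \<noteq> {}" using X(2) by blast
    then show "fst X \<subseteq> D" using D X(1) by (simp add: closed_in_def)
  qed
  ultimately show ?thesis unfolding closed_in_def by blast
qed

lemma in_component: "a \<in> component A F a"
  by (simp add: component_def)

lemma component_minimal: "closed_in A F D \<Longrightarrow> a \<in> D \<Longrightarrow> component A F a \<subseteq> D"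
  by (auto simp: component_def)

text \<open>If \<open>a\<close> were outside the component of \<open>b\<close>, removing that
  component would leave a smaller closed set around \<open>a\<close>.\<close>

lemma component_eq:
  assumes F: "F \<subseteq> Pow A \<times> Pow B" and a: "a \<in> A" and b: "b \<in> component A F a"
  shows "component A F b = component A F a"
proof -
  have cl: "closed_in A F (component A F a)" by (rule closed_in_component[OF F a])
  then have "b \<in> A" using b closed_in_subset by blast
  then have cl': "closed_in A F (component A F b)" by (rule closed_in_component[OF F])
  have sub: "component A F b \<subseteq> component A F a" using component_minimal[OF cl b] .
  have "a \<in> component A F b"
  proof (rule ccontr)
    assume "a \<notin> component A F b"
    then have "component A F a \<subseteq> component A F a - component A F b"
      using component_minimal[OF closed_in_Diff[OF cl cl']] in_component by fast
    then show False using b in_component[of b A F] by blast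
  qed
  then show ?thesis using component_minimal[OF cl'] sub by blast
qed

lemma comps_disjoint:
  assumes F: "F \<subseteq> Pow A \<times> Pow B" and "K \<in> comps A F" "K' \<in> comps A F" "K \<noteq> K'"
  shows "K \<inter> K' = {}"
proof (rule ccontr)
  assume "K \<inter> K' \<noteq> {}"
  then obtain x where x: "x \<in> K" "x \<in> K'" by blast
  obtain a a' where "a \<in> A" "K = component A F a" "a' \<in> A" "K' = component A F a'"
    using assms by (auto simp: comps_def)
  then have "component A F x = K" "component A F x = K'" using component_eq[OF F] x by metis+
  then show False using assms(4) by simp
qed

lemma comps_closed: "F \<subseteq> Pow A \<times> Pow B \<Longrightarrow> K \<in> comps A F \<Longrightarrow> closed_in A F K"
  by (auto simp: comps_def intro: closed_in_component)

lemma comps_nonempty: "K \<in> comps A F \<Longrightarrow> K \<noteq> {}"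
  using in_component by (fastforce simp: comps_def)

lemma Union_comps:
  assumes "F \<subseteq> Pow A \<times> Pow B"
  shows "\<Union>(comps A F) = A"
  using closed_in_subset[OF closed_in_component[OF assms]] in_component[of _ A F] by (auto simp: comps_def)

lemma comps_crossing:
  assumes F: "F \<subseteq> Pow A \<times> Pow B" and K: "K \<in> comps A F" and U: "U \<subseteq> K" "U \<noteq> {}" "U \<noteq> K"
  shows "\<exists>X\<in>F. fst X \<inter> U \<noteq> {} \<and> \<not> fst X \<subseteq> U"
proof (rule ccontr)
  assume no: "\<not> ?thesis"
  obtain a where a: "a \<in> A" "K = component A F a" using K by (auto simp: comps_def)
  have "closed_in A F U" using no U(1) closed_in_subset[OF comps_closed[OF F K]] by (auto simp: closed_in_def)
  moreover obtain u where "u \<in> U" using U by blast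
  ultimately have "component A F u \<subseteq> U" by (rule component_minimal)
  moreover have "component A F u = K" using component_eq[OF F a(1)] a \<open>u \<in> U\<close> U by blast
  ultimately show False using U by blast
qed

text \<open>Hypergraph form of the fact that a connected graph on \<open>m\<close> vertices has at
  least \<open>m - 1\<close> edges. A member that crosses the boundary of \<open>U\<close> adds at
  most its size minus one new points, so a largest \<open>U\<close> spanned within the bound is all
  of \<open>K\<close>.\<close>

lemma comps_edge_bound:
  assumes F: "F \<subseteq> Pow A \<times> Pow B" and fin: "finite A" "finite F" and K: "K \<in> comps A F"
  shows "card K - 1 \<le> (\<Sum>X\<in>meeting F K. card (fst X) - 1)"
proof -
  have KA: "K \<subseteq> A" "finite K" using closed_in_subset[OF comps_closed[OF F K]] fin by (simp_all add: finite_subset)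
  have finX: "finite (fst X)" if "X \<in> F" for X
  proof -
    have "fst X \<subseteq> A" using family_subset(1)[OF F that] .
    then show ?thesis using fin finite_subset by blast
  qed
  let ?P = "\<lambda>U. U \<subseteq> K \<and> U \<noteq> {} \<and> (\<exists>G\<subseteq>meeting F K. (\<forall>X\<in>G. fst X \<subseteq> U) \<and>
      card U - 1 \<le> (\<Sum>X\<in>G. card (fst X) - 1))"
  obtain u where "u \<in> K" using comps_nonempty[OF K] by blast
  then have "?P {u}" by (auto intro!: exI[of _ "{}"])
  moreover have "\<forall>U. ?P U \<longrightarrow> card U < Suc (card K)" using KA by (auto intro: card_mono simp: less_Suc_eq_le)
  ultimately obtain U where U: "?P U" and max: "\<And>V. ?P V \<Longrightarrow> card V \<le> card U"
    using ex_has_greatest_nat[of ?P "{u}" card "Suc (card K)"] by auto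
  have UK: "U \<subseteq> K" "U \<noteq> {}" using U by simp_all
  obtain G where G: "G \<subseteq> meeting F K" "\<forall>X\<in>G. fst X \<subseteq> U"
    "card U - 1 \<le> (\<Sum>X\<in>G. card (fst X) - 1)" using U by (elim conjE exE) simp
  have finM: "finite (meeting F K)" using fin(2) by (simp add: meeting_def)
  have finG: "finite G" using finM by (rule finite_subset[OF G(1)])
  have "U = K"
  proof (rule ccontr)
    assume "U \<noteq> K"
    then obtain X where X: "X \<in> F" "fst X \<inter> U \<noteq> {}" "\<not> fst X \<subseteq> U"
      using comps_crossing[OF F K UK \<open>U \<noteq> K\<close>] by blast
    have "fst X \<inter> K \<noteq> {}" using X(2) UK by blast
    then have XK: "fst X \<subseteq> K" by (rule closed_inD[OF comps_closed[OF F K] X(1)])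
    let ?V = "U \<union> fst X"
    have finU: "finite U" using KA(2) by (rule finite_subset[OF UK(1)])
    have XG: "X \<notin> G" using G(2) X(3) by blast
    have "card ?V = card U + card (fst X - U)" using finU finX[OF X(1)]
      by (metis Un_Diff_cancel card_Un_disjoint Diff_disjoint finite_Diff)
    moreover have "card (fst X - U) \<le> card (fst X) - 1"
    proof -
      have "card (fst X - U) < card (fst X)" using X(2) finX[OF X(1)] by (intro psubset_card_mono) auto
      then show ?thesis by simp
    qed
    moreover have "(\<Sum>X\<in>insert X G. card (fst X) - 1) = card (fst X) - 1 + (\<Sum>X\<in>G. card (fst X) - 1)"
      using XG finG by simp
    ultimately have "card ?V - 1 \<le> (\<Sum>X\<in>insert X G. card (fst X) - 1)" using G(3) by linarith
    moreover have "insert X G \<subseteq> meeting F K" using G(1) X(1) \<open>fst X \<inter> K \<noteq> {}\<close> by (simp add: meeting_def)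
    moreover have "\<forall>Y\<in>insert X G. fst Y \<subseteq> ?V" using G(2) by blast
    moreover have "?V \<subseteq> K" "?V \<noteq> {}" using UK XK by simp_all
    ultimately have "?P ?V" by blast
    then have "card ?V \<le> card U" by (rule max)
    moreover have "card U < card ?V" using X(3) finU finX[OF X(1)] by (intro psubset_card_mono) auto
    ultimately show False by simp
  qed
  then have "card K - 1 \<le> (\<Sum>X\<in>G. card (fst X) - 1)" using G(3) by simp
  also have "\<dots> \<le> (\<Sum>X\<in>meeting F K. card (fst X) - 1)" by (rule sum_mono2[OF finM G(1)]) simp
  finally show ?thesis .
qed

lemma sum_card_fst:
  assumes "finite D" "finite F" "\<And>X. X \<in> F \<Longrightarrow> fst X \<inter> D \<noteq> {} \<Longrightarrow> fst X \<subseteq> D"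
    and "\<And>a. a \<in> D \<Longrightarrow> card {X \<in> F. a \<in> fst X} = n"
  shows "(\<Sum>X\<in>meeting F D. card (fst X)) = n * card D"
proof -
  have fin: "finite (meeting F D)" using assms(2) by (simp add: meeting_def)
  have "(\<Sum>X\<in>meeting F D. card (fst X)) = (\<Sum>X\<in>meeting F D. \<Sum>a\<in>D. if a \<in> fst X then 1 else 0)"
  proof (rule sum.cong)
    fix X assume "X \<in> meeting F D"
    then have "fst X \<subseteq> D" using assms(3)[of X] unfolding meeting_def by blast
    then have "D \<inter> {a. a \<in> fst X} = fst X" by blast
    then show "card (fst X) = (\<Sum>a\<in>D. if a \<in> fst X then 1 else 0)" using assms(1) by (simp add: sum.If_cases)
  qed simp
  also have "\<dots> = (\<Sum>a\<in>D. \<Sum>X\<in>meeting F D. if a \<in> fst X then 1 else 0)" by (rule sum.swap)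
  also have "\<dots> = (\<Sum>a\<in>D. n)"
  proof (rule sum.cong)
    fix a assume "a \<in> D"
    then have "meeting F D \<inter> {X. a \<in> fst X} = {X \<in> F. a \<in> fst X}" by (auto simp: meeting_def)
    then show "(\<Sum>X\<in>meeting F D. if a \<in> fst X then 1 else 0) = n"
      using assms(4)[OF \<open>a \<in> D\<close>] fin by (simp add: sum.If_cases)
  qed simp
  finally show ?thesis by simp
qed

context
  fixes A :: "'a set" and B :: "'b set" and n1 n2 :: nat and F :: "('a set \<times> 'b set) set"
  assumes finA: "finite A" and finB: "finite B" and F: "realizes A B n1 n2 F"
begin

lemma F_sub: "F \<subseteq> Pow A \<times> Pow B"
  using F by (simp add: realizes_def)

lemma finF: "finite F"
  using F finA finB realizes_finite by blast

lemma fin_comps: "finite (comps A F)"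
  using finA by (simp add: comps_def)

lemma fin_comp: "K \<in> comps A F \<Longrightarrow> finite K"
  using closed_in_subset[OF comps_closed[OF F_sub]] finA finite_subset by blast

text \<open>Subtract \<open>comps_edge_bound\<close> from the degree sum \<open>n1 * card K\<close>:
  what remains of the sizes is one for each class. Equality is the tree-like case.\<close>

lemma card_meeting_comp:
  assumes K: "K \<in> comps A F"
  shows "card (meeting F K) + card K \<le> n1 * card K + 1"
proof -
  have fin: "finite (meeting F K)" using finF by (simp add: meeting_def)
  have sub: "K \<subseteq> A" using closed_in_subset[OF comps_closed[OF F_sub K]] .
  have "(\<Sum>X\<in>meeting F K. card (fst X)) = n1 * card K"
  proof (rule sum_card_fst)
    fix a assume "a \<in> K"
    then show "card {X \<in> F. a \<in> fst X} = n1" using F sub by (auto simp: realizes_def)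
  qed (use finF fin_comp K closed_inD[OF comps_closed[OF F_sub K]] in auto)
  moreover have "(\<Sum>X\<in>meeting F K. card (fst X)) = (\<Sum>X\<in>meeting F K. (card (fst X) - 1) + 1)"
  proof (rule sum.cong)
    fix X assume X: "X \<in> meeting F K"
    then have "fst X \<subseteq> A" "fst X \<noteq> {}" using family_subset(1)[OF F_sub] by (auto simp: meeting_def)
    then have "card (fst X) \<noteq> 0" using finA by (metis card_eq_0_iff finite_subset)
    then show "card (fst X) = (card (fst X) - 1) + 1" by simp
  qed simp
  ultimately have "n1 * card K = (\<Sum>X\<in>meeting F K. card (fst X) - 1) + card (meeting F K)"
    by (simp only: sum.distrib) simp
  then show ?thesis using comps_edge_bound[OF F_sub finA finF K] by linarith
qed

lemma fin_coloured: "finite (coloured F D)"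
  using finF by (simp add: coloured_def)

lemma card_Union_comps:
  assumes "\<K> \<subseteq> comps A F"
  shows "card (\<Union>\<K>) = (\<Sum>K\<in>\<K>. card K)"
proof (rule card_Union_disjoint)
  show "pairwise disjnt \<K>" unfolding pairwise_def disjnt_def using assms comps_disjoint[OF F_sub] by blast
qed (use assms fin_comp in blast)

lemma card_coloured_Union_comps:
  assumes \<K>: "\<K> \<subseteq> comps A F"
  shows "card (coloured F (\<Union>\<K>)) = (\<Sum>K\<in>\<K>. card (coloured F K))"
proof -
  have "coloured F (\<Union>\<K>) = (\<Union>K\<in>\<K>. coloured F K)" by (auto simp: coloured_def)
  also have "card \<dots> = (\<Sum>K\<in>\<K>. card (coloured F K))"
  proof (rule card_UN_disjoint)
    show "\<forall>i\<in>\<K>. \<forall>j\<in>\<K>. i \<noteq> j \<longrightarrow> coloured F i \<inter> coloured F j = {}"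
    proof (intro ballI impI, rule ccontr)
      fix K K' assume K: "K \<in> \<K>" "K' \<in> \<K>" "K \<noteq> K'" "coloured F K \<inter> coloured F K' \<noteq> {}"
      then obtain X where X: "X \<in> F" "fst X \<inter> K \<noteq> {}" "fst X \<inter> K' \<noteq> {}" by (auto simp: coloured_def)
      then have "fst X \<subseteq> K" using K \<K> closed_inD[OF comps_closed[OF F_sub]] by blast
      then show False using X(3) comps_disjoint[OF F_sub] K \<K> by blast
    qed
  qed (use \<K> fin_comps finite_subset fin_coloured in auto)
  finally show ?thesis .
qed

text \<open>An uncoloured class occupies one of the places counted in
  \<open>card_meeting_comp\<close>, so its component misses the bound by at least one.\<close>

lemma card_coloured_comp:
  assumes K: "K \<in> comps A F"
  shows "card (coloured F K) + card K \<le> n1 * card K + 1"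
    and "X \<in> F \<Longrightarrow> snd X = {} \<Longrightarrow> fst X \<inter> K \<noteq> {} \<Longrightarrow> card (coloured F K) + card K \<le> n1 * card K"
proof -
  have fin: "finite (meeting F K)" using finF by (simp add: meeting_def)
  have sub: "coloured F K \<subseteq> meeting F K" by (auto simp: coloured_def meeting_def)
  then show "card (coloured F K) + card K \<le> n1 * card K + 1"
    using card_meeting_comp[OF K] card_mono[OF fin sub] by linarith
  assume "X \<in> F" "snd X = {}" "fst X \<inter> K \<noteq> {}"
  then have "coloured F K \<subset> meeting F K" by (auto simp: coloured_def meeting_def)
  then have "card (coloured F K) < card (meeting F K)" using fin psubset_card_mono by blast
  then show "card (coloured F K) + card K \<le> n1 * card K" using card_meeting_comp[OF K] by linarith
qed

lemma card_coloured_bound: "card (coloured F A) + card A \<le> n1 * card A + card (comps A F)"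
proof -
  have "card (coloured F A) + card A = (\<Sum>K\<in>comps A F. card (coloured F K) + card K)"
    using card_coloured_Union_comps[of "comps A F"] card_Union_comps[of "comps A F"] Union_comps[OF F_sub]
    by (simp add: sum.distrib)
  also have "\<dots> \<le> (\<Sum>K\<in>comps A F. n1 * card K + 1)"
    using card_coloured_comp(1) by (intro sum_mono) auto
  also have "\<dots> = n1 * card A + card (comps A F)"
    using card_Union_comps[of "comps A F"] Union_comps[OF F_sub]
    by (simp only: sum.distrib sum_distrib_left[symmetric]) simp
  finally show ?thesis .
qed

text \<open>The balance \<open>h\<close> is additive over components and at most 1 on each.
  \<open>K0\<close> and the components with \<open>h \<le> 0\<close> together have balance at most
  1, while every other component contributes exactly 1; since the total is at least 2, adding some
  of the latter reaches the value 1. Components with an uncoloured class have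
  \<open>h \<le> 0\<close>, so all of them are included.\<close>

lemma ex_union_comps:
  assumes Q: "n1 * card A + 2 \<le> card (coloured F A) + card A" and K0: "K0 \<in> comps A F"
  shows "\<exists>D. closed_in A F D \<and> K0 \<subseteq> D \<and> card (coloured F D) + card D = n1 * card D + 1 \<and>
    (\<forall>X\<in>F. snd X = {} \<longrightarrow> fst X \<inter> D \<noteq> {})"
proof -
  let ?C = "comps A F"
  define h :: "'a set \<Rightarrow> int" where "h K = int (card (coloured F K)) + int (card K) - int (n1 * card K)" for K
  have h1: "h K \<le> 1" if "K \<in> ?C" for K using card_coloured_comp(1)[OF that] unfolding h_def by linarith
  let ?P = "insert K0 {K \<in> ?C. h K \<le> 0}"
  have finC: "finite ?C" by (rule fin_comps)
  have sum_h: "(\<Sum>K\<in>\<K>. h K) = h (\<Union>\<K>)" if "\<K> \<subseteq> ?C" for \<K>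
    unfolding h_def using card_coloured_Union_comps[OF that] card_Union_comps[OF that]
    by (simp add: sum.distrib sum_subtractf sum_distrib_left)
  have hA: "h A \<ge> 2" using Q unfolding h_def by linarith
  have P: "?P \<subseteq> ?C" using K0 by blast
  have rest: "h K = 1" if "K \<in> ?C - ?P" for K using h1[of K] that by fastforce
  have "(\<Sum>K\<in>?P. h K) \<le> 1"
  proof -
    have "(\<Sum>K\<in>?P - {K0}. h K) \<le> 0" by (rule sum_nonpos) auto
    moreover have "(\<Sum>K\<in>?P. h K) = h K0 + (\<Sum>K\<in>?P - {K0}. h K)"
      by (rule sum.remove) (use finC in auto)
    ultimately show ?thesis using h1[OF K0] by simp
  qed
  moreover have "(\<Sum>K\<in>?C. h K) = (\<Sum>K\<in>?P. h K) + int (card (?C - ?P))"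
  proof -
    have "(\<Sum>K\<in>?C. h K) = (\<Sum>K\<in>?P. h K) + (\<Sum>K\<in>?C - ?P. h K)"
      using sum.subset_diff[OF P finC, of h] by simp
    moreover have "(\<Sum>K\<in>?C - ?P. h K) = (\<Sum>K\<in>?C - ?P. 1)" by (rule sum.cong[OF refl rest])
    ultimately show ?thesis by simp
  qed
  moreover have "(\<Sum>K\<in>?C. h K) \<ge> 2" using sum_h[of ?C] hA Union_comps[OF F_sub] by simp
  ultimately have "nat (1 - (\<Sum>K\<in>?P. h K)) \<le> card (?C - ?P)" by linarith
  then obtain R where R: "R \<subseteq> ?C - ?P" "card R = nat (1 - (\<Sum>K\<in>?P. h K))"
    by (meson obtain_subset_with_card_n)
  have finP: "finite ?P" using finC by (rule finite_subset[OF P])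
  have finR: "finite R" using finC R(1) by (meson finite_Diff finite_subset)
  have RC: "R \<union> ?P \<subseteq> ?C" using R P by blast
  have "(\<Sum>K\<in>R \<union> ?P. h K) = (\<Sum>K\<in>R. h K) + (\<Sum>K\<in>?P. h K)"
    by (rule sum.union_disjoint[OF finR finP]) (use R(1) in blast)
  also have "(\<Sum>K\<in>R. h K) = (\<Sum>K\<in>R. 1)" by (rule sum.cong[OF refl rest]) (use R(1) in blast)
  also have "\<dots> + (\<Sum>K\<in>?P. h K) = 1" using R(2) \<open>(\<Sum>K\<in>?P. h K) \<le> 1\<close> by simp
  finally have hD: "h (\<Union>(R \<union> ?P)) = 1" using sum_h[OF RC] by simp
  let ?D = "\<Union>(R \<union> ?P)"
  have "closed_in A F ?D" by (rule closed_in_Union) (use RC comps_closed[OF F_sub] in blast)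
  moreover have "fst X \<inter> ?D \<noteq> {}" if X: "X \<in> F" "snd X = {}" for X
  proof -
    have "fst X \<noteq> {}" using X F by (metis realizes_def prod.collapse)
    then obtain x where x: "x \<in> fst X" "x \<in> A" using family_subset(1)[OF F_sub X(1)] by blast
    let ?K = "component A F x"
    have K: "?K \<in> ?C" using x by (simp add: comps_def)
    have "fst X \<inter> ?K \<noteq> {}" using x in_component[of x A F] by blast
    then have "h ?K \<le> 0" using card_coloured_comp(2)[OF K X] unfolding h_def by linarith
    then have "?K \<in> ?P" using K by blast
    then show ?thesis using \<open>fst X \<inter> ?K \<noteq> {}\<close> by blast
  qed
  moreover have "card (coloured F ?D) + card ?D = n1 * card ?D + 1" using hD unfolding h_def by linarith
  moreover have "K0 \<subseteq> ?D" by blast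
  ultimately show ?thesis by (intro exI[of _ ?D] conjI ballI impI)
qed

text \<open>
  Two components with the same code, that is, with the same incidences after numbering their
  elements, can be exchanged by an automorphism.
\<close>

lemma card_small_comps:
  "card {K \<in> comps A F. card K \<le> s} \<le> Suc s * 2 ^ (2 ^ s * 2 ^ card B)"
proof -
  let ?C = "{K \<in> comps A F. card K \<le> s}"
  have "\<exists>e. bij_betw e {..<card K} K" if "K \<in> comps A F" for K
    using fin_comp[OF that] by (metis ex_bij_betw_nat_finite lessThan_atLeast0)
  then obtain e where e: "\<And>K. K \<in> comps A F \<Longrightarrow> bij_betw (e K) {..<card K} K" by metis
  define code where "code K = (\<lambda>X. ({i. i < card K \<and> e K i \<in> fst X}, snd X)) ` meeting F K" for K
  have "inj_on (\<lambda>K. (card K, code K)) ?C"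
  proof (rule inj_onI, rule ccontr)
    fix K K' assume "K \<in> ?C" "K' \<in> ?C" and eq: "(card K, code K) = (card K', code K')" and ne: "K \<noteq> K'"
    then have K: "K \<in> comps A F" "K' \<in> comps A F" by auto
    let ?j = "card K"
    have cK': "card K' = ?j" and cc: "code K = code K'" using eq by auto
    have disj: "K \<inter> K' = {}" by (rule comps_disjoint[OF F_sub K ne])
    let ?u = "inv_into {..<?j} (e K)" and ?v = "inv_into {..<?j} (e K')"
    define \<sigma> where "\<sigma> a = (if a \<in> K then e K' (?u a) else if a \<in> K' then e K (?v a) else a)" for a
    have eK: "bij_betw (e K) {..<?j} K" "bij_betw (e K') {..<?j} K'" using e[OF K(1)] e[OF K(2)] cK' by auto
    have in_K: "e K i \<in> K" "e K' i \<in> K'" if "i < ?j" for i using eK that by (auto simp: bij_betw_def)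
    have \<sigma>1: "\<sigma> (e K i) = e K' i" if "i < ?j" for i
      using in_K(1)[OF that] bij_betw_inv_into_left[OF eK(1)] that by (simp add: \<sigma>_def)
    have \<sigma>2: "\<sigma> (e K' i) = e K i" if "i < ?j" for i
    proof -
      have "e K' i \<notin> K" using in_K(2)[OF that] disj by blast
      then show ?thesis using in_K(2)[OF that] bij_betw_inv_into_left[OF eK(2)] that by (simp add: \<sigma>_def)
    qed
    have exK: "\<exists>i<?j. a = e K i" if "a \<in> K" for a using eK(1) that by (auto simp: bij_betw_def)
    have exK': "\<exists>i<?j. a = e K' i" if "a \<in> K'" for a using eK(2) that by (auto simp: bij_betw_def)
    have invol: "\<sigma> (\<sigma> a) = a" for a
    proof (cases "a \<in> K \<union> K'")
      case True
      then show ?thesis using exK exK' \<sigma>1 \<sigma>2 by (metis Un_iff)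
    qed (simp add: \<sigma>_def)
    have "K \<subseteq> A" "K' \<subseteq> A" using K closed_in_subset[OF comps_closed[OF F_sub]] by auto
    then have out: "\<sigma> a = a" if "a \<notin> A" for a using that by (auto simp: \<sigma>_def)
    have perm: "\<sigma> permutes A" unfolding permutes_def using out invol by metis
    \<comment> \<open>Stated for \<open>L\<close> and \<open>L'\<close> because it is used in both
      directions, from \<open>K\<close> to \<open>K'\<close> and back.\<close>
    have move: "\<exists>Y\<in>F. fst Y = \<sigma> ` fst X \<and> snd Y = snd X"
      if X: "X \<in> meeting F L" and L: "L \<in> comps A F" "L' \<in> comps A F" "code L = code L'" "card L = ?j" "card L' = ?j"
        and \<sigma>L: "\<And>i. i < ?j \<Longrightarrow> \<sigma> (e L i) = e L' i" for X L L'
    proof -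
      have eL: "bij_betw (e L) {..<?j} L" "bij_betw (e L') {..<?j} L'" using e[OF L(1)] e[OF L(2)] L by auto
      have "({i. i < card L \<and> e L i \<in> fst X}, snd X) \<in> code L"
        unfolding code_def using X by blast
      then have "({i. i < card L \<and> e L i \<in> fst X}, snd X) \<in> code L'" unfolding L(3) .
      then obtain Y where Y: "Y \<in> meeting F L'" "snd Y = snd X"
        "{i. i < ?j \<and> e L i \<in> fst X} = {i. i < ?j \<and> e L' i \<in> fst Y}"
        unfolding code_def L(4,5) by auto
      have sub: "fst X \<subseteq> L" "fst Y \<subseteq> L'" using X Y(1) closed_inD[OF comps_closed[OF F_sub]] L by (auto simp: meeting_def)
      have "\<sigma> ` fst X = fst Y"
      proof (intro equalityI subsetI)
        fix y assume "y \<in> \<sigma> ` fst X"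
        then obtain x where x: "x \<in> fst X" "y = \<sigma> x" by blast
        then have "x \<in> e L ` {..<?j}" using sub(1) eL(1) by (auto simp: bij_betw_def)
        then obtain i where i: "i < ?j" "x = e L i" by auto
        then have "i \<in> {i. i < ?j \<and> e L' i \<in> fst Y}" using x(1) Y(3) by auto
        then show "y \<in> fst Y" using x i \<sigma>L by simp
      next
        fix y assume y: "y \<in> fst Y"
        then have "y \<in> e L' ` {..<?j}" using sub(2) eL(2) by (auto simp: bij_betw_def)
        then obtain i where i: "i < ?j" "y = e L' i" by auto
        then have "i \<in> {i. i < ?j \<and> e L i \<in> fst X}" using y Y(3) by auto
        then show "y \<in> \<sigma> ` fst X" using i \<sigma>L by force
      qed
      then show ?thesis using Y by (auto simp: meeting_def)
    qed
    have "act \<sigma> id X \<in> F" if X: "X \<in> F" for X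
    proof -
      have "\<exists>Y\<in>F. fst Y = \<sigma> ` fst X \<and> snd Y = snd X"
      proof (cases "fst X \<inter> K = {} \<and> fst X \<inter> K' = {}")
        case True
        then have "\<sigma> ` fst X = (\<lambda>x. x) ` fst X" by (intro image_cong) (auto simp: \<sigma>_def)
        then show ?thesis using X by auto
      next
        case False
        then consider "X \<in> meeting F K" | "X \<in> meeting F K'" using X by (auto simp: meeting_def)
        then show ?thesis
        proof cases
          case 1
          show ?thesis by (rule move[OF 1 K cc refl cK' \<sigma>1])
        next
          case 2
          show ?thesis by (rule move[OF 2 K(2,1) cc[symmetric] cK' refl \<sigma>2])
        qed
      qed
      then obtain Y where "Y \<in> F" "fst Y = \<sigma> ` fst X" "snd Y = snd X" by blast
      then show ?thesis by (metis act_def image_id id_apply prod.collapse)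
    qed
    moreover have "rigid A B F" using F by (simp add: realizes_def)
    ultimately have "\<sigma> = id" using rigidD(1)[OF _ perm permutes_id] by blast
    moreover obtain a where a: "a \<in> K" using comps_nonempty[OF K(1)] by blast
    moreover obtain i where "i < ?j" "a = e K i" using exK[OF a] by blast
    ultimately have "e K' i = e K i" using \<sigma>1[of i] by simp
    then show False using in_K[OF \<open>i < ?j\<close>] disj by auto
  qed
  \<comment> \<open>A code is a set of pairs consisting of a subset of the first \<open>s\<close>
    numbers and a colour. There are \<open>2 ^ (2 ^ s * 2 ^ card B)\<close> such sets, and
    \<open>Suc s\<close> possible sizes.\<close>
  moreover have "(\<lambda>K. (card K, code K)) ` ?C \<subseteq> {..s} \<times> Pow (Pow {..<s} \<times> Pow B)"
  proof
    fix z assume "z \<in> (\<lambda>K. (card K, code K)) ` ?C"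
    then obtain K where K: "K \<in> comps A F" "card K \<le> s" "z = (card K, code K)" by blast
    have "code K \<subseteq> Pow {..<s} \<times> Pow B"
      using K(2) family_subset(2)[OF F_sub] by (auto simp: code_def meeting_def)
    then show "z \<in> {..s} \<times> Pow (Pow {..<s} \<times> Pow B)" using K by simp
  qed
  moreover have "finite ({..s} \<times> Pow (Pow {..<s} \<times> Pow B))" using finB by simp
  ultimately have "card ?C \<le> card ({..s} \<times> Pow (Pow {..<s} \<times> Pow B))" by (rule card_inj_on_le)
  then show ?thesis using finB by (simp add: card_cartesian_product card_Pow)
qed

lemma card_small_union:
  "card (\<Union>{K \<in> comps A F. card K \<le> s}) \<le> s * (Suc s * 2 ^ (2 ^ s * 2 ^ card B))"
proof -
  let ?C = "{K \<in> comps A F. card K \<le> s}"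
  have "card (\<Union>?C) = (\<Sum>K\<in>?C. card K)" by (rule card_Union_comps) blast
  also have "\<dots> \<le> (\<Sum>K\<in>?C. s)" by (rule sum_mono) simp
  also have "\<dots> \<le> s * (Suc s * 2 ^ (2 ^ s * 2 ^ card B))" using card_small_comps[of s] by simp
  finally show ?thesis .
qed

text \<open>Components of size at most \<open>s\<close> are bounded in number, and there are at most
  \<open>card A / Suc s\<close> larger ones. As \<open>s\<close> is arbitrary, the number of
  components is \<open>o(card A)\<close>.\<close>

lemma card_comps_bound:
  "Suc s * card (comps A F) \<le> Suc s * (Suc s * 2 ^ (2 ^ s * 2 ^ card B)) + card A"
proof -
  let ?S = "{K \<in> comps A F. card K \<le> s}" and ?L = "{K \<in> comps A F. \<not> card K \<le> s}"
  have "comps A F = ?S \<union> ?L" by blast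
  then have "card (comps A F) \<le> card ?S + card ?L" using card_Un_le[of ?S ?L] by simp
  moreover have "Suc s * card ?L \<le> card A"
  proof -
    have "Suc s * card ?L = (\<Sum>K\<in>?L. Suc s)" by simp
    also have "\<dots> \<le> (\<Sum>K\<in>?L. card K)" by (rule sum_mono) auto
    also have "\<dots> = card (\<Union>?L)" by (rule card_Union_comps[symmetric]) blast
    also have "\<dots> \<le> card A" using Union_comps[OF F_sub] finA by (intro card_mono) blast+
    finally show ?thesis .
  qed
  moreover have "Suc s * (card ?S + card ?L) = Suc s * card ?S + Suc s * card ?L" by (rule add_mult_distrib2)
  ultimately have "Suc s * card (comps A F) \<le> Suc s * card ?S + card A"
    using mult_le_mono2[of "card (comps A F)" "card ?S + card ?L" "Suc s"] by linarith
  also have "Suc s * card ?S \<le> Suc s * (Suc s * 2 ^ (2 ^ s * 2 ^ card B))"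
    using card_small_comps mult_le_mono2 by blast
  finally show ?thesis by simp
qed

lemma card_meeting_le:
  assumes "U \<subseteq> A"
  shows "card (meeting F U) \<le> n1 * card U"
proof -
  have "finite U" using assms finA finite_subset by blast
  have "meeting F U = (\<Union>a\<in>U. {X \<in> F. a \<in> fst X})" by (auto simp: meeting_def)
  then have "card (meeting F U) \<le> (\<Sum>a\<in>U. card {X \<in> F. a \<in> fst X})"
    by (simp only: card_UN_le[OF \<open>finite U\<close>])
  also have "\<dots> = (\<Sum>a\<in>U. n1)"
    by (rule sum.cong) (use F assms in \<open>auto simp: realizes_def\<close>)
  finally show ?thesis by (simp add: mult.commute)
qed

text \<open>Small components cover boundedly many points, and these lie in boundedly many classes,
  so a collection \<open>G\<close> above that bound reaches a large component.\<close>

lemma ex_large_comp: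
  assumes G: "G \<subseteq> F" "\<And>X. X \<in> G \<Longrightarrow> fst X \<noteq> {}"
    and big: "n1 * (s * (Suc s * 2 ^ (2 ^ s * 2 ^ card B))) < card G"
  shows "\<exists>K\<in>comps A F. s < card K \<and> (\<exists>X\<in>G. fst X \<inter> K \<noteq> {})"
proof -
  let ?U = "\<Union>{K \<in> comps A F. card K \<le> s}"
  have "?U \<subseteq> A" using Union_comps[OF F_sub] by blast
  then have "card (meeting F ?U) \<le> n1 * card ?U" by (rule card_meeting_le)
  also have "\<dots> < card G" using card_small_union[of s] big by (meson le_less_trans mult_le_mono2)
  finally have "\<not> G \<subseteq> meeting F ?U"
    using finF card_mono[of "meeting F ?U" G] by (auto simp: meeting_def)
  then obtain X where X: "X \<in> G" "X \<notin> meeting F ?U" by blast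
  then obtain a where a: "a \<in> fst X" "a \<in> A" using G family_subset(1)[OF F_sub] by blast
  then have K: "component A F a \<in> comps A F" "fst X \<inter> component A F a \<noteq> {}" using in_component[of a A F] by (auto simp: comps_def)
  moreover have "s < card (component A F a)"
  proof (rule ccontr)
    assume "\<not> ?thesis"
    then have "component A F a \<subseteq> ?U" using K(1) by auto
    then show False using X G(1) K(2) by (auto simp: meeting_def)
  qed
  ultimately show ?thesis using X(1) by blast
qed

end

section \<open>The linear programming bound\<close>

lemma sum_card_snd:
  assumes "finite B" "finite F" "F \<subseteq> Pow A \<times> Pow B" "\<And>b. b \<in> B \<Longrightarrow> card {X \<in> F. b \<in> snd X} = n"
  shows "(\<Sum>X\<in>F. card (snd X)) = n * card B"
proof -
  have "(\<Sum>X\<in>F. card (snd X)) = (\<Sum>X\<in>F. \<Sum>b\<in>B. if b \<in> snd X then 1 else 0)"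
  proof (rule sum.cong)
    fix X assume "X \<in> F"
    then have "B \<inter> {b. b \<in> snd X} = snd X" using family_subset(2)[OF assms(3)] by blast
    then show "card (snd X) = (\<Sum>b\<in>B. if b \<in> snd X then 1 else 0)" using assms(1) by (simp add: sum.If_cases)
  qed simp
  also have "\<dots> = (\<Sum>b\<in>B. \<Sum>X\<in>F. if b \<in> snd X then 1 else 0)" by (rule sum.swap)
  also have "\<dots> = (\<Sum>b\<in>B. n)"
  proof (rule sum.cong)
    fix b assume "b \<in> B"
    moreover have "F \<inter> {X. b \<in> snd X} = {X \<in> F. b \<in> snd X}" by blast
    ultimately show "(\<Sum>X\<in>F. if b \<in> snd X then 1 else 0) = n"
      using assms(2,4) by (simp add: sum.If_cases)
  qed simp
  finally show ?thesis by simp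
qed

text \<open>Points lacking the most profitable singleton class. The duality inequality charges each
  of them \<open>card B - l\<close>, so a nearly optimal family has few of them when
  \<open>l < card B\<close>.\<close>

definition unmarked :: "'a set \<Rightarrow> 'b set \<Rightarrow> ('a set \<times> 'b set) set \<Rightarrow> 'a set" where
  "unmarked A B F = {a \<in> A. ({a}, B) \<notin> F}"

text \<open>Gain of a singleton class of colour \<open>T\<close> beyond the price \<open>l\<close>;
  it can be collected once per point and colour.\<close>

definition excess :: "real \<Rightarrow> 'b set \<Rightarrow> real" where
  "excess l T = max 0 (real (card T) - l)"

text \<open>
  Linear programming duality: \<open>l\<close> is the price of one incidence with \<open>A\<close>, and the term with
  \<open>2 * l - card B\<close> accounts for the number of classes.
\<close>

lemma duality_inequality:
  fixes l :: real
  assumes finA: "finite A" and finB: "finite B" and F: "realizes A B n1 n2 F"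
    and l: "real (card B) / 2 \<le> l" "l \<le> real (card B)"
  shows "real (card B) * real n2 + (real (card B) - l) * real (card (unmarked A B F)) +
      (\<Sum>X\<in>{X \<in> F. 2 \<le> card (fst X)}. (real (card B) - l) * (real (card (fst X)) - 2))
    \<le> real (card B) * 2 ^ card B + (real (card B) - l) * real n1 * real (card A) +
      (2 * l - real (card B)) * real (card (coloured F A)) +
      real (card A) * (\<Sum>T\<in>Pow B. excess l T)"
proof -
  let ?m = "real (card B)" and ?F0 = "{X \<in> F. fst X = {}}" and ?F1 = "meeting F A"
  let ?\<Phi> = "\<Sum>T\<in>Pow B. excess l T" and ?L = "unmarked A B F"
  have sub: "F \<subseteq> Pow A \<times> Pow B" using F by (simp add: realizes_def)
  have finF: "finite F" using F finA finB realizes_finite by blast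
  have fin1: "finite ?F1" using finF by (simp add: meeting_def)
  have part: "F = ?F0 \<union> ?F1" "?F0 \<inter> ?F1 = {}"
    using family_subset(1)[OF sub] by (auto simp: meeting_def)
  have cT: "card (snd X) \<le> card B" if "X \<in> F" for X
    using family_subset(2)[OF sub that] finB by (rule card_mono[rotated])
  have "?m * real n2 = (\<Sum>X\<in>F. real (card (snd X)))"
    using sum_card_snd[OF finB finF sub, of n2] F
    by (simp add: realizes_def mult.commute flip: of_nat_sum of_nat_mult)
  also have "\<dots> = (\<Sum>X\<in>?F0. real (card (snd X))) + (\<Sum>X\<in>?F1. real (card (snd X)))"
    using part fin1 finF by (metis (no_types, lifting) finite_Un sum.union_disjoint)
  finally have total: "?m * real n2 = (\<Sum>X\<in>?F0. real (card (snd X))) + (\<Sum>X\<in>?F1. real (card (snd X)))" .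
  \<comment> \<open>A class that avoids \<open>A\<close> is determined by its second component, so
    these classes contribute only a bounded amount.\<close>
  have empty: "(\<Sum>X\<in>?F0. real (card (snd X))) \<le> ?m * 2 ^ card B"
  proof -
    have "(\<Sum>X\<in>?F0. real (card (snd X))) \<le> (\<Sum>X\<in>?F0. ?m)" using cT by (intro sum_mono) auto
    also have "\<dots> = ?m * real (card ?F0)" by simp
    also have "card ?F0 \<le> card (Pow B)"
    proof (rule card_inj_on_le[of snd])
      show "inj_on snd ?F0" by (auto simp: inj_on_def)
      show "snd ` ?F0 \<subseteq> Pow B" using family_subset(2)[OF sub] by blast
    qed (use finB in simp)
    then have "?m * real (card ?F0) \<le> ?m * 2 ^ card B" using finB by (simp add: card_Pow mult_left_mono)
    finally show ?thesis .
  qed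
  let ?big = "\<lambda>X. if 2 \<le> card (fst X) then (?m - l) * (real (card (fst X)) - 2) else 0"
  let ?col = "\<lambda>X. if snd X \<noteq> {} then 2 * l - ?m else (0::real)"
  let ?one = "\<lambda>X. if card (fst X) = 1 then excess l (snd X) else 0"
  \<comment> \<open>For a coloured class the right-hand side is \<open>l\<close> plus the excess on
    a singleton, and exactly \<open>card B\<close> on a larger set, where \<open>?big\<close> takes
    back the charge beyond two points.\<close>
  have "real (card (snd X)) \<le> (?m - l) * real (card (fst X)) + ?col X - ?big X + ?one X"
    if X: "X \<in> ?F1" for X
  proof -
    have XF: "X \<in> F" and ne: "fst X \<noteq> {}" using X by (auto simp: meeting_def)
    have "finite (fst X)" using family_subset(1)[OF sub XF] finA finite_subset by blast
    then have c: "card (fst X) = 1 \<or> 2 \<le> card (fst X)" using ne by (metis One_nat_def Suc_1 Suc_leI card_gt_0_iff le_neq_implies_less)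
    have t: "real (card (snd X)) \<le> ?m" using cT[OF XF] by simp
    have ex: "excess l (snd X) \<ge> real (card (snd X)) - l" "excess l (snd X) \<ge> 0" by (auto simp: excess_def)
    show ?thesis
    proof (cases "snd X = {}")
      case True
      then show ?thesis using c l ex by (auto simp: algebra_simps)
    next
      case False
      then show ?thesis using c l ex t by (auto simp: algebra_simps)
    qed
  qed
  then have "(\<Sum>X\<in>?F1. real (card (snd X))) \<le>
      (\<Sum>X\<in>?F1. (?m - l) * real (card (fst X)) + ?col X - ?big X + ?one X)" by (rule sum_mono)
  also have "\<dots> = (\<Sum>X\<in>?F1. (?m - l) * real (card (fst X))) + (\<Sum>X\<in>?F1. ?col X)
      - (\<Sum>X\<in>?F1. ?big X) + (\<Sum>X\<in>?F1. ?one X)"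
    by (simp only: sum.distrib sum_subtractf)
  also have "(\<Sum>X\<in>?F1. (?m - l) * real (card (fst X))) = (?m - l) * real n1 * real (card A)"
  proof -
    have "(\<Sum>X\<in>?F1. card (fst X)) = n1 * card A"
      by (rule sum_card_fst) (use finA finF F family_subset(1)[OF sub] in \<open>auto simp: realizes_def\<close>)
    then have "(\<Sum>X\<in>?F1. real (card (fst X))) = real n1 * real (card A)" by (metis of_nat_mult of_nat_sum)
    then show ?thesis by (simp only: sum_distrib_left[symmetric] mult.assoc)
  qed
  also have "(\<Sum>X\<in>?F1. ?col X) = (2 * l - ?m) * real (card (coloured F A))"
  proof -
    have "?F1 \<inter> {X. snd X \<noteq> {}} = coloured F A" by (auto simp: meeting_def coloured_def)
    then show ?thesis using fin1 by (simp add: sum.If_cases mult.commute)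
  qed
  also have "(\<Sum>X\<in>?F1. ?big X) = (\<Sum>X\<in>{X \<in> F. 2 \<le> card (fst X)}. (?m - l) * (real (card (fst X)) - 2))"
  proof -
    have "?F1 \<inter> {X. 2 \<le> card (fst X)} = {X \<in> F. 2 \<le> card (fst X)}"
    proof (intro equalityI subsetI)
      fix X assume X: "X \<in> {X \<in> F. 2 \<le> card (fst X)}"
      then have "fst X \<noteq> {}" by auto
      then show "X \<in> ?F1 \<inter> {X. 2 \<le> card (fst X)}"
        using X family_subset(1)[OF sub, of X] by (auto simp: meeting_def)
    qed (auto simp: meeting_def)
    then show ?thesis using fin1 by (simp add: sum.If_cases)
  qed
  also have "(\<Sum>X\<in>?F1. ?one X) \<le> real (card A) * ?\<Phi> - (?m - l) * real (card ?L)"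
  proof -
    let ?S = "SIGMA a:A. {T \<in> Pow B. ({a}, T) \<in> F}" and ?f = "\<lambda>(a, T). ({a}, T)"
    have "?F1 \<inter> {X. card (fst X) = 1} = ?f ` ?S"
    proof (intro equalityI subsetI)
      fix X assume "X \<in> ?F1 \<inter> {X. card (fst X) = 1}"
      then have X: "X \<in> F" "card (fst X) = 1" by (auto simp: meeting_def)
      obtain a where a: "fst X = {a}" using X(2) card_1_singletonE by blast
      have "a \<in> A" "snd X \<in> Pow B" using family_subset[OF sub X(1)] a by auto
      moreover have "X = ({a}, snd X)" using a by (simp add: prod_eq_iff)
      ultimately have "(a, snd X) \<in> ?S" "X = ?f (a, snd X)" using X(1) by auto
      then show "X \<in> ?f ` ?S" by blast
    qed (auto simp: meeting_def)
    then have "(\<Sum>X\<in>?F1. ?one X) = (\<Sum>X\<in>?f ` ?S. excess l (snd X))" using fin1 by (simp add: sum.If_cases)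
    also have "\<dots> = (\<Sum>p\<in>?S. excess l (snd p))"
      by (subst sum.reindex) (auto simp: inj_on_def case_prod_beta)
    also have "\<dots> = (\<Sum>a\<in>A. \<Sum>T\<in>{T \<in> Pow B. ({a}, T) \<in> F}. excess l T)"
      by (subst sum.Sigma) (use finA finB in \<open>auto simp: case_prod_beta\<close>)
    \<comment> \<open>A point without the class \<open>({a}, B)\<close> cannot collect
      \<open>excess l B\<close>, which is \<open>card B - l\<close>.\<close>
    also have "\<dots> \<le> (\<Sum>a\<in>A. ?\<Phi> - (if ({a}, B) \<notin> F then ?m - l else 0))"
    proof (rule sum_mono)
      fix a assume "a \<in> A"
      let ?T = "{T \<in> Pow B. ({a}, T) \<in> F}"
      show "(\<Sum>T\<in>?T. excess l T) \<le> ?\<Phi> - (if ({a}, B) \<notin> F then ?m - l else 0)"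
      proof (cases "({a}, B) \<in> F")
        case True
        have "(\<Sum>T\<in>?T. excess l T) \<le> ?\<Phi>"
          by (rule sum_mono2) (use finB in \<open>auto simp: excess_def\<close>)
        then show ?thesis using True by simp
      next
        case False
        have "(\<Sum>T\<in>?T. excess l T) \<le> (\<Sum>T\<in>Pow B - {B}. excess l T)"
          by (rule sum_mono2) (use finB False in \<open>auto simp: excess_def\<close>)
        also have "\<dots> = ?\<Phi> - excess l B" using finB by (simp add: sum_diff1)
        also have "excess l B = ?m - l" using l by (simp add: excess_def)
        finally show ?thesis using False by simp
      qed
    qed
    also have "\<dots> = real (card A) * ?\<Phi> - (?m - l) * real (card ?L)"
    proof -
      have "A \<inter> {a. ({a}, B) \<notin> F} = ?L" by (auto simp: unmarked_def)
      then show ?thesis using finA by (simp add: sum_subtractf sum.If_cases mult.commute)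
    qed
    finally show ?thesis .
  qed
  finally show ?thesis using total empty by linarith
qed

section \<open>Merging two singleton classes into a chord\<close>

text \<open>Reflexive on \<open>A\<close>, so that \<open>adj A F ^^ n\<close> expresses distance at
  most \<open>n\<close> and is monotone in \<open>n\<close>.\<close>

definition adj :: "'a set \<Rightarrow> ('a set \<times> 'b set) set \<Rightarrow> ('a \<times> 'a) set" where
  "adj A F = {(a, b). a \<in> A \<and> b \<in> A \<and> (a = b \<or> (\<exists>X\<in>F. a \<in> fst X \<and> b \<in> fst X))}"

lemma adj_cong:
  assumes "a \<noteq> b \<Longrightarrow> (\<exists>X\<in>F. a \<in> fst X \<and> b \<in> fst X) \<longleftrightarrow> (\<exists>X\<in>G. a \<in> fst X \<and> b \<in> fst X)"
  shows "(a, b) \<in> adj A F \<longleftrightarrow> (a, b) \<in> adj A G"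
  using assms by (auto simp: adj_def)

lemma adj_sym: "(a, b) \<in> adj A F \<Longrightarrow> (b, a) \<in> adj A F"
  by (auto simp: adj_def)

lemma relpow_adj_sym: "(a, b) \<in> adj A F ^^ n \<Longrightarrow> (b, a) \<in> adj A F ^^ n"
proof (induction n arbitrary: b)
  case (Suc n)
  from Suc.prems obtain c where c: "(a, c) \<in> adj A F ^^ n" "(c, b) \<in> adj A F" by (rule relpow_Suc_E)
  show ?case by (rule relpow_Suc_I2[OF adj_sym[OF c(2)] Suc.IH[OF c(1)]])
qed auto

lemma relpow_subset:
  fixes R S :: "('c \<times> 'c) set"
  shows "R \<subseteq> S \<Longrightarrow> (a, b) \<in> R ^^ n \<Longrightarrow> (a, b) \<in> S ^^ n"
proof (induction n arbitrary: b)
  case (Suc n)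
  from Suc.prems(2) obtain c where c: "(a, c) \<in> R ^^ n" "(c, b) \<in> R" by (rule relpow_Suc_E)
  show ?case by (rule relpow_Suc_I[OF Suc.IH[OF Suc.prems(1) c(1)]]) (use c(2) Suc.prems(1) in blast)
qed simp

lemma relpow_adj_in: "(a, b) \<in> adj A F ^^ n \<Longrightarrow> a \<in> A \<Longrightarrow> b \<in> A"
proof (induction n arbitrary: b)
  case (Suc n)
  from Suc.prems(1) obtain c where "(c, b) \<in> adj A F" by (rule relpow_Suc_E)
  then show ?case by (simp add: adj_def)
qed simp

lemma relpow_adj_mono:
  assumes "(a, b) \<in> adj A F ^^ n" "a \<in> A" "n \<le> m"
  shows "(a, b) \<in> adj A F ^^ m"
  using assms(3)
proof (induction m rule: dec_induct)
  case (step m)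
  have "(b, b) \<in> adj A F" using relpow_adj_in[OF assms(1,2)] by (simp add: adj_def)
  then show ?case by (rule relpow_Suc_I[OF step.IH])
qed (rule assms(1))

text \<open>Merging keeps the degrees in \<open>A\<close> and lowers each degree in \<open>B\<close>
  by one. An automorphism of the new family that preserves the new edge is one of \<open>F\<close>.
  Any other takes it to some \<open>({x1, x2}, B)\<close> with unmarked ends, whose distance after
  deletion of that edge is again exactly \<open>c\<close>; this is excluded by \<open>other\<close>.
  The assumption \<open>far\<close> keeps walks of length \<open>c\<close> from unmarked points away
  from the places where the two families differ.\<close>

lemma chord_replacement:
  assumes fin: "finite A" "finite B" and F: "realizes A B n1 n2 F"
    and yz: "y \<in> A" "z \<in> A" "({y}, B) \<in> F" "({z}, B) \<in> F" "({y, z}, B) \<notin> F"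
    and c: "2 \<le> c" "(y, z) \<in> adj A F ^^ c" "(y, z) \<notin> adj A F ^^ (c - 1)"
    and far: "\<And>x. x \<in> unmarked A B F \<Longrightarrow> (x, y) \<notin> adj A F ^^ (2 * c)"
    and other: "\<And>x1 x2. x1 \<in> unmarked A B F \<Longrightarrow> x2 \<in> unmarked A B F \<Longrightarrow> ({x1, x2}, B) \<in> F \<Longrightarrow>
      (x1, x2) \<in> adj A (F - {({x1, x2}, B)}) ^^ c \<Longrightarrow> (x1, x2) \<in> adj A (F - {({x1, x2}, B)}) ^^ (c - 1)"
  shows "\<exists>F'. realizes A B n1 (n2 - 1) F'"
proof -
  let ?L = "unmarked A B F" and ?E = "adj A F"
  let ?F' = "insert ({y, z}, B) (F - {({y}, B), ({z}, B)})"
  have finF: "finite F" using F fin realizes_finite by blast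
  have sub: "F \<subseteq> Pow A \<times> Pow B" using F by (simp add: realizes_def)
  have LA: "?L \<subseteq> A" by (auto simp: unmarked_def)
  have ne: "y \<noteq> z"
  proof
    assume "y = z"
    have "(y, y) \<in> ?E ^^ 0" by simp
    then have "(y, y) \<in> ?E ^^ (c - 1)" by (rule relpow_adj_mono[OF _ yz(1)]) simp
    then show False using c \<open>y = z\<close> by simp
  qed
  \<comment> \<open>The radius \<open>2 * c\<close> around \<open>y\<close> also protects
    \<open>z\<close>, which is at distance \<open>c\<close> from \<open>y\<close>.\<close>
  have far_yz: "(x, y) \<notin> ?E ^^ n" "(x, z) \<notin> ?E ^^ n" if x: "x \<in> ?L" and n: "n \<le> c" for x n
  proof -
    have xA: "x \<in> A" using x LA by blast
    show "(x, y) \<notin> ?E ^^ n"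
    proof
      assume "(x, y) \<in> ?E ^^ n"
      then have "(x, y) \<in> ?E ^^ (2 * c)" by (rule relpow_adj_mono[OF _ xA]) (use n in simp)
      then show False using far[OF x] by blast
    qed
    show "(x, z) \<notin> ?E ^^ n"
    proof
      assume "(x, z) \<in> ?E ^^ n"
      then have "(x, z) \<in> ?E ^^ c" by (rule relpow_adj_mono[OF _ xA n])
      moreover have "(z, y) \<in> ?E ^^ c" by (rule relpow_adj_sym[OF c(2)])
      ultimately have "(x, y) \<in> ?E ^^ (c + c)" by (auto simp: relpow_add)
      then show False using far[OF x] by (simp add: mult_2)
    qed
  qed
  have far1: "(x, y) \<notin> ?E" "(x, z) \<notin> ?E" if "x \<in> ?L" for x
    using far_yz[OF that, of 1] c(1) by auto
  have degA: "card {X \<in> ?F'. a \<in> fst X} = n1" if "a \<in> A" for a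
  proof -
    let ?G = "{X \<in> F. a \<in> fst X}"
    have G: "card ?G = n1" "finite ?G" using F that finF by (auto simp: realizes_def)
    show ?thesis
    proof (cases "a = y \<or> a = z")
      case True
      then have "{X \<in> ?F'. a \<in> fst X} = insert ({y, z}, B) (?G - {({a}, B)})" using ne yz by auto
      moreover have mem: "({a}, B) \<in> ?G" using True yz by auto
      have "Suc (card (?G - {({a}, B)})) = n1" using card_Suc_Diff1[OF G(2) mem] unfolding G(1) .
      moreover have "card (insert ({y, z}, B) (?G - {({a}, B)})) = Suc (card (?G - {({a}, B)}))"
        by (rule card_insert_disjoint) (use yz G(2) in simp_all)
      ultimately show ?thesis by (simp only:)
    next
      case False
      then have "{X \<in> ?F'. a \<in> fst X} = ?G" by auto
      then show ?thesis using G by simp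
    qed
  qed
  have degB: "card {X \<in> ?F'. b \<in> snd X} = n2 - 1" if b: "b \<in> B" for b
  proof -
    let ?G = "{X \<in> F. b \<in> snd X}"
    have G: "card ?G = n2" "finite ?G" using F b finF by (auto simp: realizes_def)
    have "{X \<in> ?F'. b \<in> snd X} = insert ({y, z}, B) (?G - {({y}, B), ({z}, B)})" using b by auto
    moreover have "card (?G - {({y}, B), ({z}, B)}) = n2 - 2"
    proof -
      have "{({y}, B), ({z}, B)} \<subseteq> ?G" using b yz by auto
      moreover have "card {({y}, B), ({z}, B)} = 2" using ne by simp
      ultimately show ?thesis using G by (simp add: card_Diff_subset)
    qed
    moreover have "({y, z}, B) \<notin> ?G - {({y}, B), ({z}, B)}" using yz by simp
    \<comment> \<open>Excludes truncation in \<open>n2 - 2 + 1 = n2 - 1\<close>.\<close>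
    moreover have "2 \<le> n2"
    proof -
      have "card {({y}, B), ({z}, B)} \<le> card ?G" by (rule card_mono) (use G b yz in auto)
      then show ?thesis using G ne by simp
    qed
    ultimately show ?thesis using G(2) by simp
  qed
  have "rigid A B ?F'" unfolding rigid_def
  proof (intro allI impI, elim conjE)
    fix \<pi> \<beta> assume perm: "\<pi> permutes A" "\<beta> permutes B" and img: "act \<pi> \<beta> ` ?F' \<subseteq> ?F'"
    have inj: "inj \<pi>" "inj \<beta>" using perm permutes_inj by auto
    have act_eq: "act \<pi> \<beta> ` ?F' = ?F'" using act_image_eq[OF _ inj img] finF by simp
    have act_iff: "act \<pi> \<beta> X \<in> ?F' \<longleftrightarrow> X \<in> ?F'" for X
      using act_eq act_inj[OF inj] by (metis inj_image_mem_iff)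
    have actB: "act \<pi> \<beta> (S, B) = (\<pi> ` S, B)" for S using permutes_image[OF perm(2)] by simp
    \<comment> \<open>The points lacking \<open>({a}, B)\<close> in the new family are the unmarked
      points of \<open>F\<close> together with \<open>y\<close> and \<open>z\<close>, and
      \<open>\<pi>\<close> preserves this set.\<close>
    have L': "({a}, B) \<notin> ?F' \<longleftrightarrow> ({\<pi> a}, B) \<notin> ?F'" for a
      using act_iff[of "({a}, B)"] unfolding actB by simp
    have mem_L': "a \<in> ?L \<or> a = y \<or> a = z" if "a \<in> A" "({a}, B) \<notin> ?F'" for a
      using that by (auto simp: unmarked_def)
    have yL: "({y}, B) \<notin> ?F'" "({z}, B) \<notin> ?F'" using ne by auto
    have \<pi>A: "\<pi> a \<in> A \<longleftrightarrow> a \<in> A" for a using permutes_in_image[OF perm(1)] .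
    have e: "({\<pi> y, \<pi> z}, B) \<in> ?F'" using act_iff[of "({y, z}, B)"] unfolding actB by simp
    have \<pi>ne: "\<pi> y \<noteq> \<pi> z" using ne inj(1) by (meson injD)
    have \<pi>L': "\<pi> y \<in> ?L \<or> \<pi> y = y \<or> \<pi> y = z" "\<pi> z \<in> ?L \<or> \<pi> z = y \<or> \<pi> z = z"
      using mem_L'[of "\<pi> y"] mem_L'[of "\<pi> z"] L'[of y] L'[of z] yL yz \<pi>A by blast+
    show "\<pi> = id \<and> \<beta> = id"
    proof (cases "{\<pi> y, \<pi> z} = {y, z}")
      case True
      have "act \<pi> \<beta> X \<in> F" if X: "X \<in> F" for X
      proof (cases "X = ({y}, B) \<or> X = ({z}, B)")
        case True
        moreover have "\<pi> y \<in> {y, z}" "\<pi> z \<in> {y, z}" using \<open>{\<pi> y, \<pi> z} = {y, z}\<close> by auto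
        ultimately show ?thesis using actB[of "{y}"] actB[of "{z}"] yz by auto
      next
        case False
        then have "act \<pi> \<beta> X \<in> ?F'" using X act_iff[of X] by blast
        moreover have "act \<pi> \<beta> X \<noteq> ({y, z}, B)"
        proof
          assume "act \<pi> \<beta> X = ({y, z}, B)"
          then have "act \<pi> \<beta> X = act \<pi> \<beta> ({y, z}, B)" using actB[of "{y, z}"] True by simp
          then have "X = ({y, z}, B)" using act_inj[OF inj] by (meson injD)
          then show False using X yz by simp
        qed
        ultimately show ?thesis by blast
      qed
      moreover have "rigid A B F" using F by (simp add: realizes_def)
      ultimately show ?thesis using perm rigidD by meson
    next
      case False
      let ?e = "({\<pi> y, \<pi> z}, B)"
      have "?e \<noteq> ({y, z}, B)" using False by simp
      then have eF: "?e \<in> F" using e by blast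
      have "\<exists>X\<in>F. \<pi> y \<in> fst X \<and> \<pi> z \<in> fst X" by (rule bexI[OF _ eF]) simp
      then have adje: "(\<pi> y, \<pi> z) \<in> ?E" using yz(1,2) \<pi>A by (simp add: adj_def)
      then have adje': "(\<pi> z, \<pi> y) \<in> ?E" by (rule adj_sym)
      \<comment> \<open>A member of \<open>F\<close> joining \<open>y\<close> or \<open>z\<close> to
        an unmarked point would contradict \<open>far1\<close>, so both ends of the image are
        unmarked.\<close>
      have inL: "\<pi> y \<in> ?L" "\<pi> z \<in> ?L"
        using \<pi>L' far1 adje adje' False \<pi>ne by (metis insert_commute)+
      let ?R = "adj A (F - {?e})" and ?R' = "adj A (?F' - {?e})" and ?Q = "adj A (?F' - {({y, z}, B)})"
      \<comment> \<open>Without the new edge the family differs from \<open>F\<close> only by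
        singletons, which join nothing.\<close>
      have QE: "?Q = ?E"
      proof -
        have ex: "(\<exists>X\<in>?F' - {({y, z}, B)}. a \<in> fst X \<and> b \<in> fst X) \<longleftrightarrow> (\<exists>X\<in>F. a \<in> fst X \<and> b \<in> fst X)" if "a \<noteq> b" for a b
        proof
          assume "\<exists>X\<in>?F' - {({y, z}, B)}. a \<in> fst X \<and> b \<in> fst X"
          then show "\<exists>X\<in>F. a \<in> fst X \<and> b \<in> fst X" by blast
        next
          assume "\<exists>X\<in>F. a \<in> fst X \<and> b \<in> fst X"
          then obtain X where X: "X \<in> F" "a \<in> fst X" "b \<in> fst X" by blast
          then have "X \<noteq> ({y}, B)" "X \<noteq> ({z}, B)" "X \<noteq> ({y, z}, B)" using that yz(5) by auto
          then show "\<exists>X\<in>?F' - {({y, z}, B)}. a \<in> fst X \<and> b \<in> fst X" using X by blast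
        qed
        have "(a, b) \<in> ?Q \<longleftrightarrow> (a, b) \<in> ?E" for a b by (rule adj_cong) (rule ex)
        then show ?thesis by (intro set_eqI) (simp only: split_paired_all)
      qed
      have Q_iff: "(a, b) \<in> ?Q \<longleftrightarrow> (\<pi> a, \<pi> b) \<in> ?R'" for a b
      proof -
        have h: "act \<pi> \<beta> ` (?F' - {({y, z}, B)}) = ?F' - {?e}"
          unfolding image_set_diff[OF act_inj[OF inj]] act_eq using actB[of "{y, z}"] by simp
        have "(\<exists>X\<in>?F' - {?e}. \<pi> a \<in> fst X \<and> \<pi> b \<in> fst X) \<longleftrightarrow>
            (\<exists>X\<in>?F' - {({y, z}, B)}. \<pi> a \<in> fst (act \<pi> \<beta> X) \<and> \<pi> b \<in> fst (act \<pi> \<beta> X))"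
          unfolding h[symmetric] by (rule bex_simps(7))
        then show ?thesis unfolding adj_def using \<pi>A inj(1) by (simp add: inj_image_mem_iff inj_eq)
      qed
      have Q_pow: "(a, b) \<in> ?Q ^^ n \<longleftrightarrow> (\<pi> a, \<pi> b) \<in> ?R' ^^ n" if "a \<in> A" for a b n
      proof (induction n arbitrary: b)
        case 0
        show ?case using inj(1) by (simp add: inj_eq)
      next
        case (Suc n)
        show ?case
        proof
          assume "(a, b) \<in> ?Q ^^ Suc n"
          then show "(\<pi> a, \<pi> b) \<in> ?R' ^^ Suc n" using Suc Q_iff by auto
        next
          assume "(\<pi> a, \<pi> b) \<in> ?R' ^^ Suc n"
          then obtain d where d: "(\<pi> a, d) \<in> ?R' ^^ n" "(d, \<pi> b) \<in> ?R'" by auto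
          obtain d' where "d = \<pi> d'" using permutes_surj[OF perm(1)] by (metis surjD)
          then show "(a, b) \<in> ?Q ^^ Suc n" using d Suc Q_iff by auto
        qed
      qed
      \<comment> \<open>The two families differ only in members through \<open>y\<close> or
        \<open>z\<close>, and a walk of fewer than \<open>c\<close> steps from \<open>x\<close>
        reaches neither.\<close>
      have R_pow: "(x, w) \<in> ?R' ^^ n \<longleftrightarrow> (x, w) \<in> ?R ^^ n" if x: "x \<in> ?L" and "n \<le> c" for x w n
        using \<open>n \<le> c\<close>
      proof (induction n arbitrary: w)
        case (Suc n)
        have step: "(v, w) \<in> ?R' \<longleftrightarrow> (v, w) \<in> ?R" if v: "(x, v) \<in> ?R ^^ n" for v
        proof -
          have "?R \<subseteq> ?E" by (auto simp: adj_def)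
          then have "(x, v) \<in> ?E ^^ n" by (rule relpow_subset[OF _ v])
          then have "v \<noteq> y" "v \<noteq> z" using far_yz[OF x] Suc.prems by auto
          then have "(\<exists>X\<in>?F' - {?e}. v \<in> fst X \<and> w \<in> fst X) \<longleftrightarrow> (\<exists>X\<in>F - {?e}. v \<in> fst X \<and> w \<in> fst X)"
          proof (intro iffI; elim bexE conjE)
            fix X assume "X \<in> ?F' - {?e}" "v \<in> fst X" "w \<in> fst X"
            moreover have "X \<noteq> ({y, z}, B)" using \<open>v \<in> fst X\<close> \<open>v \<noteq> y\<close> \<open>v \<noteq> z\<close> by auto
            ultimately show "\<exists>X\<in>F - {?e}. v \<in> fst X \<and> w \<in> fst X" by blast
          next
            fix X assume "X \<in> F - {?e}" "v \<in> fst X" "w \<in> fst X"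
            moreover have "X \<noteq> ({y}, B)" "X \<noteq> ({z}, B)" using \<open>v \<in> fst X\<close> \<open>v \<noteq> y\<close> \<open>v \<noteq> z\<close> by auto
            ultimately show "\<exists>X\<in>?F' - {?e}. v \<in> fst X \<and> w \<in> fst X" by blast
          qed
          then show ?thesis by (rule adj_cong)
        qed
        have IH: "(x, v) \<in> ?R' ^^ n \<longleftrightarrow> (x, v) \<in> ?R ^^ n" for v using Suc by simp
        have "(x, w) \<in> ?R' ^^ Suc n \<longleftrightarrow> (\<exists>v. (x, v) \<in> ?R' ^^ n \<and> (v, w) \<in> ?R')" by auto
        also have "\<dots> \<longleftrightarrow> (\<exists>v. (x, v) \<in> ?R ^^ n \<and> (v, w) \<in> ?R)" using IH step by blast
        also have "\<dots> \<longleftrightarrow> (x, w) \<in> ?R ^^ Suc n" by auto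
        finally show ?case .
      qed simp
      have "(\<pi> y, \<pi> z) \<in> ?R ^^ c"
        using c(2) Q_pow[OF yz(1)] R_pow[OF inL(1)] unfolding QE by simp
      then have "(\<pi> y, \<pi> z) \<in> ?R ^^ (c - 1)" using other[OF inL eF] by blast
      then have "(y, z) \<in> ?E ^^ (c - 1)"
        using Q_pow[OF yz(1)] R_pow[OF inL(1)] unfolding QE by simp
      then show ?thesis using c(3) by blast
    qed
  qed
  moreover have "?F' \<subseteq> Pow A \<times> Pow B" using sub yz by auto
  moreover have "({}, {}) \<notin> ?F'" using F by (auto simp: realizes_def)
  ultimately have "realizes A B n1 (n2 - 1) ?F'" using degA degB by (simp add: realizes_def)
  then show ?thesis by blast
qed

lemma card_adj_le:
  assumes "finite A" "finite F" "F \<subseteq> Pow A \<times> Pow B" "a \<in> A" "card {X \<in> F. a \<in> fst X} = n1"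
    and d: "\<And>X. X \<in> F \<Longrightarrow> card (fst X) \<le> d"
  shows "card (adj A F `` {a}) \<le> 1 + n1 * d"
proof -
  let ?G = "{X \<in> F. a \<in> fst X}"
  have finX: "finite (fst X)" if "X \<in> F" for X
    using family_subset(1)[OF assms(3) that] assms(1) finite_subset by blast
  have "adj A F `` {a} \<subseteq> insert a (\<Union>X\<in>?G. fst X)" by (auto simp: adj_def)
  moreover have "finite (\<Union>X\<in>?G. fst X)" using assms(2) finX by auto
  ultimately have "card (adj A F `` {a}) \<le> card (insert a (\<Union>X\<in>?G. fst X))" by (meson card_mono finite_insert)
  also have "\<dots> \<le> 1 + card (\<Union>X\<in>?G. fst X)" by (simp add: card_insert_le_m1 card_insert_if \<open>finite (\<Union>X\<in>?G. fst X)\<close>)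
  also have "card (\<Union>X\<in>?G. fst X) \<le> (\<Sum>X\<in>?G. card (fst X))" by (rule card_UN_le) (use assms(2) in simp)
  also have "\<dots> \<le> (\<Sum>X\<in>?G. d)" by (rule sum_mono) (use d in simp)
  also have "\<dots> = n1 * d" using assms(5) by simp
  finally show ?thesis by simp
qed

lemma card_relpow_adj_le:
  assumes "\<And>a. a \<in> A \<Longrightarrow> card (adj A F `` {a}) \<le> \<Delta>" "finite A" "S \<subseteq> A"
  shows "card ((adj A F ^^ n) `` S) \<le> card S * \<Delta> ^ n \<and> (adj A F ^^ n) `` S \<subseteq> A"
proof (induction n)
  case 0
  then show ?case using assms by simp
next
  case (Suc n)
  let ?T = "(adj A F ^^ n) `` S"
  have T: "?T \<subseteq> A" "card ?T \<le> card S * \<Delta> ^ n" using Suc by auto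
  have eq: "(adj A F ^^ Suc n) `` S = (\<Union>a\<in>?T. adj A F `` {a})" by auto
  have "card (\<Union>a\<in>?T. adj A F `` {a}) \<le> (\<Sum>a\<in>?T. card (adj A F `` {a}))"
    by (rule card_UN_le) (use T assms(2) finite_subset in blast)
  also have "\<dots> \<le> (\<Sum>a\<in>?T. \<Delta>)" by (rule sum_mono) (use T assms(1) in blast)
  also have "\<dots> \<le> card S * \<Delta> ^ n * \<Delta>" using T(2) by simp
  finally have "card ((adj A F ^^ Suc n) `` S) \<le> card S * \<Delta> ^ Suc n" unfolding eq by (simp add: ac_simps)
  moreover have "(adj A F ^^ Suc n) `` S \<subseteq> A" unfolding eq by (auto simp: adj_def)
  ultimately show ?case by blast
qed

text \<open>A pair of unmarked points can be \<open>bad\<close> for only one length, its distance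
  after deletion of the edge, and there are at most \<open>u\<^sup>2\<close> pairs; so one of the
  \<open>u\<^sup>2 + 1\<close> lengths from 2 to \<open>u\<^sup>2 + 2\<close> is bad for none. The
  size assumption leaves a point \<open>y\<close> in a component with more than
  \<open>\<Delta> ^ (u\<^sup>2 + 2)\<close> points and at distance more than
  \<open>2 * (u\<^sup>2 + 2)\<close> from all unmarked points.\<close>

lemma descent_chord:
  fixes A :: "'a set" and B :: "'b set"
  defines "G \<equiv> \<lambda>s. s * (Suc s * 2 ^ (2 ^ s * 2 ^ card B))"
  assumes fin: "finite A" "finite B" and F: "realizes A B n1 n2 F"
    and u: "card (unmarked A B F) \<le> u" and d: "\<And>X. X \<in> F \<Longrightarrow> card (fst X) \<le> d"
    and \<Delta>: "\<Delta> = 1 + n1 * d"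
    and big: "G (\<Delta> ^ (u\<^sup>2 + 2)) + u * \<Delta> ^ (2 * (u\<^sup>2 + 2)) < card A"
  shows "\<exists>F'. realizes A B n1 (n2 - 1) F'"
proof -
  let ?E = "adj A F" and ?L = "unmarked A B F" and ?m = "u\<^sup>2 + 2"
  let ?s = "\<Delta> ^ ?m"
  have finF: "finite F" using F fin realizes_finite by blast
  have sub: "F \<subseteq> Pow A \<times> Pow B" using F by (simp add: realizes_def)
  have deg: "card {X \<in> F. a \<in> fst X} = n1" if "a \<in> A" for a using F that by (simp add: realizes_def)
  have \<Delta>1: "card (?E `` {a}) \<le> \<Delta>" if "a \<in> A" for a
    unfolding \<Delta> by (rule card_adj_le[OF fin(1) finF sub that deg[OF that] d])
  have ball: "card ((?E ^^ n) `` S) \<le> card S * \<Delta> ^ n \<and> (?E ^^ n) `` S \<subseteq> A" if "S \<subseteq> A" for S n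
    by (rule card_relpow_adj_le) (use \<Delta>1 fin(1) that in auto)
  have LA: "?L \<subseteq> A" by (auto simp: unmarked_def)
  have finL: "finite ?L" using LA fin(1) finite_subset by blast
  define R where "R p = adj A (F - {({fst p, snd p}, B)})" for p :: "'a \<times> 'a"
  define bad where "bad c p \<longleftrightarrow> p \<in> R p ^^ c \<and> p \<notin> R p ^^ (c - 1)" for c p
  have "\<exists>c\<in>{2..?m}. \<forall>p\<in>?L \<times> ?L. \<not> bad c p"
  proof (rule ccontr)
    assume "\<not> ?thesis"
    then have "\<forall>c\<in>{2..?m}. \<exists>p. p \<in> ?L \<times> ?L \<and> bad c p" by blast
    then obtain f where f: "\<And>c. c \<in> {2..?m} \<Longrightarrow> f c \<in> ?L \<times> ?L \<and> bad c (f c)" by (rule bchoice[THEN exE]) blast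
    have lt: False if c: "c \<in> {2..?m}" "c' \<in> {2..?m}" "f c = f c'" "c < c'" for c c'
    proof -
      let ?p = "f c"
      have pc: "(fst ?p, snd ?p) \<in> R ?p ^^ c" using f[OF c(1)] by (simp add: bad_def)
      have pA: "fst ?p \<in> A" using f[OF c(1)] LA by (auto simp: mem_Times_iff)
      have "(fst ?p, snd ?p) \<in> R ?p ^^ (c' - 1)"
        using pc unfolding R_def by (rule relpow_adj_mono[OF _ pA]) (use c(4) in simp)
      then have "?p \<in> R ?p ^^ (c' - 1)" by simp
      moreover have "?p \<notin> R ?p ^^ (c' - 1)" using f[OF c(2)] c(3) by (simp add: bad_def)
      ultimately show False by blast
    qed
    have "inj_on f {2..?m}"
    proof (rule inj_onI, rule ccontr)
      fix c c' assume "c \<in> {2..?m}" "c' \<in> {2..?m}" "f c = f c'" "c \<noteq> c'"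
      then show False using lt[of c c'] lt[of c' c] by (cases "c < c'") auto
    qed
    moreover have "f ` {2..?m} \<subseteq> ?L \<times> ?L" using f by blast
    ultimately have "card {2..?m} \<le> card (?L \<times> ?L)" using finL by (intro card_inj_on_le) auto
    also have "\<dots> \<le> u * u" unfolding card_cartesian_product by (rule mult_le_mono[OF u u])
    finally show False by (simp add: power2_eq_square)
  qed
  then obtain c where c: "2 \<le> c" "c \<le> ?m" "\<And>p. p \<in> ?L \<times> ?L \<Longrightarrow> \<not> bad c p" by auto
  let ?U = "\<Union>{K \<in> comps A F. card K \<le> ?s}" and ?V = "(?E ^^ (2 * ?m)) `` ?L"
  have "card (?U \<union> ?V) \<le> card ?U + card ?V" by (rule card_Un_le)
  also have "card ?U \<le> G ?s" unfolding G_def by (rule card_small_union[OF fin F])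
  also have "card ?V \<le> u * \<Delta> ^ (2 * ?m)"
    using ball[OF LA, of "2 * ?m"] u by (meson le_trans mult_le_mono1)
  finally have lt: "card (?U \<union> ?V) < card A" using big by simp
  have "?U \<subseteq> A" using Union_comps[OF sub] by blast
  moreover have "?V \<subseteq> A" using ball[OF LA] by blast
  ultimately have finUV: "finite (?U \<union> ?V)" by (intro finite_UnI) (rule finite_subset[OF _ fin(1)], assumption)+
  have "\<exists>y\<in>A. y \<notin> ?U \<union> ?V"
  proof (rule ccontr)
    assume "\<not> ?thesis"
    then have "A \<subseteq> ?U \<union> ?V" by (meson subsetI)
    from card_mono[OF finUV this] lt show False by linarith
  qed
  then obtain y where y: "y \<in> A" "y \<notin> ?U" "y \<notin> ?V" by (elim bexE) simp
  have yy: "(y, y) \<in> ?E ^^ n" for n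
  proof -
    have "(y, y) \<in> ?E ^^ 0" by simp
    then show ?thesis by (rule relpow_adj_mono[OF _ y(1)]) simp
  qed
  have far: "(x, y) \<notin> ?E ^^ n" if x: "x \<in> ?L" and n: "n \<le> 2 * ?m" for x n
  proof
    assume "(x, y) \<in> ?E ^^ n"
    then have "(x, y) \<in> ?E ^^ (2 * ?m)" by (rule relpow_adj_mono) (use x LA n in auto)
    then show False using y(3) x by blast
  qed
  have yL: "y \<notin> ?L" using far[of y 0] yy[of 0] by auto
  have K: "component A F y \<in> comps A F" using y(1) by (simp add: comps_def)
  have Kbig: "?s < card (component A F y)"
  proof (rule ccontr)
    assume "\<not> ?thesis"
    then have "component A F y \<subseteq> ?U" using K by auto
    then show False using y(2) in_component[of y A F] by blast
  qed
  let ?W = "(?E ^^ (c - 1)) `` {y}"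
  \<comment> \<open>Otherwise the ball of radius \<open>c - 1\<close> around \<open>y\<close> would
    be closed and contain the whole component, which has more points than such a ball.\<close>
  have "\<exists>z. (y, z) \<in> ?E ^^ c \<and> (y, z) \<notin> ?E ^^ (c - 1)"
  proof (rule ccontr)
    assume no: "\<not> ?thesis"
    have W: "?W \<subseteq> A" "card ?W \<le> \<Delta> ^ (c - 1)" using ball[of "{y}" "c - 1"] y(1) by auto
    have "closed_in A F ?W" unfolding closed_in_def
    proof (intro conjI ballI impI W(1))
      fix X assume X: "X \<in> F" "fst X \<inter> ?W \<noteq> {}"
      then obtain v where v: "v \<in> fst X" "(y, v) \<in> ?E ^^ (c - 1)" by blast
      show "fst X \<subseteq> ?W"
      proof
        fix x assume x: "x \<in> fst X"
        have "v \<in> A" "x \<in> A" using v(1) x family_subset(1)[OF sub X(1)] by auto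
        then have "(v, x) \<in> ?E" using v(1) x X(1) by (auto simp: adj_def)
        with v(2) have "(y, x) \<in> ?E ^^ Suc (c - 1)" by (rule relpow_Suc_I)
        then have "(y, x) \<in> ?E ^^ c" using c(1) by simp
        then show "x \<in> ?W" using no by blast
      qed
    qed
    then have "component A F y \<subseteq> ?W" by (rule component_minimal) (use yy in blast)
    then have "card (component A F y) \<le> \<Delta> ^ (c - 1)"
      using W card_mono[of ?W "component A F y"] finite_subset[OF W(1) fin(1)] by linarith
    also have "\<dots> \<le> ?s" using c(2) \<Delta> by (intro power_increasing) auto
    finally show False using Kbig by simp
  qed
  then obtain z where z: "(y, z) \<in> ?E ^^ c" "(y, z) \<notin> ?E ^^ (c - 1)" by blast
  have zA: "z \<in> A" by (rule relpow_adj_in[OF z(1) y(1)])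
  have zL: "z \<notin> ?L"
  proof
    assume zL: "z \<in> ?L"
    have "(z, y) \<in> ?E ^^ c" by (rule relpow_adj_sym[OF z(1)])
    then show False using far[OF zL, of c] c(2) by simp
  qed
  show ?thesis
  proof (rule chord_replacement[OF fin F y(1) zA _ _ _ c(1) z])
    show "({y}, B) \<in> F" "({z}, B) \<in> F" using yL zL y(1) zA by (auto simp: unmarked_def)
    show "({y, z}, B) \<notin> F"
    proof
      assume yzF: "({y, z}, B) \<in> F"
      have "\<exists>X\<in>F. y \<in> fst X \<and> z \<in> fst X" by (rule bexI[OF _ yzF]) simp
      then have "(y, z) \<in> ?E" using y(1) zA by (simp add: adj_def)
      then have "(y, z) \<in> ?E ^^ 1" by simp
      then have "(y, z) \<in> ?E ^^ (c - 1)" by (rule relpow_adj_mono[OF _ y(1)]) (use c(1) in simp)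
      then show False using z(2) by blast
    qed
    show "(x, y) \<notin> ?E ^^ (2 * c)" if "x \<in> ?L" for x by (rule far[OF that]) (use c(2) in simp)
    show "(x1, x2) \<in> adj A (F - {({x1, x2}, B)}) ^^ (c - 1)"
      if "x1 \<in> ?L" "x2 \<in> ?L" "(x1, x2) \<in> adj A (F - {({x1, x2}, B)}) ^^ c" for x1 x2
      using c(3)[of "(x1, x2)"] that by (auto simp: bad_def R_def)
  qed
qed

section \<open>Incidence matrices with prescribed column sums and balanced rows\<close>

text \<open>In the applications a column is a colour \<open>T\<close>, and \<open>col T\<close> is
  the set of points \<open>a\<close> that receive the class \<open>({a}, T)\<close>; a row sum is
  the number of such classes at one point.\<close>

definition row :: "'c set \<Rightarrow> ('c \<Rightarrow> 'r set) \<Rightarrow> 'r \<Rightarrow> 'c set" where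
  "row C col x = {c \<in> C. x \<in> col c}"

definition columns :: "'r set \<Rightarrow> 'c set \<Rightarrow> ('c \<Rightarrow> nat) \<Rightarrow> ('c \<Rightarrow> 'r set) \<Rightarrow> bool" where
  "columns R C s col \<longleftrightarrow> (\<forall>c\<in>C. col c \<subseteq> R \<and> card (col c) = s c)"

definition balanced :: "'r set \<Rightarrow> 'c set \<Rightarrow> ('c \<Rightarrow> 'r set) \<Rightarrow> bool" where
  "balanced R C col \<longleftrightarrow> (\<forall>x\<in>R. \<forall>y\<in>R. card (row C col x) \<le> card (row C col y) + 1)"

lemma sum_card_row:
  assumes "finite R" "finite C" "columns R C s col"
  shows "(\<Sum>x\<in>R. card (row C col x)) = (\<Sum>c\<in>C. s c)"
proof -
  have "(\<Sum>x\<in>R. card (row C col x)) = (\<Sum>x\<in>R. \<Sum>c\<in>C. if x \<in> col c then 1 else 0)"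
    using assms(2) by (simp add: row_def sum.If_cases Int_def)
  also have "\<dots> = (\<Sum>c\<in>C. \<Sum>x\<in>R. if x \<in> col c then 1 else 0)"
    by (rule sum.swap)
  also have "\<dots> = (\<Sum>c\<in>C. card (col c))"
  proof (rule sum.cong)
    fix c assume "c \<in> C"
    then have "col c \<subseteq> R" using assms(3) by (simp add: columns_def)
    then have "R \<inter> {x. x \<in> col c} = col c" by blast
    then show "(\<Sum>x\<in>R. if x \<in> col c then 1 else 0) = card (col c)"
      using assms(1) by (simp add: sum.If_cases)
  qed simp
  also have "\<dots> = (\<Sum>c\<in>C. s c)" using assms(3) by (simp add: columns_def)
  finally show ?thesis .
qed

definition move :: "('c \<Rightarrow> 'r set) \<Rightarrow> 'c \<Rightarrow> 'r \<Rightarrow> 'r \<Rightarrow> 'c \<Rightarrow> 'r set" where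
  "move col c x y = col(c := insert y (col c - {x}))"

lemma columns_move:
  assumes "finite R" "columns R C s col" "x \<in> col c" "y \<notin> col c" "y \<in> R"
  shows "columns R C s (move col c x y)"
proof -
  have "card (insert y (col c - {x})) = s c" if "c \<in> C"
  proof -
    have fin: "finite (col c)" using assms that by (meson columns_def finite_subset)
    then have "card (insert y (col c - {x})) = Suc (card (col c - {x}))"
      using assms(4) by simp
    also have "\<dots> = card (col c)" using fin assms(3) by (metis card_Suc_Diff1)
    finally show ?thesis using assms that by (simp add: columns_def)
  qed
  then show ?thesis using assms by (auto simp: columns_def move_def)
qed

lemma row_move:
  assumes "x \<in> col c" "y \<notin> col c" "c \<in> C"
  shows "row C (move col c x y) z =
    (if z = x then row C col x - {c} else if z = y then insert c (row C col y) else row C col z)"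
  using assms by (auto simp: row_def move_def)

lemma card_row_move:
  assumes "finite C" "x \<in> col c" "y \<notin> col c" "c \<in> C"
  shows "card (row C (move col c x y) z) =
    (if z = x then card (row C col x) - 1 else if z = y then card (row C col y) + 1
     else card (row C col z))"
    and "card (row C col x) \<ge> 1"
proof -
  have f: "finite (row C col u)" for u using assms(1) by (simp add: row_def)
  have "c \<in> row C col x" "c \<notin> row C col y" using assms by (auto simp: row_def)
  then show "card (row C (move col c x y) z) =
    (if z = x then card (row C col x) - 1 else if z = y then card (row C col y) + 1
     else card (row C col z))" using f by (simp add: row_move[where col=col and c=c, OF assms(2-4)])
  show "card (row C col x) \<ge> 1" using f \<open>c \<in> row C col x\<close>
    by (metis One_nat_def Suc_leI card_gt_0_iff empty_iff)
qed

lemma ex_row_diff: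
  assumes "finite C" "card (row C col y) < card (row C col x)"
  obtains c where "c \<in> C" "x \<in> col c" "y \<notin> col c"
proof -
  have "\<not> row C col x \<subseteq> row C col y"
    using assms card_mono[of "row C col y" "row C col x"] by (auto simp: row_def)
  then show ?thesis using that by (auto simp: row_def)
qed

text \<open>Minimise the sum of the squares of the row sums: shifting an entry to a row that is
  shorter by at least two decreases it.\<close>

lemma ex_balanced:
  assumes "finite R" "finite C" "\<And>c. c \<in> C \<Longrightarrow> s c \<le> card R"
  shows "\<exists>col. columns R C s col \<and> balanced R C col"
proof -
  let ?f = "\<lambda>col. \<Sum>x\<in>R. (card (row C col x))\<^sup>2"
  have "\<forall>c\<in>C. \<exists>X. X \<subseteq> R \<and> card X = s c"
    using assms by (meson obtain_subset_with_card_n)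
  then obtain col0 where "columns R C s col0" unfolding columns_def by metis
  then obtain col where col: "columns R C s col" and min: "\<And>col'. columns R C s col' \<Longrightarrow> ?f col \<le> ?f col'"
    using ex_has_least_nat[of "columns R C s" col0 ?f] by blast
  have "balanced R C col" unfolding balanced_def
  proof (intro ballI, rule ccontr)
    fix x y assume xy: "x \<in> R" "y \<in> R" "\<not> card (row C col x) \<le> card (row C col y) + 1"
    then obtain c where c: "c \<in> C" "x \<in> col c" "y \<notin> col c"
      using ex_row_diff[OF assms(2), of col y x] by auto
    have ne: "x \<noteq> y" using c by auto
    let ?r = "\<lambda>z. card (row C col z)" and ?r' = "\<lambda>z. card (row C (move col c x y) z)"
    have "?f col = (?r x)\<^sup>2 + (?r y)\<^sup>2 + (\<Sum>z\<in>R - {x} - {y}. (?r z)\<^sup>2)"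
      using xy ne assms(1) by (simp add: sum.remove[of R x] sum.remove[of "R - {x}" y])
    moreover have "?f (move col c x y) = (?r x - 1)\<^sup>2 + (?r y + 1)\<^sup>2 + (\<Sum>z\<in>R - {x} - {y}. (?r z)\<^sup>2)"
    proof -
      have "(\<Sum>z\<in>R - {x} - {y}. (?r' z)\<^sup>2) = (\<Sum>z\<in>R - {x} - {y}. (?r z)\<^sup>2)"
        by (rule sum.cong) (auto simp: card_row_move(1)[where col=col and c=c, OF assms(2) c(2,3,1)])
      moreover have "?r' x = ?r x - 1" "?r' y = ?r y + 1"
        using ne by (simp_all add: card_row_move(1)[where col=col and c=c, OF assms(2) c(2,3,1)])
      moreover have "?f (move col c x y) = (?r' x)\<^sup>2 + ((?r' y)\<^sup>2 + (\<Sum>z\<in>R - {x} - {y}. (?r' z)\<^sup>2))"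
        using xy ne assms(1) by (subst sum.remove[of R x], simp, simp, subst sum.remove[of "R - {x}" y]) auto
      ultimately show ?thesis by simp
    qed
    moreover have "(?r x - 1)\<^sup>2 + (?r y + 1)\<^sup>2 < (?r x)\<^sup>2 + (?r y)\<^sup>2"
    proof -
      obtain k where "?r x = ?r y + 2 + k" using xy(3) by (metis add.assoc add_Suc_right add_Suc_shift le_add_diff_inverse nat_1_add_1 not_less_eq_eq plus_1_eq_Suc)
      then show ?thesis by (simp add: power2_eq_square algebra_simps)
    qed
    moreover have "?f col \<le> ?f (move col c x y)"
      by (intro min columns_move) (use assms col c xy in auto)
    ultimately show False by linarith
  qed
  with col show ?thesis by blast
qed

text \<open>Among balanced matrices take one with the most distinct columns. If two columns equal
  the same proper set, replace \<open>x\<close> by \<open>y\<close> in one of them and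
  \<open>y\<close> by \<open>x\<close> in a third column \<open>d\<close>: the row sums stay, and
  for a suitable pair both changed columns are new. At most \<open>card C + card C ^ 2\<close> pairs
  fail, while at least \<open>card R - 1\<close> are available.\<close>

lemma ex_balanced_distinct:
  assumes fin: "finite R" "finite C" and s: "\<And>c. c \<in> C \<Longrightarrow> s c \<le> card R"
    and big: "card C ^ 2 + card C < card R - 1"
  shows "\<exists>col. columns R C s col \<and> balanced R C col \<and>
    (\<forall>c\<in>C. \<forall>c'\<in>C. c \<noteq> c' \<longrightarrow> col c = col c' \<longrightarrow> col c = {} \<or> col c = R)"
proof -
  let ?P = "\<lambda>col. columns R C s col \<and> balanced R C col"
  obtain col0 where "?P col0" using ex_balanced[of R C s, OF fin s] by blast
  moreover have "\<forall>col. ?P col \<longrightarrow> card (col ` C) < Suc (card C)"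
    using fin(2) by (simp add: card_image_le le_imp_less_Suc)
  ultimately obtain col where P: "?P col" and max: "\<And>col'. ?P col' \<Longrightarrow> card (col' ` C) \<le> card (col ` C)"
    using ex_has_greatest_nat[of ?P col0 "\<lambda>col. card (col ` C)" "Suc (card C)"] by auto
  have "col c = {} \<or> col c = R" if cc: "c \<in> C" "c' \<in> C" "c \<noteq> c'" "col c = col c'" for c c'
  proof (rule ccontr)
    assume proper: "\<not> (col c = {} \<or> col c = R)"
    let ?A = "col c" and ?I = "col ` C"
    have AR: "?A \<subseteq> R" "finite ?A" using P cc fin by (auto simp: columns_def intro: finite_subset)
    let ?bad1 = "{(x, y) \<in> ?A \<times> (R - ?A). insert y (?A - {x}) \<in> ?I}"
    let ?bad2 = "{(x, y) \<in> ?A \<times> (R - ?A). \<exists>c''\<in>C. y \<in> col c'' \<and> x \<notin> col c'' \<and> insert x (col c'' - {y}) \<in> ?I}"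
    have finI: "finite ?I" "card ?I \<le> card C" using fin by (auto simp: card_image_le)
    have finAA: "finite (?A \<times> (R - ?A))" using fin AR by simp
    have b1: "card ?bad1 \<le> card ?I"
    proof (rule card_inj_on_le)
      show "inj_on (\<lambda>(x, y). insert y (?A - {x})) ?bad1"
        by (rule inj_onI) (auto simp: set_eq_iff, metis+)
    qed (use finI in auto)
    have b2: "card ?bad2 \<le> card (?I \<times> ?I)"
    proof -
      \<comment> \<open>The pair \<open>(x, y)\<close> can be read off from the column before and
        after the exchange, so failures of the second kind are counted by pairs of columns.\<close>
      let ?g = "\<lambda>(U, V). (THE x. x \<in> V - U, THE y. y \<in> U - V)"
      have "?bad2 \<subseteq> ?g ` (?I \<times> ?I)"
      proof
        fix z assume "z \<in> ?bad2"
        then obtain x y c'' where z: "z = (x, y)" "x \<in> ?A" "y \<in> R - ?A" "c'' \<in> C" "y \<in> col c''" "x \<notin> col c''"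
          "insert x (col c'' - {y}) \<in> ?I" by blast
        have e: "insert x (col c'' - {y}) - col c'' = {x}" "col c'' - insert x (col c'' - {y}) = {y}"
          using z by auto
        have "?g (col c'', insert x (col c'' - {y})) = z" unfolding prod.case e z(1) by (intro arg_cong2[where f=Pair] the_equality) auto
        then show "z \<in> ?g ` (?I \<times> ?I)" using z by (metis (no_types, lifting) SigmaI imageI)
      qed
      then show ?thesis using finI by (meson finite_SigmaI surj_card_le)
    qed
    have "card (?bad1 \<union> ?bad2) \<le> card ?I + card (?I \<times> ?I)"
      using b1 b2 card_Un_le[of ?bad1 ?bad2] by linarith
    also have "\<dots> \<le> card C + card C ^ 2"
      using finI by (simp add: card_cartesian_product power2_eq_square add_mono mult_le_mono)
    also have "\<dots> < card R - 1" using big by simp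
    also have "card R - 1 \<le> card (?A \<times> (R - ?A))"
    proof -
      have "card (R - ?A) = card R - card ?A" "card ?A < card R" "card ?A \<ge> 1"
        using AR fin proper by (auto simp: card_Diff_subset psubset_card_mono psubset_eq Suc_le_eq card_gt_0_iff)
      moreover have "k - 1 \<le> a * (k - a)" if ak: "a < k" "1 \<le> a" for a k :: nat
      proof -
        obtain d where d: "a = Suc d" using ak(2) by (cases a) auto
        obtain e where e: "k = Suc (a + e)" using ak(1) less_iff_Suc_add by auto
        have "k - a = Suc e" using e by simp
        then show ?thesis using d e by simp
      qed
      ultimately show ?thesis by (simp add: card_cartesian_product)
    qed
    finally have "\<not> ?A \<times> (R - ?A) \<subseteq> ?bad1 \<union> ?bad2"
    proof -
      assume lt: "card (?bad1 \<union> ?bad2) < card (?A \<times> (R - ?A))"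
      have "finite (?bad1 \<union> ?bad2)" by (rule finite_subset[OF _ finAA]) auto
      then show ?thesis using lt by (meson card_mono leD)
    qed
    then obtain x y where xy: "x \<in> ?A" "y \<in> R" "y \<notin> ?A" and nb1: "insert y (?A - {x}) \<notin> ?I"
      and nb2: "\<And>c''. c'' \<in> C \<Longrightarrow> y \<in> col c'' \<Longrightarrow> x \<notin> col c'' \<Longrightarrow> insert x (col c'' - {y}) \<notin> ?I"
      by blast
    \<comment> \<open>Row \<open>x\<close> contains both equal columns and row \<open>y\<close>
      neither; if no column contained \<open>y\<close> without \<open>x\<close>, the row sums would
      differ by at least two.\<close>
    have "\<exists>c''\<in>C. y \<in> col c'' \<and> x \<notin> col c''"
    proof (rule ccontr)
      assume "\<not> ?thesis"
      then have "row C col y \<subseteq> row C col x - {c} - {c'}"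
        using xy cc by (auto simp: row_def)
      moreover have "{c, c'} \<subseteq> row C col x" using xy cc by (auto simp: row_def)
      moreover have "finite (row C col x)" using fin by (simp add: row_def)
      ultimately have "card (row C col y) + 2 \<le> card (row C col x)"
        using cc(3) card_mono[of "row C col x - {c} - {c'}" "row C col y"]
          card_mono[of "row C col x" "{c, c'}"] by (simp add: card_Diff_singleton)
      moreover have "card (row C col x) \<le> card (row C col y) + 1"
        using P xy AR by (auto simp: balanced_def)
      ultimately show False by simp
    qed
    then obtain d where d: "d \<in> C" "y \<in> col d" "x \<notin> col d" by blast
    have dc: "d \<noteq> c" "d \<noteq> c'" using d xy cc by auto
    let ?m = "move col c x y" let ?col' = "move ?m d y x"
    have xR: "x \<in> R" using xy AR by blast
    have cols: "columns R C s ?m" by (intro columns_move) (use P xy fin in auto)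
    have md: "?m d = col d" using dc by (simp add: move_def)
    have cols': "columns R C s ?col'"
      by (rule columns_move[where col="?m" and c=d]) (use cols fin xR d md in auto)
    have "card (row C ?col' z) = card (row C col z)" for z
    proof -
      have ne: "x \<noteq> y" using xy by auto
      note 1 = card_row_move[where col=col and c=c, OF fin(2) xy(1,3) cc(1)]
      have 2: "y \<in> ?m d" "x \<notin> ?m d" using d md by auto
      show ?thesis using card_row_move(1)[where col="?m" and c=d, OF fin(2) 2 d(1), of z] 1 ne by auto
    qed
    then have "?P ?col'" using P cols' by (simp add: balanced_def)
    then have le: "card (?col' ` C) \<le> card ?I" by (rule max)
    let ?n1 = "insert y (?A - {x})" and ?n2 = "insert x (col d - {y})"
    have n12: "?n1 \<noteq> ?n2" using xy by auto
    have nn: "?n1 \<notin> ?I" "?n2 \<notin> ?I" using nb1 nb2 d by auto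
    \<comment> \<open>Only the old value of column \<open>d\<close> can disappear, because
      \<open>c'\<close> still has the old value of \<open>c\<close>; two new values appear.\<close>
    have "insert ?n1 (insert ?n2 (?I - {col d})) \<subseteq> ?col' ` C"
    proof -
      have "?col' c = ?n1" "?col' d = ?n2" using dc by (auto simp: move_def)
      then have n12': "?n1 \<in> ?col' ` C" "?n2 \<in> ?col' ` C" using cc(1) d(1) by (metis imageI)+
      have "col u \<in> ?col' ` C" if "u \<in> C" "col u \<noteq> col d" for u
      proof (cases "u = c")
        case True
        then have "?col' c' = col u" using cc dc by (auto simp: move_def)
        then show ?thesis using cc by (metis imageI)
      next
        case False
        then have "?col' u = col u" using that by (auto simp: move_def)
        then show ?thesis using that by (metis imageI)
      qed
      then have "?I - {col d} \<subseteq> ?col' ` C" by blast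
      then show ?thesis using n12' by simp
    qed
    then have "card (insert ?n1 (insert ?n2 (?I - {col d}))) \<le> card (?col' ` C)"
      using fin by (simp add: card_mono)
    moreover have "card (insert ?n1 (insert ?n2 (?I - {col d}))) = card ?I + 1"
    proof -
      have "col d \<in> ?I" using d(1) by blast
      then have "Suc (card (?I - {col d})) = card ?I" using finI(1) by (metis card.remove)
      moreover have "?n2 \<notin> ?I - {col d}" "?n1 \<notin> insert ?n2 (?I - {col d})" using nn n12 by blast+
      moreover have "finite (?I - {col d})" using finI(1) by simp
      ultimately show ?thesis using card_insert_disjoint by (metis Suc_eq_plus1 finite_insert)
    qed
    ultimately show False using le by simp
  qed
  with P show ?thesis by blast
qed

lemma balanced_rows_const:
  assumes "finite R" "finite C" "columns R C s col" "balanced R C col"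
    "(\<Sum>c\<in>C. s c) = card R * q" "x \<in> R"
  shows "card (row C col x) = q"
proof (rule ccontr)
  let ?r = "\<lambda>x. card (row C col x)"
  assume ne: "?r x \<noteq> q"
  have bal: "?r u \<le> ?r v + 1" if "u \<in> R" "v \<in> R" for u v using that assms by (auto simp: balanced_def)
  have sum: "(\<Sum>x\<in>R. ?r x) = (\<Sum>x\<in>R. q)" using sum_card_row[OF assms(1-3)] assms(5) by simp
  from ne consider "?r x < q" | "?r x > q" by linarith
  then show False
  proof cases
    case 1
    then have "(\<Sum>x\<in>R. ?r x) < (\<Sum>x\<in>R. q)"
      using assms bal[OF _ assms(6)] by (intro sum_strict_mono_ex1) fastforce+
    then show False using sum by simp
  next
    case 2
    then have "(\<Sum>x\<in>R. q) < (\<Sum>x\<in>R. ?r x)"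
      using assms bal[OF assms(6)] by (intro sum_strict_mono_ex1) fastforce+
    then show False using sum by simp
  qed
qed

lemma balanced_rows_one:
  assumes fin: "finite R" "finite C" and cols: "columns R C s col" and bal: "balanced R C col"
    and tot: "(\<Sum>c\<in>C. s c) = card R * q + 1" and R2: "2 \<le> card R"
  shows "\<exists>x\<in>R. card (row C col x) = q + 1 \<and> (\<forall>y\<in>R - {x}. card (row C col y) = q)"
proof -
  let ?r = "\<lambda>x. card (row C col x)"
  have bal: "?r u \<le> ?r v + 1" if "u \<in> R" "v \<in> R" for u v using that bal by (auto simp: balanced_def)
  have sum: "(\<Sum>x\<in>R. ?r x) = card R * q + 1" using sum_card_row[OF fin cols] tot by simp
  have ge: "q \<le> ?r x" if "x \<in> R" for x
  proof (rule ccontr)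
    assume "\<not> q \<le> ?r x"
    then have "\<forall>y\<in>R. ?r y \<le> q" using bal[OF _ that] by fastforce
    then have "(\<Sum>x\<in>R. ?r x) \<le> (\<Sum>x\<in>R. q)" by (intro sum_mono) auto
    then show False using sum by simp
  qed
  have le: "?r x \<le> q + 1" if "x \<in> R" for x
  proof (rule ccontr)
    assume "\<not> ?r x \<le> q + 1"
    then have "\<forall>y\<in>R. q + 1 \<le> ?r y" using bal[OF that] by fastforce
    then have "(\<Sum>x\<in>R. q + 1) \<le> (\<Sum>x\<in>R. ?r x)" by (intro sum_mono) auto
    then show False using sum R2 by simp
  qed
  have "(\<Sum>x\<in>R. ?r x - q) = 1"
  proof -
    have "(\<Sum>x\<in>R. ?r x) = (\<Sum>x\<in>R. (?r x - q) + q)" using ge by (intro sum.cong) auto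
    then show ?thesis using sum by (simp add: sum.distrib)
  qed
  then obtain x where x: "x \<in> R" "?r x - q = 1" "\<forall>y\<in>R. x \<noteq> y \<longrightarrow> ?r y - q = 0"
    using sum_eq_1_iff[OF fin(1), of "\<lambda>x. ?r x - q"] by auto
  show ?thesis using x ge by (intro bexI[of _ x]) fastforce+
qed

section \<open>Rebuilding a union of components as a coloured path\<close>

lemma ex_colouring:
  fixes p :: "'c \<Rightarrow> nat"
  assumes "finite C" "(\<Sum>c\<in>C. p c) = N"
  shows "\<exists>f. f ` {..<N} \<subseteq> C \<and> (\<forall>c\<in>C. card {i. i < N \<and> f i = c} = p c)"
proof -
  let ?S = "SIGMA c:C. {..<p c}"
  have "card ?S = N" "finite ?S" using assms by (auto simp: card_SigmaI)
  then obtain g where g: "bij_betw g {..<N} ?S" by (metis ex_bij_betw_nat_finite lessThan_atLeast0)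
  have img: "g ` {..<N} = ?S" and inj: "inj_on g {..<N}" using g by (auto simp: bij_betw_def)
  have "card {i. i < N \<and> fst (g i) = c} = p c" if "c \<in> C" for c
  proof -
    have "bij_betw g {i. i < N \<and> fst (g i) = c} ({c} \<times> {..<p c})"
    proof -
      have "g ` {i. i < N \<and> fst (g i) = c} = {x \<in> ?S. fst x = c}"
      proof (intro equalityI subsetI)
        fix x assume "x \<in> {x \<in> ?S. fst x = c}"
        then have x: "x \<in> g ` {..<N}" "fst x = c" unfolding img by simp_all
        then obtain i where "i \<in> {..<N}" "x = g i" by (metis imageE)
        then show "x \<in> g ` {i. i < N \<and> fst (g i) = c}" using x by simp
      next
        fix x assume "x \<in> g ` {i. i < N \<and> fst (g i) = c}"
        then obtain i where i: "i < N" "fst (g i) = c" "x = g i" by blast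
        then have "x \<in> g ` {..<N}" by simp
        then have "x \<in> ?S" unfolding img .
        then show "x \<in> {x \<in> ?S. fst x = c}" using i by simp
      qed
      also have "\<dots> = {c} \<times> {..<p c}" using that by auto
      finally have "g ` {i. i < N \<and> fst (g i) = c} = {c} \<times> {..<p c}" .
      moreover have "inj_on g {i. i < N \<and> fst (g i) = c}"
        by (rule inj_on_subset[OF inj]) auto
      ultimately show ?thesis unfolding bij_betw_def by simp
    qed
    then have "card {i. i < N \<and> fst (g i) = c} = card ({c} \<times> {..<p c})" by (rule bij_betw_same_card)
    then show ?thesis by (simp add: card_cartesian_product)
  qed
  moreover have "(fst \<circ> g) ` {..<N} \<subseteq> C" unfolding image_comp[symmetric] img by auto
  ultimately show ?thesis by (intro exI[of _ "fst \<circ> g"]) auto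
qed

lemma ex_enumeration_last:
  assumes "finite D" "x \<in> D"
  shows "\<exists>e. bij_betw e {..<card D} D \<and> e (card D - 1) = x"
proof -
  obtain e where e: "bij_betw e {..<card D} D"
    using assms(1) by (metis ex_bij_betw_nat_finite lessThan_atLeast0)
  have "0 < card D" using assms by (metis card_gt_0_iff empty_iff)
  then have "card D - 1 \<in> {..<card D}" by simp
  then have "transpose x (e (card D - 1)) permutes D"
    using e assms(2) by (intro permutes_swap_id) (auto simp: bij_betw_def)
  then have "bij_betw (transpose x (e (card D - 1)) \<circ> e) {..<card D} D"
    using e by (meson bij_betw_trans permutes_imp_bij)
  then show ?thesis by (intro exI[of _ "transpose x (e (card D - 1)) \<circ> e"]) simp
qed

lemma card_by_colour:
  assumes "finite G" "finite B" "snd ` G \<subseteq> Pow B"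
  shows "card {X \<in> G. b \<in> snd X} = (\<Sum>T\<in>{T \<in> Pow B. b \<in> T}. card {X \<in> G. snd X = T})"
proof -
  have "{X \<in> G. b \<in> snd X} = (\<Union>T\<in>{T \<in> Pow B. b \<in> T}. {X \<in> G. snd X = T})"
    using assms(3) by auto
  also have "card \<dots> = (\<Sum>T\<in>{T \<in> Pow B. b \<in> T}. card {X \<in> G. snd X = T})"
    using assms by (intro card_UN_disjoint) auto
  finally show ?thesis .
qed

text \<open>Path edges are the members of size two, and the root \<open>({e 0}, {})\<close>
  distinguishes the two ends of the path. Coloured singletons fill up the degrees.\<close>

definition path_family ::
    "(nat \<Rightarrow> 'a) \<Rightarrow> nat \<Rightarrow> (nat \<Rightarrow> 'b set) \<Rightarrow> ('b set \<Rightarrow> 'a set) \<Rightarrow> 'b set \<Rightarrow> ('a set \<times> 'b set) set" where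
  "path_family e N f col B =
     {({e 0}, {})} \<union> (\<lambda>i. ({e i, e (Suc i)}, f i)) ` {..<N} \<union> {({a}, T) | a T. T \<in> Pow B \<and> a \<in> col T}"

context
  fixes A D :: "'a set" and B :: "'b set" and e :: "nat \<Rightarrow> 'a" and M n1 :: nat
    and f :: "nat \<Rightarrow> 'b set" and col :: "'b set \<Rightarrow> 'a set" and s p :: "'b set \<Rightarrow> nat"
  assumes finB: "finite B" and finD: "finite D"
    and e: "bij_betw e {..<M} D" and M: "2 \<le> M" and n1: "2 \<le> n1"
    and f: "f ` {..<M - 1} \<subseteq> Pow B" "\<And>T. T \<in> Pow B \<Longrightarrow> card {i. i < M - 1 \<and> f i = T} = p T"
    and col: "columns D (Pow B) s col" and s0: "s {} = 0"
    and rows: "\<And>i. i < M \<Longrightarrow> card (row (Pow B) col (e i)) = (if i = M - 1 then n1 - 1 else n1 - 2)"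
begin

abbreviation "\<K> \<equiv> path_family e (M - 1) f col B"

lemma col0: "col {} = {}"
  using col s0 finD by (metis Pow_bottom card_0_eq columns_def finite_subset)

lemma col_sub: "T \<in> Pow B \<Longrightarrow> col T \<subseteq> D"
  using col by (simp add: columns_def)

lemma e_inj: "i < M \<Longrightarrow> j < M \<Longrightarrow> e i = e j \<longleftrightarrow> i = j"
  using e by (auto simp: bij_betw_def inj_on_def)

lemma e_in: "i < M \<Longrightarrow> e i \<in> D"
  using e by (auto simp: bij_betw_def)

lemma pair_eq: "i < M - 1 \<Longrightarrow> j < M - 1 \<Longrightarrow> {e i, e (Suc i)} = {e j, e (Suc j)} \<longleftrightarrow> i = j"
  using M by (auto simp: doubleton_eq_iff e_inj)

lemma card_pair: "i < M - 1 \<Longrightarrow> card {e i, e (Suc i)} = 2"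
  using M by (simp add: e_inj)

lemma K_cases:
  assumes "X \<in> \<K>"
  obtains "X = ({e 0}, {})" | i where "i < M - 1" "X = ({e i, e (Suc i)}, f i)"
  | a T where "X = ({a}, T)" "T \<in> Pow B" "a \<in> col T"
  using assms unfolding path_family_def by blast

lemma K_sub: "X \<in> \<K> \<Longrightarrow> fst X \<subseteq> D \<and> fst X \<noteq> {} \<and> snd X \<subseteq> B"
  using e_in M f(1) col_sub by (elim K_cases) (auto, blast)

lemma finK: "finite \<K>"
proof -
  have "\<K> \<subseteq> Pow D \<times> Pow B"
  proof
    fix X assume "X \<in> \<K>"
    from K_sub[OF this] show "X \<in> Pow D \<times> Pow B" by (simp add: mem_Times_iff)
  qed
  then show ?thesis using finB finD by (meson finite_Pow_iff finite_SigmaI finite_subset)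
qed

lemma K_pairD:
  assumes "(S, T) \<in> \<K>" "card S = 2"
  shows "\<exists>i<M - 1. S = {e i, e (Suc i)} \<and> T = f i"
  using assms(1) by (rule K_cases) (use assms(2) in auto)

lemma K_singleD:
  assumes "({a}, T) \<in> \<K>"
  shows "(T = {} \<and> a = e 0) \<or> (T \<in> Pow B \<and> a \<in> col T)"
  using assms
proof (rule K_cases)
  fix i assume i: "i < M - 1" "({a}, T) = ({e i, e (Suc i)}, f i)"
  then have "card {a} = 2" using card_pair by (metis Pair_inject)
  then show ?thesis by simp
qed auto

lemma K_pairI: "i < M - 1 \<Longrightarrow> ({e i, e (Suc i)}, f i) \<in> \<K>"
  by (auto simp: path_family_def)

lemma K_singleI: "T \<in> Pow B \<Longrightarrow> a \<in> col T \<Longrightarrow> ({a}, T) \<in> \<K>"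
  by (auto simp: path_family_def)

lemma K_root: "({e 0}, {}) \<in> \<K>"
  by (auto simp: path_family_def)

text \<open>Every vertex but the last lies in two members besides its coloured singletons, which for
  \<open>e 0\<close> are the root and one edge; the last vertex lies in one edge only. This accounts
  for the exceptional row sum \<open>n1 - 1\<close> at \<open>M - 1\<close>.\<close>

lemma K_degree:
  assumes "a \<in> D"
  shows "card {X \<in> \<K>. a \<in> fst X} = n1"
proof -
  obtain i where i: "i < M" "a = e i" using e assms by (auto simp: bij_betw_def)
  let ?P = "\<lambda>i. ({e i, e (Suc i)}, f i)"
  let ?R = "(if i = 0 then {({e 0}, {})} else {})"
  let ?P1 = "(if i < M - 1 then {?P i} else {})" and ?P2 = "(if 0 < i then {?P (i - 1)} else {})"
  let ?S = "(\<lambda>T. ({a}, T)) ` row (Pow B) col a"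
  have "{X \<in> \<K>. a \<in> fst X} = ?R \<union> (?P1 \<union> ?P2) \<union> ?S"
  proof (intro equalityI subsetI)
    fix X assume X: "X \<in> {X \<in> \<K>. a \<in> fst X}"
    then have "X \<in> \<K>" by simp
    then show "X \<in> ?R \<union> (?P1 \<union> ?P2) \<union> ?S"
    proof (cases rule: K_cases)
      case 1
      then have "e i = e 0" using X i by simp
      then have "i = 0" using e_inj[of i 0] i M by simp
      then show ?thesis using 1 by simp
    next
      case (2 j)
      then have "e i = e j \<or> e i = e (Suc j)" using X i by auto
      then have "i = j \<or> i = Suc j" using e_inj 2(1) i by (metis Suc_lessI less_diff_conv Suc_eq_plus1 Suc_lessD less_SucI add.commute plus_1_eq_Suc)
      then show ?thesis using 2 i by auto
    next
      case (3 c T)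
      then show ?thesis using X by (auto simp: row_def)
    qed
  next
    fix X assume "X \<in> ?R \<union> (?P1 \<union> ?P2) \<union> ?S"
    then consider "X \<in> ?R" | "X \<in> ?P1" | "X \<in> ?P2" | "X \<in> ?S" by blast
    then show "X \<in> {X \<in> \<K>. a \<in> fst X}"
    proof cases
      case 1 then show ?thesis using i K_root by (auto split: if_splits)
    next
      case 2 then show ?thesis using i K_pairI[of i] by (auto split: if_splits)
    next
      case 3 then show ?thesis using i K_pairI[of "i - 1"] by (auto split: if_splits)
    next
      case 4 then show ?thesis using K_singleI by (auto simp: row_def)
    qed
  qed
  moreover have "card (?R \<union> (?P1 \<union> ?P2) \<union> ?S) = card ?R + (card ?P1 + card ?P2) + card ?S"
  proof -
    have fS: "finite ?S" using finB by (simp add: row_def)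
    have "?R \<inter> ?S = {}" using col0 by (auto simp: row_def)
    moreover have "(?P1 \<union> ?P2) \<inter> ?S = {}"
    proof -
      have 2: "card (fst X) = 2" if "X \<in> ?P1 \<union> ?P2" for X
        using that i card_pair[of i] card_pair[of "i - 1"] by (auto split: if_splits)
      have 1: "card (fst X) = 1" if "X \<in> ?S" for X using that by auto
      show ?thesis
      proof (rule ccontr)
        assume "\<not> ?thesis"
        then obtain X where X: "X \<in> ?P1 \<union> ?P2" "X \<in> ?S" by blast
        show False using 1[OF X(2)] 2[OF X(1)] by simp
      qed
    qed
    moreover have "?R \<inter> (?P1 \<union> ?P2) = {}" using M by (auto simp: e_inj)
    moreover have "?P1 \<inter> ?P2 = {}"
      using pair_eq[of i "i - 1"] less_imp_diff_less[of i "M - 1" 1] by auto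
    ultimately show ?thesis using fS by (subst card_Un_disjoint; auto simp: card_Un_disjoint)+
  qed
  moreover have "card ?S = (if i = M - 1 then n1 - 1 else n1 - 2)"
    using rows[OF i(1)] i(2) by (subst card_image) (auto simp: inj_on_def)
  moreover have "card ?R + (card ?P1 + card ?P2) = (if i = M - 1 then 1 else 2)"
    using i M by auto
  ultimately show ?thesis using n1 by (auto split: if_splits)
qed

lemma K_colour:
  assumes "T \<in> Pow B" "T \<noteq> {}"
  shows "card {X \<in> \<K>. snd X = T} = p T + s T"
proof -
  let ?P = "(\<lambda>i. ({e i, e (Suc i)}, f i)) ` {i. i < M - 1 \<and> f i = T}" and ?S = "(\<lambda>a. ({a}, T)) ` col T"
  have "{X \<in> \<K>. snd X = T} = ?P \<union> ?S"
    using assms by (auto simp: path_family_def)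
  moreover have "?P \<inter> ?S = {}"
  proof -
    have 2: "card (fst X) = 2" if "X \<in> ?P" for X using that card_pair by auto
    have 1: "card (fst X) = 1" if "X \<in> ?S" for X using that by auto
    show ?thesis
    proof (rule ccontr)
      assume "\<not> ?thesis"
      then obtain X where X: "X \<in> ?P" "X \<in> ?S" by blast
      show False using 1[OF X(2)] 2[OF X(1)] by simp
    qed
  qed
  moreover have "card ?P = p T"
    using pair_eq f(2)[OF assms(1)] by (subst card_image) (auto simp: inj_on_def)
  moreover have "card ?S = s T"
    using col assms(1) by (subst card_image) (auto simp: inj_on_def columns_def)
  moreover have "finite ?P" "finite ?S"
    using col_sub[OF assms(1)] finD by (auto intro: finite_subset)
  ultimately show ?thesis by (simp add: card_Un_disjoint)
qed

text \<open>As \<open>F0\<close> has no class \<open>({a}, {})\<close> and \<open>s {} = 0\<close>,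
  the root is the only singleton class with empty colour. So \<open>e 0\<close> is fixed, and the
  edges propagate this along the path.\<close>

lemma K_growth:
  assumes "inj \<pi>" "\<And>X. X \<in> F0 \<union> \<K> \<Longrightarrow> act \<pi> \<beta> X \<in> F0 \<union> \<K>"
    and F0: "\<And>X. X \<in> F0 \<Longrightarrow> fst X \<inter> D = {}" "\<And>a. ({a}, {}) \<notin> F0"
    and "a \<in> D"
  shows "\<pi> a = a"
proof -
  obtain i where i: "i < M" "a = e i" using e assms by (auto simp: bij_betw_def)
  have "\<pi> (e i) = e i"
  proof (rule growth[of e M \<pi> "F0 \<union> \<K>" \<beta> 1 i])
    fix t :: nat assume "t < 1"
    have "({\<pi> (e 0)}, {}) \<in> F0 \<union> \<K>" using assms(2)[of "({e 0}, {})"] K_root by simp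
    then have "({\<pi> (e 0)}, {}) \<in> \<K>" using F0(2) by blast
    then have "\<pi> (e 0) = e 0" using K_singleD col0 by blast
    then show "\<pi> (e t) = e t" using \<open>t < 1\<close> by simp
  next
    fix t assume t: "1 \<le> t" "t < M"
    have "({e (t - 1), e t}, f (t - 1)) \<in> F0 \<union> \<K>" using K_pairI[of "t - 1"] t by simp
    moreover have "S' \<subseteq> e ` {..t}" if S': "(S', T') \<in> F0 \<union> \<K>" "e (t - 1) \<in> S'" "card S' = card {e (t - 1), e t}" for S' T'
    proof -
      have "e (t - 1) \<in> D" using t e_in by simp
      then have "(S', T') \<in> \<K>" using S' F0(1) by fastforce
      moreover have "card S' = 2" using S'(3) card_pair[of "t - 1"] t by simp
      ultimately obtain j where j: "j < M - 1" "S' = {e j, e (Suc j)}" using K_pairD by blast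
      then have "t - 1 = j \<or> t - 1 = Suc j"
        using S'(2) e_inj[of "t - 1" j] e_inj[of "t - 1" "Suc j"] t by auto
      then have "j \<le> t" "Suc j \<le> t" using t by auto
      then show ?thesis using j by auto
    qed
    ultimately show "\<exists>v<t. \<exists>S T. (S, T) \<in> F0 \<union> \<K> \<and> e v \<in> S \<and> e t \<in> S \<and>
        (\<forall>S' T'. (S', T') \<in> F0 \<union> \<K> \<and> e v \<in> S' \<and> card S' = card S \<longrightarrow> S' \<subseteq> e ` {..t})"
      using t by (intro exI[of _ "t - 1"] conjI exI[of _ "{e (t - 1), e t}"] exI[of _ "f (t - 1)"]) auto
  next
    show "inj_on e {..<M}" using e by (simp add: bij_betw_def)
    show "act \<pi> \<beta> X \<in> F0 \<union> \<K>" if "X \<in> F0 \<union> \<K>" for X using assms(2) that by blast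
  qed (use assms(1) i in auto)
  then show ?thesis using i by simp
qed

end

text \<open>
  The classes inside \<open>D\<close> are replaced by a path whose first vertex carries the only class with an
  empty \<open>B\<close>-part. A permutation \<open>\<beta>\<close> of \<open>B\<close> fixes every colour used on the path, and moves another
  colour only if that colour is used on all singletons of \<open>D\<close>, in which case it acts trivially on
  the old classes inside \<open>D\<close>, too.
\<close>

lemma path_replacement:
  fixes A D :: "'a set" and B :: "'b set" and p s :: "'b set \<Rightarrow> nat"
  defines "\<kappa> \<equiv> \<lambda>F T. card {X \<in> F. fst X \<inter> D \<noteq> {} \<and> snd X = T}"
  assumes fin: "finite A" "finite B" and B: "B \<noteq> {}" and D: "D \<subseteq> A" and n1: "2 \<le> n1"
    and F: "realizes A B n1 n2 F"
    and closed: "\<And>X. X \<in> F \<Longrightarrow> fst X \<inter> D \<noteq> {} \<Longrightarrow> fst X \<subseteq> D"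
    and outside: "\<And>X. X \<in> F \<Longrightarrow> snd X = {} \<Longrightarrow> fst X \<inter> D \<noteq> {}"
    and p: "(\<Sum>T\<in>Pow B. p T) = card D - 1"
    and s: "s {} = 0" "\<And>T. T \<subseteq> B \<Longrightarrow> s T \<le> card D" "(\<Sum>T\<in>Pow B. s T) = card D * (n1 - 2) + 1"
    and ps: "\<And>T. T \<subseteq> B \<Longrightarrow> T \<noteq> {} \<Longrightarrow> T \<noteq> B \<Longrightarrow> p T + s T = \<kappa> F T" "p B + s B + 1 = \<kappa> F B"
    and full: "\<And>T a. T \<subseteq> B \<Longrightarrow> T \<noteq> {} \<Longrightarrow> T \<noteq> B \<Longrightarrow> p T = 0 \<Longrightarrow> s T = card D \<Longrightarrow> a \<in> D \<Longrightarrow> ({a}, T) \<in> F"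
    and big: "(2 ^ card B)\<^sup>2 + 2 ^ card B < card D - 1"
  shows "\<exists>F'. realizes A B n1 (n2 - 1) F'"
proof -
  let ?M = "card D"
  have finD: "finite D" using fin D finite_subset by blast
  have finF: "finite F" using F fin realizes_finite by blast
  have M: "2 \<le> ?M" using big by linarith
  obtain col where col: "columns D (Pow B) s col" "balanced D (Pow B) col"
    and dist: "\<And>T T'. T \<in> Pow B \<Longrightarrow> T' \<in> Pow B \<Longrightarrow> T \<noteq> T' \<Longrightarrow> col T = col T' \<Longrightarrow> col T = {} \<or> col T = D"
    using ex_balanced_distinct[of D "Pow B" s] finD fin s(2) big by (auto simp: card_Pow)
  \<comment> \<open>The column sums exceed \<open>card D * (n1 - 2)\<close> by one, so exactly one
    row has an extra entry; the enumeration will place it at the end of the path.\<close>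
  obtain x where x: "x \<in> D" "card (row (Pow B) col x) = n1 - 2 + 1"
    "\<And>y. y \<in> D - {x} \<Longrightarrow> card (row (Pow B) col y) = n1 - 2"
    using balanced_rows_one[OF finD _ col s(3) M] fin by auto
  obtain e where e: "bij_betw e {..<?M} D" "e (?M - 1) = x" using ex_enumeration_last[OF finD x(1)] by blast
  obtain f where f: "f ` {..<?M - 1} \<subseteq> Pow B" "\<And>T. T \<in> Pow B \<Longrightarrow> card {i. i < ?M - 1 \<and> f i = T} = p T"
    using ex_colouring[of "Pow B" p] fin p by auto
  have rows: "card (row (Pow B) col (e i)) = (if i = ?M - 1 then n1 - 1 else n1 - 2)" if "i < ?M" for i
  proof (cases "i = ?M - 1")
    case True
    then show ?thesis using x e n1 by simp
  next
    case False
    then have "e i \<noteq> x" using e that by (metis bij_betw_inv_into_left diff_less lessThan_iff less_nat_zero_code not_gr_zero zero_less_one)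
    then have "e i \<in> D - {x}" using e that by (auto simp: bij_betw_def)
    then show ?thesis using x False by simp
  qed
  note ctx = fin(2) finD e(1) M n1 f col(1) s(1) rows
  let ?K = "path_family e (?M - 1) f col B"
  let ?F0 = "{X \<in> F. fst X \<inter> D = {}}"
  let ?F' = "?F0 \<union> ?K"
  have finK: "finite ?K" by (rule finK[OF ctx])
  have Ksub: "fst X \<subseteq> D \<and> fst X \<noteq> {} \<and> snd X \<subseteq> B" if "X \<in> ?K" for X by (rule K_sub[OF ctx that])
  have FA: "fst X \<subseteq> A \<and> snd X \<subseteq> B" if "X \<in> F" for X
  proof -
    have "X \<in> Pow A \<times> Pow B" using F that unfolding realizes_def by blast
    then show ?thesis by (simp add: mem_Times_iff)
  qed
  have F0: "({a}, {}) \<notin> ?F0" for a using outside by fastforce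
  have degA: "card {X \<in> ?F'. a \<in> fst X} = n1" if "a \<in> A" for a
  proof (cases "a \<in> D")
    case True
    then have "{X \<in> ?F'. a \<in> fst X} = {X \<in> ?K. a \<in> fst X}" by auto
    then show ?thesis using K_degree[OF ctx True] by simp
  next
    case False
    then have "{X \<in> ?F'. a \<in> fst X} = {X \<in> F. a \<in> fst X}" using Ksub closed by blast
    then show ?thesis using F that by (simp add: realizes_def)
  qed
  have degB: "card {X \<in> ?F'. b \<in> snd X} = n2 - 1" if b: "b \<in> B" for b
  proof -
    let ?Tb = "{T \<in> Pow B. b \<in> T}"
    have "{X \<in> ?F'. b \<in> snd X} = {X \<in> ?F0. b \<in> snd X} \<union> {X \<in> ?K. b \<in> snd X}" by blast
    moreover have "{X \<in> ?F0. b \<in> snd X} \<inter> {X \<in> ?K. b \<in> snd X} = {}" using Ksub by blast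
    ultimately have 1: "card {X \<in> ?F'. b \<in> snd X} = card {X \<in> ?F0. b \<in> snd X} + card {X \<in> ?K. b \<in> snd X}"
      using finF finK by (simp add: card_Un_disjoint)
    have "card {X \<in> ?K. b \<in> snd X} = (\<Sum>T\<in>?Tb. card {X \<in> ?K. snd X = T})"
    proof (rule card_by_colour[OF finK fin(2)])
      show "snd ` ?K \<subseteq> Pow B" using Ksub by blast
    qed
    also have "\<dots> = (\<Sum>T\<in>?Tb. p T + s T)"
    proof (rule sum.cong)
      fix T assume T: "T \<in> ?Tb"
      then show "card {X \<in> ?K. snd X = T} = p T + s T" by (intro K_colour[OF ctx]) auto
    qed simp
    \<comment> \<open>Only the colour \<open>B\<close> loses a class, and it contains every
      \<open>b\<close>; hence all degrees drop by exactly one.\<close>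
    also have "\<dots> + 1 = (\<Sum>T\<in>?Tb. \<kappa> F T)"
    proof -
      have BT: "B \<in> ?Tb" "finite ?Tb" using b fin by auto
      have "(\<Sum>T\<in>?Tb - {B}. p T + s T) = (\<Sum>T\<in>?Tb - {B}. \<kappa> F T)"
        by (rule sum.cong) (use ps in auto)
      then show ?thesis using ps(2) unfolding sum.remove[OF BT(2,1)] by linarith
    qed
    also have "(\<Sum>T\<in>?Tb. \<kappa> F T) = card {X \<in> {X \<in> F. fst X \<inter> D \<noteq> {}}. b \<in> snd X}"
    proof -
      have "{X \<in> {X \<in> F. fst X \<inter> D \<noteq> {}}. snd X = T} = {X \<in> F. fst X \<inter> D \<noteq> {} \<and> snd X = T}" for T by blast
      moreover have "snd ` {X \<in> F. fst X \<inter> D \<noteq> {}} \<subseteq> Pow B" using FA by blast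
      ultimately show ?thesis using card_by_colour[of "{X \<in> F. fst X \<inter> D \<noteq> {}}" B b] finF fin
        by (simp add: \<kappa>_def)
    qed
    finally have 2: "card {X \<in> ?K. b \<in> snd X} + 1 = card {X \<in> {X \<in> F. fst X \<inter> D \<noteq> {}}. b \<in> snd X}" .
    have "{X \<in> F. b \<in> snd X} = {X \<in> ?F0. b \<in> snd X} \<union> {X \<in> {X \<in> F. fst X \<inter> D \<noteq> {}}. b \<in> snd X}" by blast
    then have "card {X \<in> F. b \<in> snd X} = card {X \<in> ?F0. b \<in> snd X} + card {X \<in> {X \<in> F. fst X \<inter> D \<noteq> {}}. b \<in> snd X}"
      using finF by (simp add: card_Un_disjoint disjoint_iff)
    moreover have "card {X \<in> F. b \<in> snd X} = n2" using F b by (simp add: realizes_def)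
    ultimately show ?thesis using 1 2 by linarith
  qed
  have "rigid A B ?F'" unfolding rigid_def
  proof (intro allI impI, elim conjE)
    fix \<pi> \<beta> assume perm: "\<pi> permutes A" "\<beta> permutes B" and img: "act \<pi> \<beta> ` ?F' \<subseteq> ?F'"
    have inj: "inj \<pi>" "inj \<beta>" using perm permutes_inj by auto
    have act: "act \<pi> \<beta> X \<in> ?F'" if "X \<in> ?F'" for X using img that by blast
    have act_eq: "act \<pi> \<beta> ` ?F' = ?F'" using act_image_eq[OF _ inj img] finF finK by simp
    have fixD: "\<pi> a = a" if "a \<in> D" for a
      by (rule K_growth[OF ctx inj(1), of ?F0 \<beta>]) (use act F0 that in auto)
    have fix_img: "\<pi> ` S = S" if "S \<subseteq> D" for S using fixD that by (force simp: image_iff)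
    have in_K: "X \<in> ?K" if "X \<in> ?F'" "fst X \<inter> D \<noteq> {}" for X using that by blast
    have \<beta>B: "\<beta> ` T \<subseteq> B" if "T \<subseteq> B" for T using perm(2) that by (metis image_mono permutes_image)
    have path: "\<beta> ` f i = f i" if i: "i < ?M - 1" for i
    proof -
      have eD: "{e i, e (Suc i)} \<subseteq> D" using e(1) i by (auto simp: bij_betw_def)
      have "({e i, e (Suc i)}, f i) \<in> ?F'" using K_pairI[OF ctx i] by blast
      then have "({e i, e (Suc i)}, \<beta> ` f i) \<in> ?F'"
        using act[of "({e i, e (Suc i)}, f i)"] unfolding act_Pair fix_img[OF eD] by blast
      then have "({e i, e (Suc i)}, \<beta> ` f i) \<in> ?K" using in_K eD by auto
      then obtain j where "j < ?M - 1" "{e i, e (Suc i)} = {e j, e (Suc j)}" "\<beta> ` f i = f j"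
        using K_pairD[OF ctx] card_pair[OF ctx i] by metis
      then show ?thesis using pair_eq[OF ctx i] by metis
    qed
    have path': "\<beta> ` T = T" if T: "T \<subseteq> B" "p T \<noteq> 0" for T
    proof -
      have "card {i. i < ?M - 1 \<and> f i = T} \<noteq> 0" using T f(2) by simp
      then obtain i where "i < ?M - 1" "f i = T" by (auto simp: card_eq_0_iff)
      then show ?thesis using path by blast
    qed
    \<comment> \<open>As \<open>\<pi>\<close> fixes \<open>D\<close> pointwise,
      \<open>\<beta>\<close> permutes the colours of the singleton classes at each point of
      \<open>D\<close> separately.\<close>
    have col_inv: "col (\<beta> ` T) = col T" if T: "T \<subseteq> B" "T \<noteq> {}" for T
    proof (intro equalityI subsetI)
      fix a assume a: "a \<in> col T"
      then have aD: "a \<in> D" using col T by (auto simp: columns_def)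
      have "({a}, T) \<in> ?F'" using K_singleI[OF ctx, of T a] T a by blast
      then have "act \<pi> \<beta> ({a}, T) \<in> ?F'" by (rule act)
      then have "({a}, \<beta> ` T) \<in> ?F'" unfolding act_Pair by (simp only: image_insert image_empty fixD[OF aD])
      then have "({a}, \<beta> ` T) \<in> ?K" using in_K aD by auto
      then show "a \<in> col (\<beta> ` T)" using K_singleD[OF ctx] T by blast
    next
      fix a assume a: "a \<in> col (\<beta> ` T)"
      then have aD: "a \<in> D" using col \<beta>B[OF T(1)] by (auto simp: columns_def)
      have "({a}, \<beta> ` T) \<in> ?F'" using K_singleI[OF ctx, of "\<beta> ` T" a] \<beta>B[OF T(1)] a by simp
      then have "({a}, \<beta> ` T) \<in> act \<pi> \<beta> ` ?F'" by (subst act_eq)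
      then obtain Y where Y: "Y \<in> ?F'" "({a}, \<beta> ` T) = act \<pi> \<beta> Y" by (elim imageE)
      have ia: "\<pi> ` {a} = {a}" using fixD[OF aD] by simp
      have "\<pi> ` fst Y = {a}" "\<beta> ` snd Y = \<beta> ` T"
        using arg_cong[OF Y(2), of fst] arg_cong[OF Y(2), of snd] by simp_all
      then have "\<pi> ` fst Y = \<pi> ` {a}" "\<beta> ` snd Y = \<beta> ` T" by (simp_all only: ia)
      then have "fst Y = {a}" "snd Y = T" by (simp_all only: inj_image_eq_iff[OF inj(1)] inj_image_eq_iff[OF inj(2)])
      then have "Y = ({a}, T)" by (simp add: prod_eq_iff)
      then have "({a}, T) \<in> ?F'" using Y(1) by (simp only:)
      moreover have "fst ({a}, T) \<inter> D \<noteq> {}" using aD by simp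
      ultimately have "({a}, T) \<in> ?K" by (rule in_K)
      then show "a \<in> col T" using K_singleD[OF ctx] T by blast
    qed
    \<comment> \<open>An automorphism of the new family is shown to be one of \<open>F\<close>,
      whose rigidity then applies. Classes outside \<open>D\<close> are common to both families;
      inside \<open>D\<close> only a colour moved by \<open>\<beta>\<close> needs an
      argument.\<close>
    have "act \<pi> \<beta> X \<in> F" if X: "X \<in> F" for X
    proof (cases "fst X \<inter> D = {}")
      case True
      have "\<pi> ` fst X \<inter> D = {}"
      proof (rule ccontr)
        assume "\<not> ?thesis"
        then obtain u where "u \<in> fst X" "\<pi> u \<in> D" by blast
        then have "\<pi> (\<pi> u) = \<pi> u" using fixD by blast
        then have "\<pi> u = u" using inj(1) by (meson injD)
        then show False using True \<open>u \<in> fst X\<close> \<open>\<pi> u \<in> D\<close> by auto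
      qed
      moreover have "act \<pi> \<beta> X \<in> ?F'" using act X True by blast
      ultimately show ?thesis using Ksub[of "act \<pi> \<beta> X"] unfolding fst_act by blast
    next
      case False
      let ?T = "snd X"
      have SD: "fst X \<subseteq> D" using closed X False by blast
      have act_X: "act \<pi> \<beta> X = (fst X, \<beta> ` ?T)" using fix_img[OF SD] by (simp add: act_def)
      show ?thesis
      proof (cases "\<beta> ` ?T = ?T")
        case True
        then show ?thesis using act_X X by simp
      next
        case moved: False
        have TB: "?T \<subseteq> B" using FA X by blast
        have "?T \<noteq> {}" using moved by auto
        have "?T \<noteq> B" using moved permutes_image[OF perm(2)] by auto
        have p0: "p ?T = 0" using path' TB moved by blast
        have "col (\<beta> ` ?T) = col ?T" using col_inv TB \<open>?T \<noteq> {}\<close> by blast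
        \<comment> \<open>The colour and its image are distinct but have the same set of singletons,
          so by \<open>dist\<close> this set is empty or all of \<open>D\<close>.\<close>
        then have cc: "col ?T = {} \<or> col ?T = D" using dist[of ?T "\<beta> ` ?T"] TB \<beta>B moved by auto
        have s\<kappa>: "s ?T = \<kappa> F ?T" using ps(1)[OF TB \<open>?T \<noteq> {}\<close> \<open>?T \<noteq> B\<close>] p0 by simp
        have \<kappa>0: "\<kappa> F ?T \<noteq> 0"
        proof -
          have "{X' \<in> F. fst X' \<inter> D \<noteq> {} \<and> snd X' = ?T} \<noteq> {}" using X False by blast
          then show ?thesis using finF by (simp add: \<kappa>_def)
        qed
        have cs: "card (col T) = s T" if "T \<subseteq> B" for T using col that by (simp add: columns_def)
        have "col ?T \<noteq> {}" using cs[OF TB] s\<kappa> \<kappa>0 by (metis card.empty)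
        then have cD: "col ?T = D" using cc by blast
        then have sM: "s ?T = ?M" using cs[OF TB] by simp
        have \<kappa>M: "\<kappa> F ?T = ?M" using sM s\<kappa> by simp
        \<comment> \<open>By counting, the old classes of this colour inside \<open>D\<close> are
          the singletons at the points of \<open>D\<close> and nothing else. The image colour is
          equally full, so it also occurs at every point of \<open>D\<close>.\<close>
        have "(\<lambda>a. ({a}, ?T)) ` D = {X \<in> F. fst X \<inter> D \<noteq> {} \<and> snd X = ?T}"
        proof (rule card_subset_eq)
          show "(\<lambda>a. ({a}, ?T)) ` D \<subseteq> {X \<in> F. fst X \<inter> D \<noteq> {} \<and> snd X = ?T}"
            using full[OF TB \<open>?T \<noteq> {}\<close> \<open>?T \<noteq> B\<close> p0 sM] by auto
          show "card ((\<lambda>a. ({a}, ?T)) ` D) = card {X \<in> F. fst X \<inter> D \<noteq> {} \<and> snd X = ?T}"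
            using \<kappa>M by (subst card_image) (auto simp: inj_on_def \<kappa>_def)
        qed (use finF in simp)
        moreover have "X \<in> {X \<in> F. fst X \<inter> D \<noteq> {} \<and> snd X = ?T}" using X False by simp
        ultimately have "X \<in> (\<lambda>a. ({a}, ?T)) ` D" by (simp only:)
        then obtain a where a: "a \<in> D" "X = ({a}, ?T)" by (elim imageE)
        then have fX: "fst X = {a}" by (metis fst_conv)
        let ?U = "\<beta> ` ?T"
        have U: "?U \<subseteq> B" "?U \<noteq> {}" "?U \<noteq> B"
          using \<beta>B TB \<open>?T \<noteq> {}\<close> \<open>?T \<noteq> B\<close> perm(2) inj(2) by (auto, metis permutes_image inj_image_eq_iff)
        have "p ?U = 0"
        proof (rule ccontr)
          assume "p ?U \<noteq> 0"
          then have "\<beta> ` ?U = ?U" using path' U by blast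
          then show False using moved inj(2) by (metis inj_image_eq_iff)
        qed
        moreover have "s ?U = ?M" using cs[OF U(1)] col_inv[OF TB \<open>?T \<noteq> {}\<close>] cD by simp
        ultimately have "({a}, ?U) \<in> F" using full U a by blast
        then show ?thesis using act_X fX by simp
      qed
    qed
    then show "\<pi> = id \<and> \<beta> = id" using F perm unfolding realizes_def by (meson rigidD)
  qed
  moreover have "?F' \<subseteq> Pow A \<times> Pow B"
  proof
    fix X assume "X \<in> ?F'"
    then have "fst X \<subseteq> A \<and> snd X \<subseteq> B" using FA[of X] Ksub[of X] D by blast
    then show "X \<in> Pow A \<times> Pow B" by (simp add: mem_Times_iff)
  qed
  moreover have "({}, {}) \<notin> ?F'"
  proof
    assume "({}, {}) \<in> ?F'"
    then show False using F Ksub[of "({}, {})"] unfolding realizes_def by auto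
  qed
  ultimately have "realizes A B n1 (n2 - 1) ?F'" using degA degB by (simp add: realizes_def)
  then show ?thesis by blast
qed

section \<open>Distributing the colours over path edges and singletons\<close>

lemma ex_intermediate_function:
  fixes lb ub :: "'c \<Rightarrow> nat"
  assumes "finite C" "\<And>c. c \<in> C \<Longrightarrow> lb c \<le> ub c" "sum lb C \<le> m" "m \<le> sum ub C"
  shows "\<exists>p. (\<forall>c\<in>C. lb c \<le> p c \<and> p c \<le> ub c) \<and> sum p C = m"
  using assms(3,4)
proof (induction m rule: dec_induct)
  case base
  then show ?case using assms(2) by blast
next
  case (step m)
  then obtain p where p: "\<And>c. c \<in> C \<Longrightarrow> lb c \<le> p c \<and> p c \<le> ub c" "sum p C = m" by auto
  have "\<exists>c\<in>C. p c < ub c"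
  proof (rule ccontr)
    assume "\<not> ?thesis"
    then have "sum ub C \<le> sum p C" by (intro sum_mono) (meson not_less)
    then show False using p(2) step.prems by simp
  qed
  then obtain c where c: "c \<in> C" "p c < ub c" by blast
  have "sum (p(c := Suc (p c))) C = Suc (p c) + sum p (C - {c})"
    using assms(1) c(1) by (simp add: sum.remove)
  then have "sum (p(c := Suc (p c))) C = Suc m" using p(2) assms(1) c(1) by (simp add: sum.remove)
  moreover have "lb c' \<le> (p(c := Suc (p c))) c' \<and> (p(c := Suc (p c))) c' \<le> ub c'" if "c' \<in> C" for c'
    using p(1)[OF that] c(2) by auto
  ultimately show ?case by blast
qed

definition class_count :: "'a set \<Rightarrow> ('a set \<times> 'b set) set \<Rightarrow> 'b set \<Rightarrow> nat" where
  "class_count D F T = card {X \<in> F. fst X \<inter> D \<noteq> {} \<and> snd X = T}"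

definition large_class_count :: "'a set \<Rightarrow> ('a set \<times> 'b set) set \<Rightarrow> 'b set \<Rightarrow> nat" where
  "large_class_count D F T = card {X \<in> F. fst X \<inter> D \<noteq> {} \<and> snd X = T \<and> 2 \<le> card (fst X)}"

context
  fixes A D :: "'a set" and B :: "'b set" and n1 n2 :: nat and F :: "('a set \<times> 'b set) set"
  assumes fin: "finite A" "finite B" and B: "B \<noteq> {}" and F: "realizes A B n1 n2 F"
    and n1: "2 \<le> n1" and D: "closed_in A F D"
    and outside: "\<And>X. X \<in> F \<Longrightarrow> snd X = {} \<Longrightarrow> fst X \<inter> D \<noteq> {}"
    and big: "(2 ^ card B)\<^sup>2 + 2 ^ card B < card D - 1"
begin

abbreviation "\<kappa> \<equiv> class_count D F"
abbreviation "\<nu> \<equiv> large_class_count D F"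

lemma finF': "finite F"
  using F fin realizes_finite by blast

lemma subF: "F \<subseteq> Pow A \<times> Pow B"
  using F by (simp add: realizes_def)

lemma D_facts: "D \<subseteq> A" "finite D" "1 \<le> card D"
  using closed_in_subset[OF D] fin(1) finite_subset big by auto

lemma sum_\<kappa>: "(\<Sum>T\<in>Pow B - {{}}. \<kappa> T) = card (coloured F D)"
proof -
  have "coloured F D = (\<Union>T\<in>Pow B - {{}}. {X \<in> F. fst X \<inter> D \<noteq> {} \<and> snd X = T})"
    using family_subset(2)[OF subF] by (auto simp: coloured_def)
  also have "card \<dots> = (\<Sum>T\<in>Pow B - {{}}. \<kappa> T)"
    unfolding class_count_def using fin(2) finF' by (intro card_UN_disjoint) auto
  finally show ?thesis by simp
qed

lemma \<nu>_le: "\<nu> T \<le> \<kappa> T"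
  unfolding large_class_count_def class_count_def using finF' by (intro card_mono) auto

lemma singles: "\<kappa> T = \<nu> T + card {a \<in> D. ({a}, T) \<in> F}"
proof -
  let ?N = "{X \<in> F. fst X \<inter> D \<noteq> {} \<and> snd X = T \<and> 2 \<le> card (fst X)}"
  let ?S = "(\<lambda>a. ({a}, T)) ` {a \<in> D. ({a}, T) \<in> F}"
  have "{X \<in> F. fst X \<inter> D \<noteq> {} \<and> snd X = T} = ?N \<union> ?S"
  proof (intro equalityI subsetI)
    fix X assume X: "X \<in> {X \<in> F. fst X \<inter> D \<noteq> {} \<and> snd X = T}"
    show "X \<in> ?N \<union> ?S"
    proof (cases "2 \<le> card (fst X)")
      case False
      have "fst X \<subseteq> A" using X family_subset(1)[OF subF] by blast
      then have "finite (fst X)" using fin(1) by (rule finite_subset)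
      moreover have "fst X \<noteq> {}" using X by blast
      ultimately have "card (fst X) = 1" using False by (metis One_nat_def Suc_1 Suc_leI card_gt_0_iff le_neq_implies_less)
      then obtain a where a: "fst X = {a}" using card_1_singletonE by blast
      then have "X = ({a}, T)" "a \<in> D" using X by (auto simp: prod_eq_iff)
      then show ?thesis using X by auto
    qed (use X in simp)
  qed auto
  moreover have "?N \<inter> ?S = {}" by auto
  moreover have "card ?S = card {a \<in> D. ({a}, T) \<in> F}" by (rule card_image) (simp add: inj_on_def)
  moreover have "finite ?N" "finite ?S" using finF' D_facts by auto
  ultimately show ?thesis unfolding class_count_def large_class_count_def by (simp add: card_Un_disjoint)
qed

lemma singles_le: "card {a \<in> D. ({a}, T) \<in> F} \<le> card D"
  using D_facts by (intro card_mono) auto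

lemma replace:
  assumes "(\<Sum>T\<in>Pow B. p T) = card D - 1" "s {} = 0" "\<And>T. T \<subseteq> B \<Longrightarrow> s T \<le> card D"
    "(\<Sum>T\<in>Pow B. s T) = card D * (n1 - 2) + 1"
    "\<And>T. T \<subseteq> B \<Longrightarrow> T \<noteq> {} \<Longrightarrow> T \<noteq> B \<Longrightarrow> p T + s T = \<kappa> T" "p B + s B + 1 = \<kappa> B"
    "\<And>T a. T \<subseteq> B \<Longrightarrow> T \<noteq> {} \<Longrightarrow> T \<noteq> B \<Longrightarrow> p T = 0 \<Longrightarrow> s T = card D \<Longrightarrow> a \<in> D \<Longrightarrow> ({a}, T) \<in> F"
  shows "\<exists>F'. realizes A B n1 (n2 - 1) F'"
  by (rule path_replacement[OF fin B D_facts(1) n1 F _ outside assms(1-4) _ _ assms(7) big])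
    (use closed_inD[OF D] assms(5,6) in \<open>simp_all add: class_count_def\<close>)

text \<open>After one class of colour \<open>B\<close> is dropped, \<open>(n1 - 1) * card D\<close>
  coloured classes remain: \<open>card D - 1\<close> become path edges and
  \<open>card D * (n1 - 2) + 1\<close> become singletons. Each colour gets at least as many edges as
  it had classes with two or more points (for \<open>B\<close> one less is allowed). So no colour
  needs more than \<open>card D\<close> singletons, and a colour other than \<open>B\<close> that
  fills \<open>D\<close> without using an edge had filled it before.\<close>

lemma descent_tree:
  assumes Q: "card (coloured F D) + card D = n1 * card D + 1" and \<kappa>B: "1 \<le> \<kappa> B"
  shows "\<exists>F'. realizes A B n1 (n2 - 1) F'"
proof -
  let ?C = "Pow B - {{}}" and ?M = "card D"
  have finC: "finite ?C" "B \<in> ?C" using fin(2) B by auto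
  define lb where "lb T = (if T = B then \<nu> B - 1 else \<nu> T)" for T
  define ub where "ub T = (if T = B then \<kappa> B - 1 else \<kappa> T)" for T
  have lu: "lb T \<le> ub T" for T using \<nu>_le[of T] by (auto simp: lb_def ub_def)
  \<comment> \<open>A class with several points takes at least two incidences and every other
    coloured class at least one; this makes the lower bounds fit into \<open>card D - 1\<close>
    edges.\<close>
  have "(\<Sum>T\<in>?C. \<nu> T) + card (coloured F D) \<le> n1 * ?M"
  proof -
    let ?G = "{X \<in> coloured F D. 2 \<le> card (fst X)}"
    have finc: "finite (coloured F D)" using finF' by (simp add: coloured_def)
    have "?G = (\<Union>T\<in>?C. {X \<in> F. fst X \<inter> D \<noteq> {} \<and> snd X = T \<and> 2 \<le> card (fst X)})"
      using family_subset(2)[OF subF] by (auto simp: coloured_def)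
    also have "card \<dots> = (\<Sum>T\<in>?C. \<nu> T)"
      unfolding large_class_count_def using fin(2) finF' by (intro card_UN_disjoint) auto
    finally have G: "(\<Sum>T\<in>?C. \<nu> T) = card ?G" by simp
    have "card ?G + card (coloured F D) = (\<Sum>X\<in>coloured F D. (if 2 \<le> card (fst X) then 1 else 0) + 1)"
      using finc by (simp only: sum.distrib) (simp add: sum.If_cases Int_def)
    also have "\<dots> \<le> (\<Sum>X\<in>coloured F D. card (fst X))"
    proof (rule sum_mono)
      fix X assume "X \<in> coloured F D"
      then have "X \<in> F" "fst X \<noteq> {}" by (auto simp: coloured_def)
      then have "card (fst X) \<noteq> 0" using family_subset(1)[OF subF] fin(1) by (metis card_eq_0_iff finite_subset)
      then show "(if 2 \<le> card (fst X) then 1 else 0) + 1 \<le> card (fst X)" by auto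
    qed
    also have "\<dots> \<le> (\<Sum>X\<in>meeting F D. card (fst X))"
      using finF' by (intro sum_mono2) (auto simp: coloured_def meeting_def)
    also have "\<dots> = n1 * ?M"
    proof (rule sum_card_fst[OF D_facts(2) finF' closed_inD[OF D]])
      show "card {X \<in> F. a \<in> fst X} = n1" if "a \<in> D" for a using F D_facts(1) that by (auto simp: realizes_def)
    qed
    finally show ?thesis unfolding G .
  qed
  then have \<nu>M: "(\<Sum>T\<in>?C. \<nu> T) \<le> ?M - 1" using Q by linarith
  have lower: "sum lb ?C \<le> ?M - 1"
  proof -
    have "sum lb ?C \<le> sum \<nu> ?C" by (rule sum_mono) (auto simp: lb_def)
    then show ?thesis using \<nu>M by simp
  qed
  have sum_ub: "sum ub ?C + 1 = card (coloured F D)"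
  proof -
    have "sum ub (?C - {B}) = sum \<kappa> (?C - {B})" by (rule sum.cong) (auto simp: ub_def)
    moreover have "ub B + 1 = \<kappa> B" using \<kappa>B by (simp add: ub_def)
    moreover have "sum ub ?C = ub B + sum ub (?C - {B})" "sum \<kappa> ?C = \<kappa> B + sum \<kappa> (?C - {B})"
      by (rule sum.remove[OF finC])+
    ultimately show ?thesis using sum_\<kappa> by linarith
  qed
  have Q': "card (coloured F D) = ?M * (n1 - 2) + ?M + 1"
  proof -
    obtain m where m: "n1 = 2 + m" using n1 le_Suc_ex by blast
    then show ?thesis using Q by (simp add: algebra_simps)
  qed
  then have upper: "?M - 1 \<le> sum ub ?C" using sum_ub by linarith
  obtain p where p: "\<And>T. T \<in> ?C \<Longrightarrow> lb T \<le> p T \<and> p T \<le> ub T" "sum p ?C = ?M - 1"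
    using ex_intermediate_function[OF finC(1) lu lower upper] by blast
  define p' where "p' T = (if T = {} then 0 else p T)" for T
  define s where "s T = (if T = {} then 0 else ub T - p T)" for T
  have Pow: "sum f (Pow B) = f {} + sum f ?C" for f :: "'b set \<Rightarrow> nat"
    by (rule sum.remove) (use fin(2) in auto)
  have p'C: "sum p' ?C = ?M - 1" using p(2) by (simp add: p'_def)
  have sC: "sum s ?C + sum p ?C = sum ub ?C"
    unfolding sum.distrib[symmetric] by (rule sum.cong) (use p(1) in \<open>auto simp: s_def\<close>)
  show ?thesis
  proof (rule replace[of p' s])
    show "(\<Sum>T\<in>Pow B. p' T) = ?M - 1" using Pow[of p'] p'C by (simp add: p'_def)
    show "s {} = 0" by (simp add: s_def)
    show "s T \<le> ?M" if "T \<subseteq> B" for T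
    proof (cases "T = {}")
      case False
      then have "T \<in> ?C" using that by simp
      then have "s T \<le> ub T - lb T" using p(1)[of T] False by (simp add: s_def diff_le_mono2)
      also have "\<dots> \<le> ?M" using singles[of T] singles_le[of T] by (auto simp: lb_def ub_def)
      finally show ?thesis .
    qed (simp add: s_def)
    show "(\<Sum>T\<in>Pow B. s T) = ?M * (n1 - 2) + 1"
      using Pow[of s] sC p(2) sum_ub Q' D_facts(3) by (simp add: s_def)
    show "p' T + s T = \<kappa> T" if "T \<subseteq> B" "T \<noteq> {}" "T \<noteq> B" for T
      using p(1)[of T] that by (auto simp: p'_def s_def ub_def)
    show "p' B + s B + 1 = \<kappa> B"
      using p(1)[of B] B \<kappa>B by (auto simp: p'_def s_def ub_def)
    show "({a}, T) \<in> F" if T: "T \<subseteq> B" "T \<noteq> {}" "T \<noteq> B" "p' T = 0" "s T = ?M" "a \<in> D" for T a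
    proof -
      have "lb T \<le> p T" "p T = 0" using p(1)[of T] T by (auto simp: p'_def)
      then have "\<nu> T = 0" using T(3) by (simp add: lb_def)
      moreover have "\<kappa> T = ?M" using T p(1)[of T] by (auto simp: s_def ub_def p'_def)
      ultimately have "card {a \<in> D. ({a}, T) \<in> F} = ?M" using singles[of T] by simp
      then have "{a \<in> D. ({a}, T) \<in> F} = D" using D_facts(2) by (intro card_subset_eq) auto
      then show ?thesis using T(6) by blast
    qed
  qed
qed

text \<open>With \<open>n1 = 2\<close> only the last vertex has room for a coloured singleton, and
  it gets the colour \<open>B\<close>. So of the classes of colour \<open>B\<close> one is dropped
  and one becomes this singleton; all other coloured classes become edges, and the remaining edges
  get the empty colour.\<close>

lemma descent_path_two:
  assumes n2: "n1 = 2" and Q: "card (coloured F D) \<le> card D + 1" and \<kappa>B: "2 \<le> \<kappa> B"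
  shows "\<exists>F'. realizes A B n1 (n2 - 1) F'"
proof -
  let ?C = "Pow B - {{}}" and ?M = "card D"
  have finC: "finite ?C" "B \<in> ?C" using fin(2) B by auto
  define q where "q T = (if T = B then \<kappa> B - 2 else \<kappa> T)" for T
  have "sum q (?C - {B}) = sum \<kappa> (?C - {B})" by (rule sum.cong) (auto simp: q_def)
  moreover have "q B + 2 = \<kappa> B" using \<kappa>B by (simp add: q_def)
  moreover have "sum q ?C = q B + sum q (?C - {B})" "sum \<kappa> ?C = \<kappa> B + sum \<kappa> (?C - {B})"
    by (rule sum.remove[OF finC])+
  ultimately have sq: "sum q ?C + 2 = card (coloured F D)" using sum_\<kappa> by linarith
  define p where "p T = (if T = {} then ?M - 1 - sum q ?C else q T)" for T
  define s where "s T = (if T = B then 1 else (0::nat))" for T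
  have Pow: "sum f (Pow B) = f {} + sum f ?C" for f :: "'b set \<Rightarrow> nat"
    by (rule sum.remove) (use fin(2) in auto)
  have "sum p ?C = sum q ?C" by (rule sum.cong) (auto simp: p_def)
  then have sp: "sum p (Pow B) = ?M - 1" using Pow[of p] sq Q by (simp add: p_def)
  show ?thesis
  proof (rule replace[of p s])
    show "(\<Sum>T\<in>Pow B. s T) = ?M * (n1 - 2) + 1" using fin(2) n2 by (simp add: s_def)
    show "s T \<le> ?M" for T using D_facts(3) by (simp add: s_def)
    show "p B + s B + 1 = \<kappa> B" using \<kappa>B B by (simp add: p_def q_def s_def)
    show "({a}, T) \<in> F" if "T \<noteq> B" "s T = ?M" for T a using that D_facts(3) by (simp add: s_def)
  qed (use sp B in \<open>auto simp: p_def q_def s_def\<close>)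
qed

end

section \<open>Rigid set systems for the construction\<close>

definition deg :: "'a set set \<Rightarrow> 'a \<Rightarrow> nat" where
  "deg \<N> a = card {S \<in> \<N>. a \<in> S}"

lemma deg_Un: "finite X \<Longrightarrow> finite Y \<Longrightarrow> X \<inter> Y = {} \<Longrightarrow> deg (X \<union> Y) a = deg X a + deg Y a"
proof -
  assume X: "finite X" "finite Y" "X \<inter> Y = {}"
  have "{S \<in> X \<union> Y. a \<in> S} = {S \<in> X. a \<in> S} \<union> {S \<in> Y. a \<in> S}" by blast
  moreover have "{S \<in> X. a \<in> S} \<inter> {S \<in> Y. a \<in> S} = {}" using X(3) by blast
  ultimately show ?thesis unfolding deg_def using X(1,2) by (simp add: card_Un_disjoint)
qed

lemma deg_empty [simp]: "deg {} a = 0"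
  by (simp add: deg_def)

lemma deg_insert:
  assumes "finite X" "S \<notin> X"
  shows "deg (insert S X) a = (if a \<in> S then 1 else 0) + deg X a"
proof -
  have "{U \<in> insert S X. a \<in> U} = (if a \<in> S then insert S {U \<in> X. a \<in> U} else {U \<in> X. a \<in> U})" by auto
  then show ?thesis using assms by (simp add: deg_def)
qed

lemma deg_eqI: "{S \<in> X. a \<in> S} = f ` I \<Longrightarrow> inj_on f I \<Longrightarrow> deg X a = card I"
  by (simp add: deg_def card_image)

lemma deg_0: "(\<And>S. S \<in> X \<Longrightarrow> a \<notin> S) \<Longrightarrow> deg X a = 0"
  by (simp add: deg_def card_eq_0_iff)

lemma filter_Un_image:
  assumes "\<And>x. x \<in> S \<Longrightarrow> P (f x) \<longleftrightarrow> Q x" "\<And>y. y \<in> T \<Longrightarrow> P (g y) \<longleftrightarrow> R y"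
  shows "{z \<in> f ` S \<union> g ` T. P z} = f ` {x \<in> S. Q x} \<union> g ` {y \<in> T. R y}"
  using assms by blast

lemma growth_sets:
  fixes \<N> :: "nat set set"
  assumes pi: "inj \<pi>" and img: "\<And>S. S \<in> \<N> \<Longrightarrow> \<pi> ` S \<in> \<N>"
    and base: "\<And>t. t < t0 \<Longrightarrow> \<pi> t = t"
    and step: "\<And>t. t0 \<le> t \<Longrightarrow> t < M \<Longrightarrow> \<exists>v<t. \<exists>S\<in>\<N>. v \<in> S \<and> t \<in> S \<and>
        (\<forall>S'\<in>\<N>. v \<in> S' \<and> card S' = card S \<longrightarrow> S' \<subseteq> {..t})"
    and "t < M"
  shows "\<pi> t = t"
proof -
  let ?F = "(\<lambda>S. (S, {} :: nat set)) ` \<N>"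
  have "\<pi> (id t) = id t"
  proof (rule growth[of id M \<pi> ?F id t0 t])
    fix t assume "t0 \<le> t" "t < M"
    from step[OF this] obtain v S where v: "v < t" "S \<in> \<N>" "v \<in> S" "t \<in> S"
      "\<forall>S'\<in>\<N>. v \<in> S' \<and> card S' = card S \<longrightarrow> S' \<subseteq> {..t}" by blast
    have "(S, {}) \<in> ?F" using v(2) by blast
    moreover have "\<forall>S' T'. (S', T') \<in> ?F \<and> id v \<in> S' \<and> card S' = card S \<longrightarrow> S' \<subseteq> id ` {..t}"
      using v(5) by auto
    ultimately show "\<exists>v<t. \<exists>S T. (S, T) \<in> ?F \<and> id v \<in> S \<and> id t \<in> S \<and>
        (\<forall>S' T'. (S', T') \<in> ?F \<and> id v \<in> S' \<and> card S' = card S \<longrightarrow> S' \<subseteq> id ` {..t})"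
      using v by (metis id_apply)
  next
    show "act \<pi> id X \<in> ?F" if "X \<in> ?F" for X using that img by auto
  qed (use assms in auto)
  then show ?thesis by simp
qed

text \<open>
  A set system whose automorphisms fix \<open>A\<close> pointwise stays rigid however its members are coloured,
  as soon as each element of \<open>B\<close> is the colour of a member of its own.
\<close>

lemma realizes_of_rigid_sets:
  fixes A :: "'a set" and B :: "'b set" and Sg :: "('a \<times> 'b set) set"
  assumes fin: "finite A" "finite B" and \<N>: "\<N> \<subseteq> Pow A" "\<And>S. S \<in> \<N> \<Longrightarrow> 2 \<le> card S"
    and Sg: "Sg \<subseteq> A \<times> Pow B"
    and degA: "\<And>a. a \<in> A \<Longrightarrow> card {T. (a, T) \<in> Sg} + deg \<N> a = n1"
    and degB: "\<And>b. b \<in> B \<Longrightarrow> card {x \<in> Sg. b \<in> snd x} + p + 1 = n2"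
    and p: "p + card B \<le> card \<N>"
    and rigidA: "\<And>\<pi>. \<pi> permutes A \<Longrightarrow> (\<And>a. (a, {}) \<in> Sg \<Longrightarrow> (\<pi> a, {}) \<in> Sg) \<Longrightarrow>
      (\<And>S. S \<in> \<N> \<Longrightarrow> \<pi> ` S \<in> \<N>) \<Longrightarrow> (\<And>a. a \<in> A \<Longrightarrow> \<pi> a = a)"
  shows "\<exists>F. realizes A B n1 n2 F"
proof -
  have fin\<N>: "finite \<N>" using \<N>(1) fin(1) finite_subset by blast
  have finSg: "finite Sg" using Sg fin by (meson finite_Pow_iff finite_SigmaI finite_subset)
  have "card B \<le> card \<N>" using p by simp
  then obtain \<mu> where \<mu>: "inj_on \<mu> B" "\<mu> ` B \<subseteq> \<N>" using card_le_inj[OF fin(2) fin\<N>] by blast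
  have "p \<le> card (\<N> - \<mu> ` B)" using p \<mu> fin by (simp add: card_Diff_subset card_image)
  then obtain \<P> where \<P>: "\<P> \<subseteq> \<N> - \<mu> ` B" "card \<P> = p" by (meson obtain_subset_with_card_n)
  have fin\<P>: "finite \<P>" using \<P>(1) fin\<N> by (meson finite_Diff finite_subset)
  \<comment> \<open>Members of \<open>\<P>\<close> get all of \<open>B\<close>, the member
    \<open>\<mu> b\<close> gets \<open>{b}\<close>, and the others get nothing. So each
    \<open>b\<close> receives \<open>p + 1\<close> incidences, and \<open>\<mu> b\<close> identifies
    \<open>b\<close>.\<close>
  define col where "col S = {b \<in> B. S \<in> \<P> \<or> S = \<mu> b}" for S
  let ?s = "\<lambda>x. ({fst x}, snd x)" and ?n = "\<lambda>S. (S, col S)"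
  let ?F = "?s ` Sg \<union> ?n ` \<N>"
  have inj_s: "inj_on ?s Sg" by (rule inj_onI) (simp add: prod_eq_iff)
  have inj_n: "inj_on ?n \<N>" by (rule inj_onI) simp
  have disj: "?s ` X \<inter> ?n ` Y = {}" if Y: "Y \<subseteq> \<N>" for X Y
  proof (rule ccontr)
    assume "\<not> ?thesis"
    then obtain x S where "x \<in> X" "S \<in> Y" "({fst x}, snd x) = (S, col S)" by blast
    then have "S = {fst x}" "S \<in> \<N>" using Y by auto
    then show False using \<N>(2)[of S] by simp
  qed
  have single_iff: "({a}, T) \<in> ?F \<longleftrightarrow> (a, T) \<in> Sg" for a T
  proof
    assume "({a}, T) \<in> ?F"
    moreover have "({a}, T) \<notin> ?n ` \<N>" using \<N>(2)[of "{a}"] by auto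
    ultimately obtain x where "x \<in> Sg" "({a}, T) = ?s x" by blast
    then show "(a, T) \<in> Sg" by (metis Pair_inject prod.collapse singleton_inject)
  next
    assume "(a, T) \<in> Sg"
    then have "?s (a, T) \<in> ?F" by blast
    then show "({a}, T) \<in> ?F" by simp
  qed
  have set_iff: "(S, T) \<in> ?F \<longleftrightarrow> S \<in> \<N> \<and> T = col S" if "2 \<le> card S" for S T
  proof
    assume "(S, T) \<in> ?F"
    moreover have "(S, T) \<notin> ?s ` Sg" using that by auto
    ultimately show "S \<in> \<N> \<and> T = col S" by blast
  qed blast
  have degA': "card {X \<in> ?F. a \<in> fst X} = n1" if a: "a \<in> A" for a
  proof -
    have "{X \<in> ?F. a \<in> fst X} = ?s ` {x \<in> Sg. fst x = a} \<union> ?n ` {S \<in> \<N>. a \<in> S}"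
      by (rule filter_Un_image) auto
    also have "card \<dots> = card (?s ` {x \<in> Sg. fst x = a}) + card (?n ` {S \<in> \<N>. a \<in> S})"
      by (rule card_Un_disjoint) (use finSg fin\<N> disj in auto)
    also have "card (?s ` {x \<in> Sg. fst x = a}) = card {x \<in> Sg. fst x = a}"
      by (rule card_image[OF inj_on_subset[OF inj_s]]) auto
    also have "{x \<in> Sg. fst x = a} = Pair a ` {T. (a, T) \<in> Sg}" by auto
    also have "card \<dots> = card {T. (a, T) \<in> Sg}" by (rule card_image) (simp add: inj_on_def)
    also have "card (?n ` {S \<in> \<N>. a \<in> S}) = deg \<N> a"
      unfolding deg_def by (rule card_image[OF inj_on_subset[OF inj_n]]) auto
    finally show ?thesis using degA[OF a] by simp
  qed
  have degB': "card {X \<in> ?F. b \<in> snd X} = n2" if b: "b \<in> B" for b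
  proof -
    have "{S \<in> \<N>. b \<in> col S} = insert (\<mu> b) \<P>" using b \<mu>(2) \<P>(1) by (auto simp: col_def)
    moreover have "\<mu> b \<notin> \<P>" using \<P>(1) b by blast
    ultimately have c: "card {S \<in> \<N>. b \<in> col S} = p + 1" using fin\<P> \<P>(2) by simp
    have "{X \<in> ?F. b \<in> snd X} = ?s ` {x \<in> Sg. b \<in> snd x} \<union> ?n ` {S \<in> \<N>. b \<in> col S}"
      by (rule filter_Un_image) auto
    also have "card \<dots> = card (?s ` {x \<in> Sg. b \<in> snd x}) + card (?n ` {S \<in> \<N>. b \<in> col S})"
      by (rule card_Un_disjoint) (use finSg fin\<N> disj in auto)
    also have "card (?s ` {x \<in> Sg. b \<in> snd x}) = card {x \<in> Sg. b \<in> snd x}"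
      by (rule card_image[OF inj_on_subset[OF inj_s]]) auto
    also have "card (?n ` {S \<in> \<N>. b \<in> col S}) = card {S \<in> \<N>. b \<in> col S}"
      by (rule card_image[OF inj_on_subset[OF inj_n]]) auto
    finally show ?thesis using degB[OF b] c by simp
  qed
  have "rigid A B ?F" unfolding rigid_def
  proof (intro allI impI, elim conjE)
    fix \<pi> \<beta> assume perm: "\<pi> permutes A" "\<beta> permutes B" and img: "act \<pi> \<beta> ` ?F \<subseteq> ?F"
    have act: "(\<pi> ` S, \<beta> ` T) \<in> ?F" if "(S, T) \<in> ?F" for S T
    proof -
      have "act \<pi> \<beta> (S, T) \<in> ?F" by (rule subsetD[OF img imageI[OF that]])
      then show ?thesis unfolding act_Pair .
    qed
    have c\<pi>: "card (\<pi> ` S) = card S" for S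
      by (rule card_image) (use permutes_inj[OF perm(1)] in \<open>auto intro: inj_on_subset\<close>)
    have fixA: "\<pi> a = a" if "a \<in> A" for a
    proof (rule rigidA[OF perm(1) _ _ that])
      show "(\<pi> a, {}) \<in> Sg" if "(a, {}) \<in> Sg" for a
        using act[of "{a}" "{}"] that single_iff[of a "{}"] single_iff[of "\<pi> a" "{}"] by simp
      show "\<pi> ` S \<in> \<N>" if S: "S \<in> \<N>" for S
        using act[of S "col S"] set_iff[of S "col S"] set_iff[of "\<pi> ` S" "\<beta> ` col S"] S \<N>(2)[OF S] c\<pi> by simp
    qed
    have \<pi>id: "\<pi> = id"
    proof
      fix x show "\<pi> x = id x" using fixA[of x] permutes_not_in[OF perm(1), of x] by (cases "x \<in> A") simp_all
    qed
    have "\<beta> b = b" if b: "b \<in> B" for b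
    proof -
      have \<mu>b: "\<mu> b \<in> \<N>" using \<mu>(2) b by blast
      have "\<mu> b \<notin> \<P>" using \<P>(1) b by blast
      then have colb: "col (\<mu> b) = {b}" using b \<mu>(1) by (auto simp: col_def inj_on_def)
      have "(\<mu> b, {b}) \<in> ?F" using set_iff[OF \<N>(2)[OF \<mu>b]] \<mu>b colb by simp
      then have "(\<mu> b, {\<beta> b}) \<in> ?F" using act[of "\<mu> b" "{b}"] \<pi>id by simp
      then have "{\<beta> b} = {b}" using set_iff[OF \<N>(2)[OF \<mu>b]] colb by simp
      then show ?thesis by simp
    qed
    then have "\<beta> = id" using permutes_not_in[OF perm(2)] by (metis eq_id_iff)
    then show "\<pi> = id \<and> \<beta> = id" using \<pi>id by simp
  qed
  moreover have "?F \<subseteq> Pow A \<times> Pow B"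
  proof
    fix X assume "X \<in> ?F"
    then consider x where "x \<in> Sg" "X = ?s x" | S where "S \<in> \<N>" "X = ?n S" by blast
    then show "X \<in> Pow A \<times> Pow B"
    proof cases
      case 1
      then have "x \<in> A \<times> Pow B" using Sg by blast
      then show ?thesis using 1(2) by (simp add: mem_Times_iff)
    next
      case 2
      then show ?thesis using \<N>(1) by (auto simp: col_def)
    qed
  qed
  moreover have "({}, {}) \<notin> ?F"
  proof
    assume "({}, {}) \<in> ?F"
    then have "{} \<in> \<N>" by auto
    then show False using \<N>(2)[of "{}"] by simp
  qed
  ultimately have "realizes A B n1 n2 ?F" using degA' degB' unfolding realizes_def by blast
  then show ?thesis by blast
qed

subsection \<open>Parts of size two\<close>

text \<open>A path whose two ends are completed by \<open>({a}, {})\<close> would have a reflection.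
  Here the triple \<open>{0, 1, 2}\<close> joins legs with 0, 1 and \<open>M - 4 \<ge> 2\<close>
  edges, so no two legs can be exchanged, and all degrees are still two.\<close>

lemma spider:
  fixes B :: "'b set"
  assumes B: "finite B" and M: "6 \<le> M" and p: "p + card B + 2 \<le> M"
  shows "\<exists>F. realizes {..<M} B 2 (p + 1) F"
proof -
  let ?N1 = "{{0, 1, 2}, {1, 3}, {2, 4}} :: nat set set"
  let ?leg = "(\<lambda>i. {i, Suc i}) ` {4..<M - 1}"
  let ?N = "?N1 \<union> ?leg"
  \<comment> \<open>The ends of the three legs lack one incidence each.\<close>
  let ?Sg = "(\<lambda>a. (a, {} :: 'b set)) ` {0, 3, M - 1}"
  have inj: "inj_on (\<lambda>i::nat. {i, Suc i}) I" for I by (rule inj_onI) (auto simp: doubleton_eq_iff)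
  have disj: "?N1 \<inter> ?leg = {}"
  proof -
    have "4 \<le> x" if "S \<in> ?leg" "x \<in> S" for S x using that by auto
    moreover have "\<exists>x\<in>S. x < 4" if "S \<in> ?N1" for S using that by auto
    ultimately show ?thesis by (meson disjoint_iff not_less)
  qed
  have "{0, 1, 2} \<noteq> {1, 3 :: nat}" "{0, 1, 2} \<noteq> {2, 4 :: nat}"
    by (rule notI, drule arg_cong[of _ _ card], simp)+
  then have N1_ne: "{0, 1, 2} \<noteq> {1, 3 :: nat}" "{0, 1, 2} \<noteq> {2, 4 :: nat}" "{1, 3} \<noteq> {2, 4 :: nat}"
    by (simp_all add: doubleton_eq_iff)
  have card: "card ?N = M - 2"
  proof -
    have "card ?N1 = 3" using N1_ne by (simp add: card_insert_if)
    moreover have "card ?leg = M - 5" using inj by (subst card_image) auto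
    ultimately show ?thesis using M disj by (subst card_Un_disjoint) auto
  qed
  have pairs: "S = {1, 3} \<or> S = {2, 4} \<or> (\<exists>i. 4 \<le> i \<and> i < M - 1 \<and> S = {i, Suc i})"
    if "S \<in> ?N" "card S = 2" for S using that by auto
  have threes: "S = {0, 1, 2}" if "S \<in> ?N" "card S = 3" for S using that by auto
  show ?thesis
  proof (rule realizes_of_rigid_sets[of _ _ ?N ?Sg])
    show "?N \<subseteq> Pow {..<M}" using M by auto
    show "2 \<le> card S" if "S \<in> ?N" for S using that by auto
    show "?Sg \<subseteq> {..<M} \<times> Pow B" using M by auto
    show "p + card B \<le> card ?N" using card p by simp
    show "card {x \<in> ?Sg. b \<in> snd x} + p + 1 = p + 1" for b
    proof -
      have "{x \<in> ?Sg. b \<in> snd x} = {}" by auto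
      then show ?thesis by simp
    qed
  next
    fix a assume a: "a \<in> {..<M}"
    have leg: "deg ?leg a = card ({a} \<inter> {4..<M - 1} \<union> {a - 1} \<inter> {i. 4 \<le> i \<and> i < M - 1 \<and> 0 < a})"
    proof (rule deg_eqI)
      show "{S \<in> ?leg. a \<in> S} = (\<lambda>i. {i, Suc i}) ` ({a} \<inter> {4..<M - 1} \<union> {a - 1} \<inter> {i. 4 \<le> i \<and> i < M - 1 \<and> 0 < a})"
        by (auto simp: image_iff)
    qed (rule inj)
    have N1: "deg ?N1 a = (if a = 0 \<or> a = 3 \<or> a = 4 then 1 else if a = 1 \<or> a = 2 then 2 else 0)"
    proof -
      have "deg ?N1 a = (if a \<in> {0, 1, 2} then 1 else 0) + ((if a \<in> {1, 3} then 1 else 0) + (if a \<in> {2, 4} then 1 else 0))"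
        using N1_ne by (simp add: deg_insert)
      then show ?thesis by (simp split: if_splits)
    qed
    have sg: "card {T. (a, T) \<in> ?Sg} = (if a = 0 \<or> a = 3 \<or> a = M - 1 then 1 else 0)"
    proof -
      have "{T. (a, T) \<in> ?Sg} = (if a = 0 \<or> a = 3 \<or> a = M - 1 then {{}} else {})" by auto
      then show ?thesis by simp
    qed
    have l: "deg ?leg a = (if a < 4 then 0 else if a = 4 \<or> a = M - 1 then 1 else 2)"
    proof -
      consider "a < 4" | "a = 4" | "a = M - 1" "5 \<le> a" | "5 \<le> a" "a < M - 1" using a by force
      then show ?thesis
      proof cases
        case 1
        then have "{a} \<inter> {4..<M - 1} \<union> {a - 1} \<inter> {i. 4 \<le> i \<and> i < M - 1 \<and> 0 < a} = {}" by auto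
        then show ?thesis using leg 1 by simp
      next
        case 2
        then have "{a} \<inter> {4..<M - 1} \<union> {a - 1} \<inter> {i. 4 \<le> i \<and> i < M - 1 \<and> 0 < a} = {4}" using M by auto
        then show ?thesis using leg 2 by simp
      next
        case 3
        then have "{a} \<inter> {4..<M - 1} \<union> {a - 1} \<inter> {i. 4 \<le> i \<and> i < M - 1 \<and> 0 < a} = {a - 1}" by auto
        then show ?thesis using leg 3 by simp
      next
        case 4
        then have "{a} \<inter> {4..<M - 1} \<union> {a - 1} \<inter> {i. 4 \<le> i \<and> i < M - 1 \<and> 0 < a} = {a, a - 1}" by auto
        then show ?thesis using leg 4 by simp
      qed
    qed
    have "deg ?N a = deg ?N1 a + deg ?leg a" by (rule deg_Un) (use disj in auto)
    then show "card {T. (a, T) \<in> ?Sg} + deg ?N a = 2" using N1 sg l a M by (auto split: if_splits)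
  next
    fix \<pi> a assume perm: "\<pi> permutes {..<M}" and sg: "\<And>a. (a, {}) \<in> ?Sg \<Longrightarrow> (\<pi> a, {}) \<in> ?Sg"
      and img: "\<And>S. S \<in> ?N \<Longrightarrow> \<pi> ` S \<in> ?N" and a: "a \<in> {..<M}"
    have inj\<pi>: "inj \<pi>" by (rule permutes_inj[OF perm])
    have c\<pi>: "card (\<pi> ` S) = card S" for S by (rule card_image) (use inj\<pi> in \<open>auto intro: inj_on_subset\<close>)
    have ends: "\<pi> x \<in> {0, 3, M - 1}" if "x \<in> {0, 3, M - 1}" for x
    proof -
      have "(x, {}) \<in> ?Sg" using that by blast
      from sg[OF this] show ?thesis by auto
    qed
    have "\<pi> ` {0, 1, 2} \<in> ?N" by (rule img) simp
    moreover have "card (\<pi> ` {0, 1, 2}) = 3" unfolding c\<pi> by simp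
    ultimately have tri: "\<pi> ` {0, 1, 2} = {0, 1, 2}" by (rule threes)
    then have "\<pi> 0 \<in> {0, 1, 2}" by blast
    then have \<pi>0: "\<pi> 0 = 0" using ends[of 0] M by auto
    have ne: "\<pi> 1 \<noteq> 0" "\<pi> 2 \<noteq> 0" "\<pi> 1 \<noteq> \<pi> 2" using \<pi>0 inj\<pi> by (metis injD numeral_One one_eq_numeral_iff zero_neq_numeral semiring_norm(85))+
    have \<pi>12: "\<pi> 1 \<in> {0, 1, 2}" "\<pi> 2 \<in> {0, 1, 2}" using tri by blast+
    have "{1, 3} \<in> ?N" by simp
    from img[OF this] have p13: "{\<pi> 1, \<pi> 3} \<in> ?N" by simp
    have c13: "card {\<pi> 1, \<pi> 3} = 2" using c\<pi>[of "{1, 3}"] by simp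
    have \<pi>3: "\<pi> 3 \<in> {0, 3, M - 1}" by (rule ends) simp
    have \<pi>1: "\<pi> 1 = 1"
    proof (rule ccontr)
      assume "\<pi> 1 \<noteq> 1"
      then have "\<pi> 1 = 2" using \<pi>12 ne by auto
      then show False using pairs[OF p13 c13] \<pi>3 M by (auto simp: doubleton_eq_iff)
    qed
    then have \<pi>2: "\<pi> 2 = 2" using \<pi>12 ne by auto
    have \<pi>3: "\<pi> 3 = 3" using pairs[OF p13 c13] \<pi>1 by (auto simp: doubleton_eq_iff)
    show "\<pi> a = a"
    proof (rule growth_sets[of \<pi> ?N 4 M a])
      fix t :: nat assume "t < 4"
      then have "t = 0 \<or> t = 1 \<or> t = 2 \<or> t = 3" by auto
      then show "\<pi> t = t" using \<pi>0 \<pi>1 \<pi>2 \<pi>3 by blast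
    next
      fix t assume t: "4 \<le> t" "t < M"
      show "\<exists>v<t. \<exists>S\<in>?N. v \<in> S \<and> t \<in> S \<and> (\<forall>S'\<in>?N. v \<in> S' \<and> card S' = card S \<longrightarrow> S' \<subseteq> {..t})"
      proof (cases "t = 4")
        case True
        have "S' \<subseteq> {..t}" if "S' \<in> ?N" "2 \<in> S'" "card S' = card {2, 4::nat}" for S'
          using pairs[OF that(1)] that(2,3) True by auto
        then show ?thesis using True by (intro exI[of _ 2] conjI bexI[of _ "{2, 4}"]) auto
      next
        case False
        have "S' \<subseteq> {..t}" if "S' \<in> ?N" "t - 1 \<in> S'" "card S' = card {t - 1, t}" for S'
          using pairs[OF that(1)] that(2,3) t False by auto
        moreover have "{t - 1, t} \<in> ?leg"
        proof
          show "{t - 1, t} = {t - 1, Suc (t - 1)}" using t by simp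
        qed (use t False in auto)
        ultimately show ?thesis using t False by (intro exI[of _ "t - 1"] conjI bexI[of _ "{t - 1, t}"]) auto
      qed
    qed (use a inj\<pi> img in simp_all)
  qed (use B in auto)
qed

subsection \<open>Parts of size at least three\<close>

context
  fixes n1 q w \<rho> N k :: nat
  assumes n1: "3 \<le> n1" and k: "k = n1 - q - 1" "q \<le> n1 - 2" "k dvd N"
    and w: "4 \<le> w" "n1 \<le> w" and \<rho>: "2 * w + 1 \<le> \<rho>" and N: "2 * w \<le> N"
begin

text \<open>The points below \<open>\<rho>\<close> form a region whose size will stay bounded; the
  next \<open>N\<close> points are the bulk, where \<open>q\<close> incidences per point are left
  for coloured singletons. Growth starts at 0, runs along \<open>paths\<close> through the region,
  enters the bulk by \<open>triples\<close> and continues in steps of \<open>w\<close> by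
  \<open>chords\<close>. The other sets adjust degrees: \<open>cliques\<close> add
  \<open>k - 1\<close> in the bulk, \<open>pre\<close> and \<open>suf\<close> together
  \<open>n1 - 3\<close> in the region, and \<open>closing\<close> adds one where
  \<open>triples\<close> are absent or a path or chord is missing. The sets in \<open>pre\<close>
  and \<open>suf\<close> and the set \<open>closing\<close> have at least four points, so growth by
  pairs and triples does not see them.\<close>

definition "paths = (\<lambda>i. {i, Suc i}) ` {..<\<rho> - 1}"
definition "triples = (\<lambda>i. {i, \<rho> - 1 - i, \<rho> + i}) ` {..<w}"
definition "pre = (\<lambda>l. {..<4 + l}) ` {..<n1 - 3}"
definition "suf = (\<lambda>l. {4 + l..<\<rho>}) ` {..<n1 - 3}"
definition "closing = {w..<\<rho> - w} \<union> {\<rho> - 1} \<union> {\<rho> + N - w..<\<rho> + N}"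
definition "chords = (\<lambda>j. {\<rho> + j, \<rho> + j + w}) ` {..<N - w}"
definition "cliques = {{\<rho> + i, \<rho> + j} | i j. i < j \<and> j < N \<and> i div k = j div k}"
definition "pairs = paths \<union> (chords \<union> cliques)"
definition "larges = triples \<union> (pre \<union> (suf \<union> {closing}))"
definition "system = pairs \<union> larges"

lemma k_pos: "1 \<le> k" and k_w: "k \<le> w"
  using k n1 w by auto

lemma card_triple: "i < w \<Longrightarrow> card {i, \<rho> - 1 - i, \<rho> + i} = 3"
proof -
  assume i: "i < w"
  then have "i \<noteq> \<rho> - 1 - i" "i \<noteq> \<rho> + i" "\<rho> - 1 - i \<noteq> \<rho> + i" using \<rho> by linarith+
  then show ?thesis by simp
qed

lemma card_paths: "S \<in> paths \<Longrightarrow> card S = 2"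
  by (auto simp: paths_def)

lemma card_chords: "S \<in> chords \<Longrightarrow> card S = 2"
  using w by (auto simp: chords_def)

lemma card_cliques: "S \<in> cliques \<Longrightarrow> card S = 2"
  by (auto simp: cliques_def)

lemma card_pairs: "S \<in> pairs \<Longrightarrow> card S = 2"
  using card_paths card_chords card_cliques by (auto simp: pairs_def)

lemma card_triples: "S \<in> triples \<Longrightarrow> card S = 3"
  using card_triple by (auto simp: triples_def)

lemma card_pre: "S \<in> pre \<Longrightarrow> 4 \<le> card S"
  by (auto simp: pre_def)

lemma card_suf: "S \<in> suf \<Longrightarrow> 4 \<le> card S"
  using \<rho> w n1 by (auto simp: suf_def)

lemma card_closing: "4 \<le> card closing"
proof -
  have "card {\<rho> + N - w..<\<rho> + N} \<le> card closing" unfolding closing_def by (rule card_mono) auto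
  then show ?thesis using w N by simp
qed

lemma paths_sub: "S \<in> paths \<Longrightarrow> x \<in> S \<Longrightarrow> x < \<rho>"
  by (auto simp: paths_def)

lemma chords_sub: "S \<in> chords \<Longrightarrow> x \<in> S \<Longrightarrow> \<rho> \<le> x \<and> x < \<rho> + N"
  using N by (auto simp: chords_def)

lemma cliques_sub: "S \<in> cliques \<Longrightarrow> x \<in> S \<Longrightarrow> \<rho> \<le> x \<and> x < \<rho> + N"
  by (auto simp: cliques_def)

lemma pre_sub: "S \<in> pre \<Longrightarrow> x \<in> S \<Longrightarrow> x < \<rho>"
  using \<rho> w n1 by (auto simp: pre_def)

lemma suf_sub: "S \<in> suf \<Longrightarrow> x \<in> S \<Longrightarrow> x < \<rho>"
  by (auto simp: suf_def)

lemma triples_sub: "S \<in> triples \<Longrightarrow> x \<in> S \<Longrightarrow> x < \<rho> + N"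
  using \<rho> w N by (auto simp: triples_def)

lemma closing_sub: "x \<in> closing \<Longrightarrow> x < \<rho> + N"
  using \<rho> N by (auto simp: closing_def)

lemma system_sub: "system \<subseteq> Pow {..<\<rho> + N}"
proof
  fix S assume "S \<in> system"
  then consider "S \<in> paths" | "S \<in> chords" | "S \<in> cliques" | "S \<in> triples" | "S \<in> pre" | "S \<in> suf" | "S = closing"
    by (auto simp: system_def pairs_def larges_def)
  then have "\<forall>x\<in>S. x < \<rho> + N"
    by cases (use paths_sub chords_sub cliques_sub triples_sub pre_sub suf_sub closing_sub in fastforce)+
  then show "S \<in> Pow {..<\<rho> + N}" by blast
qed

lemma card_larges: "S \<in> larges \<Longrightarrow> card S = 3 \<and> S \<in> triples \<or> 4 \<le> card S"
  using card_triples card_pre card_suf card_closing by (auto simp: larges_def)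

lemma card_system: "S \<in> system \<Longrightarrow> 2 \<le> card S"
  using card_pairs card_larges by (fastforce simp: system_def)

lemma fin_parts: "finite paths" "finite chords" "finite cliques" "finite triples" "finite pre" "finite suf"
proof -
  show "finite cliques"
  proof (rule finite_subset)
    show "cliques \<subseteq> Pow {..<\<rho> + N}" using cliques_sub by blast
  qed simp
qed (simp_all add: paths_def chords_def triples_def pre_def suf_def)

text \<open>Points at distance \<open>w \<ge> k\<close> lie in different blocks of length
  \<open>k\<close>, so the degrees of the two kinds of pairs add up.\<close>

lemma chord_not_clique: "chords \<inter> cliques = {}"
proof (rule ccontr)
  assume "chords \<inter> cliques \<noteq> {}"
  then obtain j i i' where "{\<rho> + j, \<rho> + j + w} = {\<rho> + i, \<rho> + i'}" "i < i'" "i div k = i' div k"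
    by (auto simp: chords_def cliques_def)
  then have "i' = i + w" "i div k = i' div k" by (auto simp: doubleton_eq_iff)
  moreover have "(i + k) div k \<le> (i + w) div k" using k_w by (intro div_le_mono) simp
  ultimately show False using k_pos by simp
qed

lemma deg_system:
  "deg system a = deg paths a + (deg chords a + deg cliques a) +
     (deg triples a + (deg pre a + (deg suf a + (if a \<in> closing then 1 else 0))))"
proof -
  have d1: "deg (chords \<union> cliques) a = deg chords a + deg cliques a"
    by (rule deg_Un) (use fin_parts chord_not_clique in auto)
  have "paths \<inter> (chords \<union> cliques) = {}"
  proof (rule ccontr)
    assume "\<not> ?thesis"
    then obtain S where S: "S \<in> paths" "S \<in> chords \<or> S \<in> cliques" by blast
    then have "S \<noteq> {}" using card_paths by force
    then obtain x where "x \<in> S" by blast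
    then show False using S paths_sub[of S x] chords_sub[of S x] cliques_sub[of S x] by auto
  qed
  then have d2: "deg pairs a = deg paths a + deg (chords \<union> cliques) a"
    unfolding pairs_def by (intro deg_Un) (use fin_parts in auto)
  have top: "\<rho> + N - 1 \<in> closing" using N w by (auto simp: closing_def)
  have cl: "closing \<notin> pre" "closing \<notin> suf" using top pre_sub suf_sub N w by fastforce+
  have d3: "deg (suf \<union> {closing}) a = deg suf a + (if a \<in> closing then 1 else 0)"
    using deg_Un[of suf "{closing}" a] cl fin_parts deg_insert[of "{}" closing a] by simp
  have "pre \<inter> (suf \<union> {closing}) = {}"
  proof -
    have "(0::nat) \<in> S" if "S \<in> pre" for S using that by (auto simp: pre_def)
    moreover have "(0::nat) \<notin> S" if "S \<in> suf" for S using that by (auto simp: suf_def)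
    ultimately show ?thesis using cl by blast
  qed
  then have d4: "deg (pre \<union> (suf \<union> {closing})) a = deg pre a + deg (suf \<union> {closing}) a"
    by (intro deg_Un) (use fin_parts in auto)
  have "triples \<inter> (pre \<union> (suf \<union> {closing})) = {}"
    using card_triples card_pre card_suf card_closing by fastforce
  then have d5: "deg larges a = deg triples a + deg (pre \<union> (suf \<union> {closing})) a"
    unfolding larges_def by (intro deg_Un) (use fin_parts in auto)
  have "pairs \<inter> larges = {}" using card_pairs card_larges by fastforce
  then have "deg system a = deg pairs a + deg larges a"
    unfolding system_def by (intro deg_Un) (use fin_parts in \<open>auto simp: pairs_def larges_def\<close>)
  then show ?thesis using d1 d2 d3 d4 d5 by simp
qed

lemma deg_paths: "a < \<rho> \<Longrightarrow> deg paths a = (if a = 0 \<or> a = \<rho> - 1 then 1 else 2)"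
proof -
  assume a: "a < \<rho>"
  let ?I = "(if a < \<rho> - 1 then {a} else {}) \<union> (if 0 < a then {a - 1} else {})"
  have "deg paths a = card ?I"
  proof (rule deg_eqI)
    show "{S \<in> paths. a \<in> S} = (\<lambda>i. {i, Suc i}) ` ?I"
    proof (intro equalityI subsetI)
      fix S assume "S \<in> {S \<in> paths. a \<in> S}"
      then obtain i where "i < \<rho> - 1" "S = {i, Suc i}" "a = i \<or> a = Suc i" by (auto simp: paths_def)
      then show "S \<in> (\<lambda>i. {i, Suc i}) ` ?I" by auto
    next
      fix S assume "S \<in> (\<lambda>i. {i, Suc i}) ` ?I"
      then obtain i where "i \<in> ?I" "S = {i, Suc i}" by blast
      then show "S \<in> {S \<in> paths. a \<in> S}" using a by (auto simp: paths_def split: if_splits)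
    qed
    show "inj_on (\<lambda>i. {i, Suc i}) ?I" by (rule inj_onI) (auto simp: doubleton_eq_iff)
  qed
  then show ?thesis using a \<rho> w by auto
qed

lemma deg_chords: "j < N \<Longrightarrow> deg chords (\<rho> + j) = (if j + w < N then 1 else 0) + (if w \<le> j then 1 else 0)"
proof -
  assume j: "j < N"
  let ?I = "(if j + w < N then {j} else {}) \<union> (if w \<le> j then {j - w} else {})"
  have "deg chords (\<rho> + j) = card ?I"
  proof (rule deg_eqI)
    show "{S \<in> chords. \<rho> + j \<in> S} = (\<lambda>j. {\<rho> + j, \<rho> + j + w}) ` ?I"
    proof (intro equalityI subsetI)
      fix S assume "S \<in> {S \<in> chords. \<rho> + j \<in> S}"
      then obtain i where i: "i < N - w" "S = {\<rho> + i, \<rho> + i + w}" "\<rho> + j \<in> S" by (auto simp: chords_def)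
      then have "j = i \<or> j = i + w" by auto
      then have "i \<in> ?I" using i(1) by auto
      then show "S \<in> (\<lambda>j. {\<rho> + j, \<rho> + j + w}) ` ?I" using i(2) by blast
    next
      fix S assume "S \<in> (\<lambda>j. {\<rho> + j, \<rho> + j + w}) ` ?I"
      then obtain i where i: "i \<in> ?I" "S = {\<rho> + i, \<rho> + i + w}" by blast
      then have "i < N - w" using j by (auto split: if_splits)
      moreover have "\<rho> + j \<in> S" using i by (auto split: if_splits)
      ultimately show "S \<in> {S \<in> chords. \<rho> + j \<in> S}" using i(2) by (auto simp: chords_def)
    qed
    show "inj_on (\<lambda>j. {\<rho> + j, \<rho> + j + w}) ?I" by (rule inj_onI) (auto simp: doubleton_eq_iff)
  qed
  then show ?thesis using w by auto
qed

text \<open>By \<open>k dvd N\<close> the last block is complete, too.\<close>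

lemma deg_cliques: "j < N \<Longrightarrow> deg cliques (\<rho> + j) = k - 1"
proof -
  assume j: "j < N"
  let ?m = "j div k"
  let ?I = "{k * ?m..<k * ?m + k} - {j}"
  have blk: "i div k = ?m \<longleftrightarrow> i \<in> {k * ?m..<k * ?m + k}" for i
  proof -
    have "i div k = ?m \<longleftrightarrow> ?m \<le> i div k \<and> i div k < Suc ?m" by auto
    also have "\<dots> \<longleftrightarrow> ?m * k \<le> i \<and> i < Suc ?m * k"
      using k_pos by (simp add: less_eq_div_iff_mult_less_eq div_less_iff_less_mult)
    finally show ?thesis by (simp add: mult.commute add.commute)
  qed
  have top: "k * ?m + k \<le> N"
  proof -
    obtain d where d: "N = k * d" using k(3) by blast
    then have "?m < d" using j k_pos by (simp add: div_less_iff_less_mult mult.commute)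
    then have "k * Suc ?m \<le> k * d" by (intro mult_le_mono2) simp
    then show ?thesis using d by simp
  qed
  have "deg cliques (\<rho> + j) = card ?I"
  proof (rule deg_eqI)
    show "{S \<in> cliques. \<rho> + j \<in> S} = (\<lambda>i. {\<rho> + i, \<rho> + j}) ` ?I"
    proof (intro equalityI subsetI)
      fix S assume "S \<in> {S \<in> cliques. \<rho> + j \<in> S}"
      then obtain i i' where S: "S = {\<rho> + i, \<rho> + i'}" "i < i'" "i div k = i' div k" "j = i \<or> j = i'"
        by (auto simp: cliques_def)
      show "S \<in> (\<lambda>i. {\<rho> + i, \<rho> + j}) ` ?I"
      proof (cases "j = i")
        case True
        then have "i' \<in> ?I" using S blk[of i'] by auto
        then show ?thesis using S True by (auto simp: insert_commute)
      next
        case False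
        then have "j = i'" using S by blast
        then have "i \<in> ?I" using S blk[of i] by auto
        then show ?thesis using S \<open>j = i'\<close> by blast
      qed
    next
      fix S assume "S \<in> (\<lambda>i. {\<rho> + i, \<rho> + j}) ` ?I"
      then obtain i where i: "i \<in> ?I" "S = {\<rho> + i, \<rho> + j}" by blast
      then have "i div k = j div k" "i \<noteq> j" "i < N" using blk[of i] top by auto
      then show "S \<in> {S \<in> cliques. \<rho> + j \<in> S}"
      proof (cases "i < j")
        case True
        then show ?thesis using i(2) j \<open>i div k = j div k\<close> unfolding cliques_def by auto
      next
        case False
        then have "j < i" "S = {\<rho> + j, \<rho> + i}" using i(2) \<open>i \<noteq> j\<close> by auto
        then have "S \<in> cliques" using \<open>i < N\<close> \<open>i div k = j div k\<close> unfolding cliques_def by (intro CollectI exI[of _ j] exI[of _ i]) auto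
        then show ?thesis using i(2) by simp
      qed
    qed
    show "inj_on (\<lambda>i. {\<rho> + i, \<rho> + j}) ?I" by (rule inj_onI) (auto simp: doubleton_eq_iff)
  qed
  also have "\<dots> = k - 1" using blk[of j] by simp
  finally show ?thesis .
qed

lemma deg_triples: "deg triples a = (if a < w \<or> \<rho> - w \<le> a \<and> a < \<rho> + w then 1 else 0)"
proof -
  let ?I = "(if a < w then {a} else if \<rho> - w \<le> a \<and> a < \<rho> then {\<rho> - 1 - a} else if \<rho> \<le> a \<and> a < \<rho> + w then {a - \<rho>} else {})"
  have "deg triples a = card ?I"
  proof (rule deg_eqI)
    show "{S \<in> triples. a \<in> S} = (\<lambda>i. {i, \<rho> - 1 - i, \<rho> + i}) ` ?I"
    proof (intro equalityI subsetI)
      fix S assume "S \<in> {S \<in> triples. a \<in> S}"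
      then obtain i where i: "i < w" "S = {i, \<rho> - 1 - i, \<rho> + i}" "a \<in> S" by (auto simp: triples_def)
      then have "a = i \<or> a = \<rho> - 1 - i \<or> a = \<rho> + i" by auto
      then have "i \<in> ?I" using i(1) \<rho> by auto
      then show "S \<in> (\<lambda>i. {i, \<rho> - 1 - i, \<rho> + i}) ` ?I" using i(2) by blast
    next
      fix S assume "S \<in> (\<lambda>i. {i, \<rho> - 1 - i, \<rho> + i}) ` ?I"
      then obtain i where i: "i \<in> ?I" "S = {i, \<rho> - 1 - i, \<rho> + i}" by blast
      then have "i < w" "a = i \<or> a = \<rho> - 1 - i \<or> a = \<rho> + i" using \<rho> by (auto split: if_splits)
      then show "S \<in> {S \<in> triples. a \<in> S}" using i(2) by (auto simp: triples_def)
    qed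
  qed simp
  then show ?thesis using \<rho> by auto
qed

text \<open>For each index \<open>l\<close> exactly one of the two complementary segments contains
  \<open>a\<close>.\<close>

lemma deg_pre_suf: "a < \<rho> \<Longrightarrow> deg pre a + deg suf a = n1 - 3"
proof -
  assume a: "a < \<rho>"
  have "deg pre a = card {l. l < n1 - 3 \<and> a < 4 + l}"
    by (rule deg_eqI[where f = "\<lambda>l. {..<4 + l}"]) (auto simp: pre_def inj_on_def)
  moreover have "deg suf a = card {l. l < n1 - 3 \<and> \<not> a < 4 + l}"
  proof (rule deg_eqI[where f = "\<lambda>l. {4 + l..<\<rho>}"])
    show "{S \<in> suf. a \<in> S} = (\<lambda>l. {4 + l..<\<rho>}) ` {l. l < n1 - 3 \<and> \<not> a < 4 + l}"
      using a by (auto simp: suf_def)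
    show "inj_on (\<lambda>l. {4 + l..<\<rho>}) {l. l < n1 - 3 \<and> \<not> a < 4 + l}"
    proof (rule inj_onI)
      fix x y assume "x \<in> {l. l < n1 - 3 \<and> \<not> a < 4 + l}" "y \<in> {l. l < n1 - 3 \<and> \<not> a < 4 + l}"
        and eq: "{4 + x..<\<rho>} = {4 + y..<\<rho>}"
      then have "4 + x < \<rho>" "4 + y < \<rho>" using a by auto
      from atLeastLessThan_inj(1)[OF eq this] show "x = y" by simp
    qed
  qed
  moreover have "card {l. l < n1 - 3 \<and> a < 4 + l} + card {l. l < n1 - 3 \<and> \<not> a < 4 + l} = card {..<n1 - 3}"
  proof -
    have "{l. l < n1 - 3 \<and> a < 4 + l} \<union> {l. l < n1 - 3 \<and> \<not> a < 4 + l} = {..<n1 - 3}" by auto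
    moreover have "card ({l. l < n1 - 3 \<and> a < 4 + l} \<union> {l. l < n1 - 3 \<and> \<not> a < 4 + l}) =
        card {l. l < n1 - 3 \<and> a < 4 + l} + card {l. l < n1 - 3 \<and> \<not> a < 4 + l}"
      by (rule card_Un_disjoint) auto
    ultimately show ?thesis by simp
  qed
  ultimately show ?thesis by simp
qed

text \<open>The missing incidence at 0 is left for the class \<open>({0}, {})\<close>, which marks
  the start of the growth.\<close>

lemma deg_region:
  assumes a: "a < \<rho>"
  shows "deg system a = (if a = 0 then n1 - 1 else n1)"
proof -
  have "deg chords a = 0" "deg cliques a = 0"
    using a chords_sub cliques_sub by (fastforce intro!: deg_0)+
  moreover have "a \<in> closing \<longleftrightarrow> w \<le> a \<and> a < \<rho> - w \<or> a = \<rho> - 1" using a N by (auto simp: closing_def)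
  ultimately have deg: "deg system a = (if a = 0 \<or> a = \<rho> - 1 then 1 else 2) +
      (if a < w \<or> \<rho> - w \<le> a \<and> a < \<rho> + w then 1 else 0) + (n1 - 3) +
      (if w \<le> a \<and> a < \<rho> - w \<or> a = \<rho> - 1 then 1 else 0)"
    using deg_system[of a] deg_paths[OF a] deg_triples[of a] deg_pre_suf[OF a] by simp
  consider "a = 0" | "0 < a" "a < w" | "w \<le> a" "a < \<rho> - w" | "\<rho> - w \<le> a" "a < \<rho> - 1" | "a = \<rho> - 1"
    using a by linarith
  moreover have "\<not> \<rho> - 1 < w" "\<rho> - w \<le> \<rho> - 1" using \<rho> w by linarith+
  ultimately show ?thesis by cases (use deg \<rho> w n1 a in simp_all)
qed

lemma deg_bulk:
  assumes j: "j < N"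
  shows "deg system (\<rho> + j) = n1 - q"
proof -
  have "deg paths (\<rho> + j) = 0" "deg pre (\<rho> + j) = 0" "deg suf (\<rho> + j) = 0"
    using paths_sub pre_sub suf_sub by (fastforce intro!: deg_0)+
  moreover have "\<rho> + j \<in> closing \<longleftrightarrow> N \<le> j + w" using j \<rho> N by (auto simp: closing_def)
  ultimately show ?thesis
    using deg_system[of "\<rho> + j"] deg_chords[OF j] deg_cliques[OF j] deg_triples[of "\<rho> + j"] j \<rho> w k n1 k_pos by auto
qed

text \<open>Chords and cliques use up all bulk incidences of the system in pairs, apart from at most
  \<open>2 * w\<close>. Such pairs are the cheapest members of \<open>system\<close> that can carry
  the colour \<open>B\<close>.\<close>

lemma card_system_ge: "N * (n1 - q) \<le> 2 * card system + 2 * w"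
proof -
  have "card chords = N - w"
    unfolding chords_def by (subst card_image) (auto simp: inj_on_def doubleton_eq_iff)
  moreover have "2 * card cliques = N * (k - 1)"
  proof -
    have "2 * card cliques = (\<Sum>S\<in>cliques. card S)" using card_cliques by simp
    also have "\<dots> = (\<Sum>S\<in>cliques. \<Sum>j<N. if \<rho> + j \<in> S then 1 else 0)"
    proof (rule sum.cong)
      fix S assume S: "S \<in> cliques"
      have eq: "S = (\<lambda>j. \<rho> + j) ` {j. j < N \<and> \<rho> + j \<in> S}"
      proof (intro equalityI subsetI)
        fix x assume "x \<in> S"
        moreover from this have "\<rho> \<le> x" "x < \<rho> + N" using cliques_sub[OF S] by auto
        ultimately show "x \<in> (\<lambda>j. \<rho> + j) ` {j. j < N \<and> \<rho> + j \<in> S}" by (intro image_eqI[of _ _ "x - \<rho>"]) auto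
      qed auto
      have "card ((\<lambda>j. \<rho> + j) ` {j. j < N \<and> \<rho> + j \<in> S}) = card {j. j < N \<and> \<rho> + j \<in> S}"
        by (rule card_image) (simp add: inj_on_def)
      with arg_cong[OF eq, of card] have "card S = card {j. j < N \<and> \<rho> + j \<in> S}" by (rule trans)
      also have "{j. j < N \<and> \<rho> + j \<in> S} = {..<N} \<inter> {j. \<rho> + j \<in> S}" by auto
      finally show "card S = (\<Sum>j<N. if \<rho> + j \<in> S then 1 else 0)" by (simp add: sum.If_cases)
    qed simp
    also have "\<dots> = (\<Sum>j<N. \<Sum>S\<in>cliques. if \<rho> + j \<in> S then 1 else 0)" by (rule sum.swap)
    also have "\<dots> = (\<Sum>j<N. k - 1)"
    proof (rule sum.cong)
      fix j assume "j \<in> {..<N}"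
      then have "deg cliques (\<rho> + j) = k - 1" using deg_cliques by simp
      moreover have "cliques \<inter> {S. \<rho> + j \<in> S} = {S \<in> cliques. \<rho> + j \<in> S}" by blast
      ultimately show "(\<Sum>S\<in>cliques. if \<rho> + j \<in> S then 1 else 0) = k - 1"
        using fin_parts(3) by (simp add: sum.If_cases deg_def)
    qed simp
    finally show ?thesis by simp
  qed
  moreover have "card chords + card cliques \<le> card system"
  proof -
    have "card chords + card cliques = card (chords \<union> cliques)"
      using fin_parts chord_not_clique by (simp add: card_Un_disjoint)
    also have "\<dots> \<le> card system"
      using finite_subset[OF system_sub] by (intro card_mono) (auto simp: system_def pairs_def)
    finally show ?thesis .
  qed
  moreover have "N * (n1 - q) = N * (k - 1) + 2 * N"
  proof -
    have "n1 - q = (k - 1) + 2" using k k_pos n1 by auto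
    then show ?thesis by (simp add: algebra_simps)
  qed
  ultimately show ?thesis using N by linarith
qed

text \<open>Cliques reach less than \<open>k \<le> w\<close> ahead, so a pair through a bulk point
  \<open>v\<close> never passes the chord partner \<open>v + w\<close>. This is what
  \<open>growth_sets\<close> asks for.\<close>

lemma pairs_below:
  assumes S: "S \<in> system" "card S = 2" "v \<in> S"
  shows "v < \<rho> \<Longrightarrow> S \<subseteq> {..Suc v}" "\<rho> \<le> v \<Longrightarrow> S \<subseteq> {..v + w}"
proof -
  have P: "S \<in> pairs" using S card_larges by (fastforce simp: system_def)
  show "S \<subseteq> {..Suc v}" if "v < \<rho>"
  proof -
    have "S \<notin> chords" "S \<notin> cliques" using chords_sub[of S v] cliques_sub[of S v] S(3) that by auto
    then have "S \<in> paths" using P by (auto simp: pairs_def)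
    then show ?thesis using S(3) by (auto simp: paths_def)
  qed
  show "S \<subseteq> {..v + w}" if "\<rho> \<le> v"
  proof -
    have "S \<notin> paths" using paths_sub[of S v] S(3) that by auto
    then consider "S \<in> chords" | "S \<in> cliques" using P by (auto simp: pairs_def)
    then show ?thesis
    proof cases
      case 1
      then show ?thesis using S(3) by (auto simp: chords_def)
    next
      case 2
      then obtain i j where ij: "S = {\<rho> + i, \<rho> + j}" "i < j" "i div k = j div k" by (auto simp: cliques_def)
      have "j < i + k"
      proof (rule ccontr)
        assume "\<not> j < i + k"
        then have "(i + k) div k \<le> j div k" by (intro div_le_mono) simp
        then show False using ij(3) k_pos by simp
      qed
      then have "j \<le> i + w" using k_w by simp
      then show ?thesis using S(3) ij by auto
    qed
  qed
qed

text \<open>The bound \<open>2 * w + 1 \<le> \<rho>\<close> keeps the three ranges of points in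
  \<open>triples\<close> disjoint, so a point below \<open>w\<close> determines its triple.\<close>

lemma triples_below:
  assumes S: "S \<in> system" "card S = 3" "v \<in> S" "v < w"
  shows "S \<subseteq> {..\<rho> + v}"
proof -
  have "S \<in> triples" using S card_larges card_pairs by (fastforce simp: system_def)
  then obtain i where i: "i < w" "S = {i, \<rho> - 1 - i, \<rho> + i}" by (auto simp: triples_def)
  then have "v = i" using S(3,4) \<rho> by auto
  then show ?thesis using i by auto
qed

lemma system_rigid:
  assumes perm: "inj \<pi>" and img: "\<And>S. S \<in> system \<Longrightarrow> \<pi> ` S \<in> system" and root: "\<pi> 0 = 0"
    and a: "a < \<rho> + N"
  shows "\<pi> a = a"
proof (rule growth_sets[of \<pi> system 1 "\<rho> + N" a])
  show "\<pi> t = t" if "t < 1" for t using that root by simp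
next
  fix t assume t: "1 \<le> t" "t < \<rho> + N"
  consider "t < \<rho>" | "\<rho> \<le> t" "t < \<rho> + w" | "\<rho> + w \<le> t" by linarith
  then show "\<exists>v<t. \<exists>S\<in>system. v \<in> S \<and> t \<in> S \<and> (\<forall>S'\<in>system. v \<in> S' \<and> card S' = card S \<longrightarrow> S' \<subseteq> {..t})"
  proof cases
    case 1
    have "{t - 1, t} \<in> system"
    proof -
      have "{t - 1, t} = {t - 1, Suc (t - 1)}" using t by simp
      then have "{t - 1, t} \<in> paths" using t 1 unfolding paths_def by (intro image_eqI[of _ _ "t - 1"]) auto
      then show ?thesis by (simp add: system_def pairs_def)
    qed
    moreover have "S' \<subseteq> {..t}" if "S' \<in> system" "t - 1 \<in> S'" "card S' = card {t - 1, t}" for S'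
      using pairs_below(1)[OF that(1) _ that(2)] that(3) t 1 by simp
    ultimately show ?thesis using t by (intro exI[of _ "t - 1"] conjI bexI[of _ "{t - 1, t}"]) auto
  next
    case 2
    let ?i = "t - \<rho>" let ?S = "{?i, \<rho> - 1 - ?i, \<rho> + ?i}"
    have i: "?i < w" "\<rho> + ?i = t" using 2 by auto
    then have "?S \<in> system" unfolding system_def larges_def triples_def by blast
    moreover have "S' \<subseteq> {..t}" if "S' \<in> system" "?i \<in> S'" "card S' = card ?S" for S'
      using triples_below[OF that(1) _ that(2) i(1)] that(3) card_triple[OF i(1)] i(2) by simp
    moreover have "?i < t" using 2 \<rho> w by simp
    ultimately show ?thesis using i(2) by (intro exI[of _ ?i] conjI bexI[of _ ?S]) auto
  next
    case 3
    let ?v = "t - w"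
    have "{?v, t} \<in> chords" unfolding chords_def
    proof (rule image_eqI[of _ _ "t - w - \<rho>"])
      show "{?v, t} = {\<rho> + (t - w - \<rho>), \<rho> + (t - w - \<rho>) + w}" using 3 by simp
    qed (use 3 t in auto)
    then have "{?v, t} \<in> system" by (simp add: system_def pairs_def)
    moreover have "S' \<subseteq> {..t}" if "S' \<in> system" "?v \<in> S'" "card S' = card {?v, t}" for S'
    proof -
      have "card {?v, t} = 2" using 3 w by simp
      then show ?thesis using pairs_below(2)[OF that(1) _ that(2)] that(3) 3 by simp
    qed
    moreover have "?v < t" using 3 w by simp
    ultimately show ?thesis by (intro exI[of _ ?v] conjI bexI[of _ "{?v, t}"]) auto
  qed
qed (use a perm img in simp_all)

end

text \<open>An exactly balanced matrix gives every bulk point \<open>q\<close> coloured singletons.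
  Besides these, each \<open>b\<close> lies in the colours of \<open>p\<close> members coloured by
  all of \<open>B\<close> and of one member of its own.\<close>

lemma explicit_ge3:
  fixes B :: "'b set" and s :: "'b set \<Rightarrow> nat"
  assumes n1: "3 \<le> n1" and q: "q \<le> n1 - 2" "n1 - q - 1 dvd N"
    and w: "4 \<le> w" "n1 \<le> w" and \<rho>: "2 * w + 1 \<le> \<rho>" and N: "2 * w \<le> N"
    and B: "finite B" and s: "s {} = 0" "\<And>T. T \<subseteq> B \<Longrightarrow> s T \<le> N" "(\<Sum>T\<in>Pow B. s T) = N * q"
    and p: "2 * p + 2 * card B + 2 * w \<le> N * (n1 - q)"
    and n2: "\<And>b. b \<in> B \<Longrightarrow> (\<Sum>T\<in>{T \<in> Pow B. b \<in> T}. s T) + p + 1 = n2"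
  shows "\<exists>F. realizes {..<\<rho> + N} B n1 n2 F"
proof -
  let ?k = "n1 - q - 1"
  note ctx = n1 refl q w \<rho> N
  let ?N = "system n1 w \<rho> N ?k"
  obtain col where col: "columns {..<N} (Pow B) s col" "balanced {..<N} (Pow B) col"
    using ex_balanced[of "{..<N}" "Pow B" s] B s(2) by auto
  have rows: "card (row (Pow B) col j) = q" if "j < N" for j
    by (rule balanced_rows_const[OF _ _ col]) (use B s(3) that in auto)
  have colN: "col T \<subseteq> {..<N}" "card (col T) = s T" if "T \<in> Pow B" for T using col(1) that by (auto simp: columns_def)
  have col0: "col {} = {}"
    using colN[of "{}"] s(1) by (metis Pow_bottom card_0_eq finite_lessThan finite_subset)
  let ?R = "SIGMA T:Pow B. col T"
  let ?g = "\<lambda>x. (\<rho> + snd x, fst x)"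
  let ?Sg = "insert (0, {}) (?g ` ?R)"
  have \<rho>0: "0 < \<rho>" using \<rho> by simp
  show ?thesis
  proof (rule realizes_of_rigid_sets[of _ _ ?N ?Sg])
    show "?N \<subseteq> Pow {..<\<rho> + N}" by (rule system_sub[OF ctx])
    show "2 \<le> card S" if "S \<in> ?N" for S by (rule card_system[OF ctx that])
    show "?Sg \<subseteq> {..<\<rho> + N} \<times> Pow B"
    proof
      fix x assume "x \<in> ?Sg"
      then consider "x = (0, {})" | T j where "T \<in> Pow B" "j \<in> col T" "x = (\<rho> + j, T)" by auto
      then show "x \<in> {..<\<rho> + N} \<times> Pow B" using colN(1) \<rho>0 by cases auto
    qed
    show "p + card B \<le> card ?N" using card_system_ge[OF ctx] p by linarith
  next
    fix b assume b: "b \<in> B"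
    have "{x \<in> ?Sg. b \<in> snd x} = ?g ` (SIGMA T:{T \<in> Pow B. b \<in> T}. col T)" by auto
    also have "card \<dots> = card (SIGMA T:{T \<in> Pow B. b \<in> T}. col T)"
      by (rule card_image) (auto simp: inj_on_def)
    also have "\<dots> = (\<Sum>T\<in>{T \<in> Pow B. b \<in> T}. card (col T))"
      by (rule card_SigmaI) (use B colN(1) in \<open>auto intro: finite_subset\<close>)
    also have "\<dots> = (\<Sum>T\<in>{T \<in> Pow B. b \<in> T}. s T)" by (rule sum.cong) (use colN(2) in auto)
    finally show "card {x \<in> ?Sg. b \<in> snd x} + p + 1 = n2" using n2[OF b] by simp
  next
    fix a assume a: "a \<in> {..<\<rho> + N}"
    show "card {T. (a, T) \<in> ?Sg} + deg ?N a = n1"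
    proof (cases "a < \<rho>")
      case True
      then have "{T. (a, T) \<in> ?Sg} = (if a = 0 then {{}} else {})" by auto
      then show ?thesis using deg_region[OF ctx True] n1 by simp
    next
      case False
      then obtain j where j: "a = \<rho> + j" "j < N" using a by (metis add_less_cancel_left le_Suc_ex lessThan_iff not_less)
      have "{T. (a, T) \<in> ?Sg} = row (Pow B) col j"
      proof (intro equalityI subsetI)
        fix T assume "T \<in> row (Pow B) col j"
        then have "(T, j) \<in> ?R" by (simp add: row_def)
        then have "?g (T, j) \<in> ?g ` ?R" by (rule imageI)
        then show "T \<in> {T. (a, T) \<in> ?Sg}" using j by simp
      qed (use j \<rho>0 in \<open>auto simp: row_def\<close>)
      then show ?thesis using deg_bulk[OF ctx j(2)] rows[OF j(2)] j(1) q(1) n1 by simp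
    qed
  next
    fix \<pi> a assume perm: "\<pi> permutes {..<\<rho> + N}" and sg: "\<And>a. (a, {}) \<in> ?Sg \<Longrightarrow> (\<pi> a, {}) \<in> ?Sg"
      and img: "\<And>S. S \<in> ?N \<Longrightarrow> \<pi> ` S \<in> ?N" and a: "a \<in> {..<\<rho> + N}"
    have mem: "(\<pi> 0, {}) \<in> ?Sg" by (rule sg) (rule insertI1)
    \<comment> \<open>By \<open>s {} = 0\<close> no bulk point carries the empty colour, so 0 is the
      only point with this mark.\<close>
    have nmem: "(\<pi> 0, {}) \<notin> ?g ` ?R"
    proof
      assume "(\<pi> 0, {}) \<in> ?g ` ?R"
      then obtain x where x: "(\<pi> 0, {}) = ?g x" "x \<in> ?R" by (rule imageE)
      obtain T j where Tj: "x = (T, j)" by (rule prod.exhaust)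
      then have "T = {}" using x(1) by simp
      then show False using x(2) Tj col0 by simp
    qed
    have \<pi>0: "\<pi> 0 = 0" using mem
    proof (rule insertE)
      assume "(\<pi> 0, {} :: 'b set) = (0, {})"
      then show ?thesis by simp
    next
      assume "(\<pi> 0, {}) \<in> ?g ` ?R"
      with nmem show ?thesis by (rule notE)
    qed
    show "\<pi> a = a"
    proof (rule system_rigid[OF ctx permutes_inj[OF perm] _ \<pi>0])
      show "\<pi> ` S \<in> ?N" if "S \<in> ?N" for S by (rule img[OF that])
    qed (use a in simp)
  qed (use B in auto)
qed

section \<open>The range of values covered by the construction\<close>

lemma sum_Pow_card:
  fixes f :: "nat \<Rightarrow> 'c :: comm_semiring_1"
  assumes "finite B"
  shows "(\<Sum>T\<in>Pow B. f (card T)) = (\<Sum>i\<le>card B. of_nat (card B choose i) * f i)"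
proof -
  have "(\<Sum>T\<in>Pow B. f (card T)) = (\<Sum>i\<in>{..card B}. \<Sum>T\<in>{T \<in> Pow B. card T = i}. f (card T))"
    by (rule sum.group[symmetric]) (use assms in \<open>auto intro: card_mono\<close>)
  also have "\<dots> = (\<Sum>i\<le>card B. of_nat (card B choose i) * f i)"
  proof (rule sum.cong)
    fix i
    have "(\<Sum>T\<in>{T \<in> Pow B. card T = i}. f (card T)) = (\<Sum>T\<in>{T \<in> Pow B. card T = i}. f i)"
      by (rule sum.cong) auto
    also have "\<dots> = of_nat (card {T. T \<subseteq> B \<and> card T = i}) * f i" by simp
    finally show "(\<Sum>T\<in>{T \<in> Pow B. card T = i}. f (card T)) = of_nat (card B choose i) * f i"
      using n_subsets[OF assms] by simp
  qed simp
  finally show ?thesis .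
qed

lemma sum_Pow_containing:
  fixes f :: "nat \<Rightarrow> 'c :: comm_semiring_1"
  assumes "finite B" "b \<in> B"
  shows "(\<Sum>T\<in>{T \<in> Pow B. b \<in> T}. f (card T)) = (\<Sum>i\<le>card B - 1. of_nat ((card B - 1) choose i) * f (Suc i))"
proof -
  have "{T \<in> Pow B. b \<in> T} = insert b ` Pow (B - {b})"
  proof (intro equalityI subsetI)
    fix T assume "T \<in> {T \<in> Pow B. b \<in> T}"
    then have "T = insert b (T - {b})" "T - {b} \<in> Pow (B - {b})" by auto
    then show "T \<in> insert b ` Pow (B - {b})" by (rule image_eqI)
  qed (use assms(2) in auto)
  moreover have "inj_on (insert b) (Pow (B - {b}))" by (rule inj_onI) blast
  ultimately have "(\<Sum>T\<in>{T \<in> Pow B. b \<in> T}. f (card T)) = (\<Sum>T\<in>Pow (B - {b}). f (card (insert b T)))"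
    by (simp add: sum.reindex)
  also have "\<dots> = (\<Sum>T\<in>Pow (B - {b}). f (Suc (card T)))"
  proof (rule sum.cong)
    fix T assume "T \<in> Pow (B - {b})"
    then have "finite T" "b \<notin> T" using assms(1) finite_subset by auto
    then show "f (card (insert b T)) = f (Suc (card T))" by simp
  qed simp
  also have "\<dots> = (\<Sum>i\<le>card (B - {b}). of_nat (card (B - {b}) choose i) * f (Suc i))"
    by (rule sum_Pow_card) (use assms(1) in simp)
  finally show ?thesis using assms by simp
qed

text \<open>At full scale, \<open>v i / L0\<close> is the fraction of bulk points that carry a
  singleton class of a given colour with \<open>i\<close> elements, and \<open>V / L0\<close> is the
  resulting degree of one \<open>b\<close> per bulk point. Smaller \<open>n2\<close> are reached by
  scaling with \<open>q' \<le> q\<close> and covering the rest by members of colour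
  \<open>B\<close>.\<close>

lemma explicit_range_ge3:
  fixes v :: "nat \<Rightarrow> nat" and m2 :: nat
  defines "V \<equiv> \<Sum>i\<le>m2 - 1. ((m2 - 1) choose i) * v (Suc i)"
  assumes n1: "3 \<le> n1" and m2: "1 \<le> m2" and L0: "0 < L0" and q: "1 \<le> q" "q \<le> n1 - 2"
    and v: "v 0 = 0" "\<And>i. v i \<le> L0" "(\<Sum>i\<le>m2. (m2 choose i) * v i) = L0 * q"
  shows "\<exists>C m0. \<forall>m1\<ge>m0. \<forall>B :: 'b set. \<forall>n2\<ge>1. finite B \<longrightarrow> card B = m2 \<longrightarrow>
    real n2 \<le> (real V / real L0 + real (n1 - q) / 2) * real m1 - C \<longrightarrow> (\<exists>F. realizes {..<m1} B n1 n2 F)"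
proof -
  define w where "w = n1 + 4"
  \<comment> \<open>The factor \<open>fact n1\<close> makes \<open>N\<close> divisible by
    \<open>n1 - q' - 1\<close> for every \<open>q'\<close> that may occur.\<close>
  define L where "L = L0 * q * fact n1"
  define r where "r = real V / real L0 + real (n1 - q) / 2"
  define C where "C = r * real (2 * w + 1 + L) + real m2 + real w"
  define m0 where "m0 = 2 * w + 1 + L + (2 * m2 + 2 * w)"
  have r0: "0 \<le> r" by (simp add: r_def)
  have L_pos: "0 < L" using L0 q by (simp add: L_def)
  have "\<exists>F. realizes {..<m1} B n1 n2 F"
    if m1: "m0 \<le> m1" and B: "finite B" "card B = m2" and n2: "1 \<le> n2" "real n2 \<le> r * real m1 - C"
    for m1 n2 and B :: "'b set"
  proof -
    \<comment> \<open>The region absorbs the remainder modulo \<open>L\<close>, so that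
      \<open>L dvd N\<close> while \<open>\<rho>\<close> stays bounded.\<close>
    define \<rho> where "\<rho> = 2 * w + 1 + (m1 - (2 * w + 1)) mod L"
    define N where "N = m1 - \<rho>"
    have \<rho>_le: "\<rho> < 2 * w + 1 + L" using L_pos by (simp add: \<rho>_def)
    then have m1_eq: "m1 = \<rho> + N" and N_ge: "2 * m2 + 2 * w \<le> N" using m1 by (auto simp: N_def m0_def)
    have "N = (m1 - (2 * w + 1)) - (m1 - (2 * w + 1)) mod L" by (simp add: N_def \<rho>_def)
    then have LN: "L dvd N" by (simp only: dvd_minus_mod)
    define t where "t = N div (L0 * q)"
    have "L0 * q dvd N" using LN by (metis L_def dvd_mult_left)
    then have Nt: "N = t * (L0 * q)" by (simp add: t_def)
    have build: "\<exists>F. realizes {..<m1} B n1 n2 F"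
      if q': "q' \<le> q" and p: "n2 = t * q' * V + p + 1" "2 * p + 2 * m2 + 2 * w \<le> N * (n1 - q')" for q' p
    proof -
      let ?s = "\<lambda>T :: 'b set. t * q' * v (card T)"
      have "n1 - q' - 1 dvd fact n1" using q q' n1 by (intro dvd_fact) auto
      then have dvd: "n1 - q' - 1 dvd N" using LN unfolding L_def by (meson dvd_mult dvd_trans)
      show ?thesis unfolding m1_eq
      proof (rule explicit_ge3[OF n1 _ dvd, where w = w and s = ?s and p = p])
        show "?s T \<le> N" for T
        proof -
          have "t * q' * v (card T) \<le> t * q * L0" using v(2) q' by (intro mult_le_mono) auto
          then show ?thesis using Nt by (simp add: mult.commute mult.left_commute)
        qed
        show "(\<Sum>T\<in>Pow B. ?s T) = N * q'"
        proof -
          have "(\<Sum>T\<in>Pow B. ?s T) = t * q' * (\<Sum>T\<in>Pow B. v (card T))" by (simp add: sum_distrib_left)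
          also have "(\<Sum>T\<in>Pow B. v (card T)) = L0 * q" using sum_Pow_card[OF B(1), of v] v(3) B(2) by simp
          finally show ?thesis using Nt by (simp add: mult.commute mult.left_commute)
        qed
        show "(\<Sum>T\<in>{T \<in> Pow B. b \<in> T}. ?s T) + p + 1 = n2" if "b \<in> B" for b
        proof -
          have "(\<Sum>T\<in>{T \<in> Pow B. b \<in> T}. ?s T) = t * q' * (\<Sum>T\<in>{T \<in> Pow B. b \<in> T}. v (card T))"
            by (simp only: sum_distrib_left)
          also have "(\<Sum>T\<in>{T \<in> Pow B. b \<in> T}. v (card T)) = V"
            using sum_Pow_containing[OF B(1) that, of v] B(2) by (simp add: V_def)
          finally show ?thesis using p(1) by simp
        qed
      qed (use q q' n1 v(1) B p(2) N_ge in \<open>auto simp: w_def \<rho>_def\<close>)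
    qed
    have V_le: "V \<le> L0 * q"
    proof (cases "\<exists>b. b \<in> B")
      case True
      then obtain b where b: "b \<in> B" by blast
      have "V = (\<Sum>T\<in>{T \<in> Pow B. b \<in> T}. v (card T))"
        using sum_Pow_containing[OF B(1) b, of v] B(2) by (simp add: V_def)
      also have "\<dots> \<le> (\<Sum>T\<in>Pow B. v (card T))" by (rule sum_mono2) (use B(1) in auto)
      also have "\<dots> = L0 * q" using sum_Pow_card[OF B(1), of v] v(3) B(2) by simp
      finally show ?thesis .
    next
      case False
      then have "card B = 0" by auto
      then show ?thesis using B(2) m2 by simp
    qed
    \<comment> \<open>Take the largest scaling whose singletons do not exceed \<open>n2 - 1\<close>;
      one incidence is reserved for the member owned by each \<open>b\<close>.\<close>
    let ?P = "\<lambda>x. x \<le> q \<and> t * x * V \<le> n2 - 1"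
    have "?P 0" by simp
    moreover have "\<forall>x. ?P x \<longrightarrow> x < Suc q" by simp
    ultimately obtain q' where q': "?P q'" and max: "\<And>x. ?P x \<Longrightarrow> x \<le> q'"
      using ex_has_greatest_nat[of ?P 0 "\<lambda>x. x" "Suc q"] by blast
    define p where "p = n2 - 1 - t * q' * V"
    have p: "n2 = t * q' * V + p + 1" unfolding p_def using q' n2(1) by linarith
    have "2 * p + 2 * m2 + 2 * w \<le> N * (n1 - q')"
    proof (cases "q' < q")
      case True
      \<comment> \<open>By maximality the rest \<open>p\<close> is less than
        \<open>t * V \<le> N\<close>, and \<open>n1 - q' \<ge> 3\<close> leaves enough room for
        it.\<close>
      then have "\<not> ?P (Suc q')" using max[of "Suc q'"] by auto
      then have "n2 - 1 < t * Suc q' * V" using True by simp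
      then have "p < t * V" using p by (simp add: algebra_simps)
      also have "t * V \<le> N" unfolding Nt using V_le by (rule mult_le_mono2)
      finally have "2 * p + 2 * m2 + 2 * w \<le> N * 3" using N_ge by linarith
      also have "\<dots> \<le> N * (n1 - q')" using True q by (intro mult_le_mono2) linarith
      finally show ?thesis .
    next
      case False
      then have [simp]: "q' = q" using q' by simp
      have "real n2 \<le> r * real N - real m2 - real w"
      proof -
        have "r * real m1 = r * real \<rho> + r * real N" unfolding m1_eq by (simp add: algebra_simps)
        moreover have "r * real \<rho> \<le> r * real (2 * w + 1 + L)"
          using \<rho>_le r0 by (intro mult_left_mono) auto
        ultimately show ?thesis using n2(2) by (simp add: C_def)
      qed
      moreover have "r * real N = real (t * q * V) + real N * real (n1 - q) / 2"
        using L0 unfolding r_def Nt by (simp add: field_simps)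
      moreover have "real n2 = real (t * q * V) + real p + 1" using p by simp
      ultimately have "2 * real p + 2 * real m2 + 2 * real w \<le> real N * real (n1 - q)" by linarith
      then have "real (2 * p + 2 * m2 + 2 * w) \<le> real (N * (n1 - q))" by simp
      then show ?thesis by (simp only: of_nat_le_iff \<open>q' = q\<close>)
    qed
    with q' p show ?thesis by (intro build) auto
  qed
  then show ?thesis unfolding r_def by blast
qed

text \<open>Supplies the case \<open>n2 = n1\<close>, where all parts together form
  \<open>A\<close>: the construction is run with \<open>q = 0\<close> and without colours.\<close>

lemma regular_family:
  assumes "2 \<le> n1"
  shows "\<exists>m0 :: nat. \<forall>M\<ge>m0. \<exists>F. realizes {..<M} ({} :: nat set) n1 n2 F"
proof (cases "n1 = 2")
  case True
  have "\<exists>F. realizes {..<M} ({} :: nat set) n1 n2 F" if M: "6 \<le> M" for M :: nat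
  proof -
    obtain F where "realizes {..<M} ({} :: nat set) 2 (0 + 1) F"
      using spider[where B = "{} :: nat set" and M = M and p = 0] M by auto
    then have "realizes {..<M} ({} :: nat set) n1 n2 F" using True by (simp add: realizes_def)
    then show ?thesis by blast
  qed
  then show ?thesis by blast
next
  case False
  then have n1: "3 \<le> n1" using assms by simp
  define w where "w = n1 + 4"
  have "\<exists>F. realizes {..<M} ({} :: nat set) n1 n2 F" if M: "2 * w + 1 + (n1 - 1) + 2 * w \<le> M" for M :: nat
  proof -
    define \<rho> where "\<rho> = 2 * w + 1 + (M - (2 * w + 1)) mod (n1 - 1)"
    define N where "N = M - \<rho>"
    have "(M - (2 * w + 1)) mod (n1 - 1) < n1 - 1" using n1 by (intro mod_less_divisor) simp
    then have "\<rho> < 2 * w + 1 + (n1 - 1)" unfolding \<rho>_def by linarith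
    then have M_eq: "M = \<rho> + N" and N_ge: "2 * w \<le> N" using M by (auto simp: N_def)
    have "N = (M - (2 * w + 1)) - (M - (2 * w + 1)) mod (n1 - 1)" by (simp add: N_def \<rho>_def)
    then have dvd: "n1 - 0 - 1 dvd N" by (simp only: dvd_minus_mod diff_zero)
    show ?thesis unfolding M_eq
    proof (rule explicit_ge3[OF n1 _ dvd, where w = w and s = "\<lambda>_. 0" and p = 0])
      have "2 * w \<le> N * 1" using N_ge by simp
      also have "\<dots> \<le> N * (n1 - 0)" using n1 by (intro mult_le_mono2) simp
      finally show "2 * 0 + 2 * card {} + 2 * w \<le> N * (n1 - 0)" by simp
    qed (use N_ge in \<open>auto simp: w_def \<rho>_def\<close>)
  qed
  then show ?thesis by blast
qed

section \<open>The constant as the value of a linear program\<close>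

lemma sum_choose_rev:
  fixes f :: "nat \<Rightarrow> 'c :: comm_semiring_1"
  shows "(\<Sum>i\<le>m. of_nat (m choose i) * f i) = (\<Sum>i\<le>m. of_nat (m choose i) * f (m - i))"
  by (rule sum.reindex_bij_witness[of _ "\<lambda>i. m - i" "\<lambda>i. m - i"]) (auto simp: binomial_symmetric[symmetric])

text \<open>Double counting of the incidences between colours and elements, by
  \<open>i * (m choose i) = m * ((m - 1) choose (i - 1))\<close>.\<close>

lemma sum_choose_absorb:
  fixes v :: "nat \<Rightarrow> nat"
  assumes "1 \<le> m"
  shows "(\<Sum>i\<le>m. (m choose i) * (i * v i)) = m * (\<Sum>i\<le>m - 1. ((m - 1) choose i) * v (Suc i))"
proof -
  obtain n where m: "m = Suc n" using assms by (cases m) auto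
  have "(\<Sum>i\<le>m. (m choose i) * (i * v i)) = (\<Sum>i\<le>n. (m choose Suc i) * (Suc i * v (Suc i)))"
    unfolding m by (subst sum.atMost_Suc_shift) simp
  also have "\<dots> = (\<Sum>i\<le>n. m * ((n choose i) * v (Suc i)))"
  proof (rule sum.cong)
    fix i
    have "Suc i * (m choose Suc i) = m * (n choose i)" using binomial_absorption[of i m] m by simp
    then show "(m choose Suc i) * (Suc i * v (Suc i)) = m * ((n choose i) * v (Suc i))"
      by (metis mult.assoc mult.commute)
  qed simp
  finally show ?thesis using m by (simp add: sum_distrib_left)
qed

context
  fixes n1 m2 j k :: nat
  assumes n1: "3 \<le> n1" and m2: "1 \<le> m2" and jk: "jk_decomposition n1 m2 j k"
begin

text \<open>Counts the colours with at least \<open>m2 - j\<close> elements; by symmetry of the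
  binomial coefficients the layers are numbered from the top.\<close>

definition "layer_count = (\<Sum>i=0..j. m2 choose i)"
text \<open>Total size of the colours counted by \<open>layer_count\<close>.\<close>

definition "layer_weight = (\<Sum>i=0..j. real (m2 choose i) * real (m2 - i))"

lemma j_le: "2 * j + 1 \<le> m2" and j_mid: "j = (m2 - 1) div 2 \<Longrightarrow> m2 \<le> 2 * j + 2"
proof -
  have "j \<le> (m2 - 1) div 2" using jk by (auto simp: jk_decomposition_def)
  then show "2 * j + 1 \<le> m2" using m2 by linarith
  show "m2 \<le> 2 * j + 2" if "j = (m2 - 1) div 2" using that by linarith
qed

lemma n1_eq: "n1 = 2 + layer_count + k"
  using jk by (simp add: jk_decomposition_def layer_count_def)

lemma S_pos: "1 \<le> layer_count"
proof -
  have "(m2 choose 0) \<le> layer_count" unfolding layer_count_def by (rule member_le_sum) auto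
  then show ?thesis by simp
qed

lemma r_const_eq:
  "r_const n1 m2 = 1 + layer_weight / real m2 + (if j < (m2 - 1) div 2 then (real m2 - real j - 1) / real m2 * real k else real k / 2)"
proof -
  have "(\<Sum>i=0..j. (real m2 - real i) / real m2 * real (m2 choose i)) = layer_weight / real m2"
    unfolding layer_weight_def sum_divide_distrib
  proof (rule sum.cong)
    fix i assume "i \<in> {0..j}"
    then have "i \<le> m2" using j_le by auto
    then show "(real m2 - real i) / real m2 * real (m2 choose i) = real (m2 choose i) * real (m2 - i) / real m2"
      by (simp add: of_nat_diff)
  qed simp
  moreover have "jk_index n1 m2 = (j, k)" by (rule jk_index_eqI[OF jk])
  ultimately show ?thesis using n1 by (simp add: r_const_def Let_def)
qed

lemma sum_upper_layers:
  fixes g :: "nat \<Rightarrow> 'c :: comm_semiring_1"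
  assumes "\<And>i. j + 1 < i \<Longrightarrow> i \<le> m2 \<Longrightarrow> g (m2 - i) = 0"
  shows "(\<Sum>i\<le>m2. of_nat (m2 choose i) * g i) =
    (\<Sum>i=0..j. of_nat (m2 choose i) * g (m2 - i)) + of_nat (m2 choose (j + 1)) * g (m2 - (j + 1))"
proof -
  have "(\<Sum>i\<le>m2. of_nat (m2 choose i) * g (m2 - i)) = (\<Sum>i=0..Suc j. of_nat (m2 choose i) * g (m2 - i))"
    by (rule sum.mono_neutral_right) (use j_le assms in auto)
  then show ?thesis using sum_choose_rev[of m2 g] by simp
qed

text \<open>The greedy solution: every colour from the top \<open>j + 1\<close> layers is used at
  every point, and each colour of the next layer at a fraction \<open>k' / L0\<close> of the
  points.\<close>

lemma primal_layers:
  assumes k': "k' = k \<and> L0 = m2 choose (j + 1) \<and> j < (m2 - 1) div 2 \<or> k' = 0 \<and> L0 = 1"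
  defines "v \<equiv> \<lambda>i. if m2 - j \<le> i then L0 else if i = m2 - (j + 1) then k' else (0::nat)"
  shows "v 0 = 0" "v i \<le> L0" "0 < L0" "(\<Sum>i\<le>m2. (m2 choose i) * v i) = L0 * layer_count + (m2 choose (j + 1)) * k'"
    "real m2 * real (\<Sum>i\<le>m2 - 1. ((m2 - 1) choose i) * v (Suc i)) =
      real L0 * layer_weight + real (m2 choose (j + 1)) * real k' * (real m2 - real j - 1)"
proof -
  have kL: "k' \<le> L0" using k' jk by (auto simp: jk_decomposition_def)
  show "0 < L0" using k' j_le by auto
  show "v i \<le> L0" using kL by (simp add: v_def)
  show "v 0 = 0" using k' j_le m2 by (auto simp: v_def)
  have v1: "v (m2 - i) = L0" if "i \<in> {0..j}" for i using that j_le by (auto simp: v_def)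
  have "\<not> m2 - j \<le> m2 - (j + 1)" using j_le by linarith
  then have v2: "v (m2 - (j + 1)) = k'" by (simp add: v_def)
  have v0: "v (m2 - i) = 0" if "j + 1 < i" "i \<le> m2" for i using that j_le by (auto simp: v_def)
  have "(\<Sum>i\<le>m2. of_nat (m2 choose i) * v i) =
      (\<Sum>i=0..j. of_nat (m2 choose i) * v (m2 - i)) + of_nat (m2 choose (j + 1)) * v (m2 - (j + 1))"
    by (rule sum_upper_layers) (rule v0)
  also have "(\<Sum>i=0..j. of_nat (m2 choose i) * v (m2 - i)) = (\<Sum>i=0..j. (m2 choose i) * L0)"
    by (rule sum.cong) (use v1 in auto)
  finally show "(\<Sum>i\<le>m2. (m2 choose i) * v i) = L0 * layer_count + (m2 choose (j + 1)) * k'"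
    unfolding v2 by (simp add: layer_count_def sum_distrib_left mult.commute)
  have "(\<Sum>i\<le>m2. of_nat (m2 choose i) * (real i * real (v i))) =
      (\<Sum>i=0..j. of_nat (m2 choose i) * (real (m2 - i) * real (v (m2 - i)))) +
      of_nat (m2 choose (j + 1)) * (real (m2 - (j + 1)) * real (v (m2 - (j + 1))))"
    by (rule sum_upper_layers) (use v0 in simp)
  also have "(\<Sum>i=0..j. of_nat (m2 choose i) * (real (m2 - i) * real (v (m2 - i)))) = real L0 * layer_weight"
    unfolding layer_weight_def sum_distrib_left by (rule sum.cong) (use v1 in auto)
  also have "real (m2 - (j + 1)) = real m2 - real j - 1" using j_le by linarith
  finally have "(\<Sum>i\<le>m2. real (m2 choose i) * (real i * real (v i))) =
      real L0 * layer_weight + real (m2 choose (j + 1)) * real k' * (real m2 - real j - 1)"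
    unfolding v2 by (simp add: mult.commute mult.left_commute)
  moreover have "(\<Sum>i\<le>m2. real (m2 choose i) * (real i * real (v i))) =
      real m2 * real (\<Sum>i\<le>m2 - 1. ((m2 - 1) choose i) * v (Suc i))"
    using arg_cong[OF sum_choose_absorb[OF m2, of v], of real] by simp
  ultimately show "real m2 * real (\<Sum>i\<le>m2 - 1. ((m2 - 1) choose i) * v (Suc i)) =
      real L0 * layer_weight + real (m2 choose (j + 1)) * real k' * (real m2 - real j - 1)" by simp
qed

text \<open>A singleton of the next layer gives \<open>m2 - j - 1\<close> incidences with
  \<open>B\<close> per incidence with \<open>A\<close>, a pair of colour \<open>B\<close> gives
  \<open>m2 / 2\<close>. While the former is at least as large, the \<open>k\<close> spare
  incidences go into singletons and \<open>n1 - q = 2\<close>; for the maximal \<open>j\<close> they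
  go into pairs and \<open>n1 - q = 2 + k\<close>.\<close>

lemma primal:
  "\<exists>v L0 q. v 0 = 0 \<and> (\<forall>i. v i \<le> L0) \<and> 0 < L0 \<and> 1 \<le> q \<and> q \<le> n1 - 2 \<and>
    (\<Sum>i\<le>m2. (m2 choose i) * v i) = L0 * q \<and>
    r_const n1 m2 = real (\<Sum>i\<le>m2 - 1. ((m2 - 1) choose i) * v (Suc i)) / real L0 + real (n1 - q) / 2"
proof (cases "j < (m2 - 1) div 2")
  case True
  let ?L = "m2 choose (j + 1)"
  let ?v = "\<lambda>i. if m2 - j \<le> i then ?L else if i = m2 - (j + 1) then k else (0::nat)"
  let ?V = "\<Sum>i\<le>m2 - 1. ((m2 - 1) choose i) * ?v (Suc i)"
  have k': "k = k \<and> ?L = ?L \<and> j < (m2 - 1) div 2 \<or> k = 0 \<and> ?L = 1" using True by simp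
  note v = primal_layers[OF k']
  have "real ?V / real ?L = layer_weight / real m2 + (real m2 - real j - 1) / real m2 * real k"
    using v(3,5) m2 by (simp add: field_simps)
  moreover have "real (n1 - (layer_count + k)) / 2 = 1" using n1_eq by simp
  ultimately have "r_const n1 m2 = real ?V / real ?L + real (n1 - (layer_count + k)) / 2"
    using r_const_eq True by simp
  moreover have "(\<Sum>i\<le>m2. (m2 choose i) * ?v i) = ?L * (layer_count + k)" using v(4) by (simp only: distrib_left)
  ultimately show ?thesis using v(1,2,3) S_pos n1_eq
    by (intro exI[of _ ?v] exI[of _ ?L] exI[of _ "layer_count + k"] conjI allI) (assumption | simp)+
next
  case False
  let ?v = "\<lambda>i. if m2 - j \<le> i then 1 else if i = m2 - (j + 1) then 0 else (0::nat)"
  let ?V = "\<Sum>i\<le>m2 - 1. ((m2 - 1) choose i) * ?v (Suc i)"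
  have k': "0 = k \<and> 1 = m2 choose (j + 1) \<and> j < (m2 - 1) div 2 \<or> (0::nat) = 0 \<and> 1 = (1::nat)" by simp
  note v = primal_layers[OF k']
  have "real ?V / real 1 = layer_weight / real m2" using v(5) m2 by (simp add: field_simps)
  moreover have "real (n1 - layer_count) / 2 = 1 + real k / 2" using n1_eq by simp
  ultimately have "r_const n1 m2 = real ?V / real 1 + real (n1 - layer_count) / 2"
    using r_const_eq False by simp
  moreover have "(\<Sum>i\<le>m2. (m2 choose i) * ?v i) = 1 * layer_count" using v(4) by simp
  ultimately show ?thesis using v(1,2) S_pos n1_eq
    by (intro exI[of _ ?v] exI[of _ 1] exI[of _ layer_count] conjI allI) (assumption | simp)+
qed

text \<open>The price \<open>l\<close> separates the colours counted by \<open>layer_count\<close>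
  from the smaller ones, so the excess is \<open>card T - l\<close> on the former and vanishes on
  the latter.\<close>

lemma dual_sum:
  fixes l :: real
  assumes "\<And>i. i \<le> j \<Longrightarrow> l \<le> real (m2 - i)" "\<And>i. j < i \<Longrightarrow> i \<le> m2 \<Longrightarrow> real (m2 - i) \<le> l"
  shows "(\<Sum>i\<le>m2. real (m2 choose i) * max 0 (real i - l)) = layer_weight - l * real layer_count"
proof -
  have "(\<Sum>i\<le>m2. real (m2 choose i) * max 0 (real i - l)) =
      (\<Sum>i=0..j. real (m2 choose i) * max 0 (real (m2 - i) - l)) +
      real (m2 choose (j + 1)) * max 0 (real (m2 - (j + 1)) - l)"
  proof (rule sum_upper_layers)
    fix i assume "j + 1 < i" "i \<le> m2"
    then show "max 0 (real (m2 - i) - l) = 0" using assms(2)[of i] by linarith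
  qed
  also have "max 0 (real (m2 - (j + 1)) - l) = 0" using assms(2)[of "j + 1"] j_le by (simp add: max_def)
  also have "(\<Sum>i=0..j. real (m2 choose i) * max 0 (real (m2 - i) - l)) =
      (\<Sum>i=0..j. real (m2 choose i) * real (m2 - i) - l * real (m2 choose i))"
    by (rule sum.cong) (use assms(1) in \<open>auto simp: max_def algebra_simps\<close>)
  also have "\<dots> = layer_weight - l * real layer_count" by (simp add: layer_weight_def layer_count_def sum_subtractf sum_distrib_left)
  finally show ?thesis by simp
qed

text \<open>Complementary slackness: the price is the gain per incidence of the last greedy choice,
  \<open>m2 - j - 1\<close> for the partly used layer and \<open>m2 / 2\<close> for pairs.\<close>

lemma dual:
  "\<exists>l. real m2 / 2 \<le> l \<and> l < real m2 \<and>
    real m2 * r_const n1 m2 = real (n1 - 2) * l + real m2 + (\<Sum>i\<le>m2. real (m2 choose i) * max 0 (real i - l))"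
proof (cases "j < (m2 - 1) div 2")
  case True
  let ?l = "real m2 - real j - 1"
  have "2 * (j + 1) \<le> m2" using True by presburger
  then have "real (2 * (j + 1)) \<le> real m2" by (simp only: of_nat_le_iff)
  then have l: "real m2 / 2 \<le> ?l" "?l < real m2" by simp_all
  have sum: "(\<Sum>i\<le>m2. real (m2 choose i) * max 0 (real i - ?l)) = layer_weight - ?l * real layer_count"
    by (rule dual_sum) (use j_le in linarith)+
  have "r_const n1 m2 = 1 + layer_weight / real m2 + ?l / real m2 * real k" using r_const_eq True by simp
  moreover have "real m2 * (1 + layer_weight / real m2 + ?l / real m2 * real k) = real m2 + layer_weight + ?l * real k"
    using m2 by (simp only: distrib_left) simp
  ultimately have "real m2 * r_const n1 m2 = real m2 + layer_weight + ?l * real k" by (simp only:)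
  also have "\<dots> = real (n1 - 2) * ?l + real m2 + (layer_weight - ?l * real layer_count)"
    using n1_eq by (simp add: algebra_simps)
  finally show ?thesis using l sum by (intro exI[of _ ?l]) simp
next
  case False
  then have j: "j = (m2 - 1) div 2" using jk by (auto simp: jk_decomposition_def)
  let ?l = "real m2 / 2"
  have sum: "(\<Sum>i\<le>m2. real (m2 choose i) * max 0 (real i - ?l)) = layer_weight - ?l * real layer_count"
    by (rule dual_sum) (use j_le j_mid[OF j] in linarith)+
  have "r_const n1 m2 = 1 + layer_weight / real m2 + real k / 2" using r_const_eq False by simp
  moreover have "real m2 * (1 + layer_weight / real m2 + real k / 2) = real m2 + layer_weight + ?l * real k"
    using m2 by (simp only: distrib_left) simp
  ultimately have "real m2 * r_const n1 m2 = real m2 + layer_weight + ?l * real k" by (simp only:)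
  also have "\<dots> = real (n1 - 2) * ?l + real m2 + (layer_weight - ?l * real layer_count)"
    using n1_eq by (simp add: algebra_simps)
  finally show ?thesis using m2 sum by (intro exI[of _ ?l]) simp
qed

end

lemma r_const_primal:
  assumes "3 \<le> n1" "1 \<le> m2"
  shows "\<exists>v L0 q. v 0 = 0 \<and> (\<forall>i. v i \<le> L0) \<and> 0 < L0 \<and> 1 \<le> q \<and> q \<le> n1 - 2 \<and>
    (\<Sum>i\<le>m2. (m2 choose i) * v i) = L0 * q \<and>
    r_const n1 m2 = real (\<Sum>i\<le>m2 - 1. ((m2 - 1) choose i) * v (Suc i)) / real L0 + real (n1 - q) / 2"
  using primal[OF assms jk_decomposition_jk_index[OF assms(1)]] .

text \<open>For \<open>n1 = 2\<close> the price is \<open>m2\<close> and no colour has excess. For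
  larger \<open>n1\<close> it stays strictly below \<open>m2\<close>, which makes the charge
  \<open>m2 - l\<close> for unmarked points positive.\<close>

lemma r_const_dual:
  assumes "2 \<le> n1" "1 \<le> m2"
  shows "\<exists>l. real m2 / 2 \<le> l \<and> l \<le> real m2 \<and> (n1 = 2 \<longrightarrow> l = real m2) \<and> (3 \<le> n1 \<longrightarrow> l < real m2) \<and>
    real m2 * r_const n1 m2 = real (n1 - 2) * l + real m2 + (\<Sum>i\<le>m2. real (m2 choose i) * max 0 (real i - l))"
proof (cases "n1 = 2")
  case True
  have "(\<Sum>i\<le>m2. real (m2 choose i) * max 0 (real i - real m2)) = 0" by (rule sum.neutral) simp
  then show ?thesis using True by (intro exI[of _ "real m2"]) (simp add: r_const_def)
next
  case False
  then have n1: "3 \<le> n1" using assms by simp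
  show ?thesis using dual[OF n1 assms(2) jk_decomposition_jk_index[OF n1]] False n1 by (auto intro: less_imp_le)
qed

section \<open>Asymptotic upper bound and descent near the optimum\<close>

context
  fixes n1 m2 :: nat
  assumes n1: "2 \<le> n1" and m2: "1 \<le> m2"
begin

text \<open>At the optimal price the main terms of \<open>duality_inequality\<close> combine to
  \<open>m2 * r_const n1 m2 * card A\<close>, and the remaining bracket is at most the number of
  components by \<open>card_coloured_bound\<close>. The price is chosen before the family, so that
  constants derived from it are uniform.\<close>

lemma duality_bound:
  fixes A :: "'a set" and B :: "'b set"
  shows "\<exists>l. real m2 / 2 \<le> l \<and> l \<le> real m2 \<and> (n1 = 2 \<longrightarrow> l = real m2) \<and> (3 \<le> n1 \<longrightarrow> l < real m2) \<and>
    (\<forall>A B n2 F. finite (A :: 'a set) \<longrightarrow> finite (B :: 'b set) \<longrightarrow> card B = m2 \<longrightarrow> realizes A B n1 n2 F \<longrightarrow>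
      real m2 * real n2 + (real m2 - l) * real (card (unmarked A B F)) +
      (\<Sum>X\<in>{X \<in> F. 2 \<le> card (fst X)}. (real m2 - l) * (real (card (fst X)) - 2))
      \<le> real m2 * 2 ^ m2 + real m2 * r_const n1 m2 * real (card A) +
        (2 * l - real m2) * (real (card (coloured F A)) + real (card A) - real n1 * real (card A)))"
proof -
  obtain l where l: "real m2 / 2 \<le> l" "l \<le> real m2" "n1 = 2 \<longrightarrow> l = real m2" "3 \<le> n1 \<longrightarrow> l < real m2"
    and r: "real m2 * r_const n1 m2 = real (n1 - 2) * l + real m2 + (\<Sum>i\<le>m2. real (m2 choose i) * max 0 (real i - l))"
    using r_const_dual[OF n1 m2] by blast
  have "real m2 * real n2 + (real m2 - l) * real (card (unmarked A B F)) +
      (\<Sum>X\<in>{X \<in> F. 2 \<le> card (fst X)}. (real m2 - l) * (real (card (fst X)) - 2))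
      \<le> real m2 * 2 ^ m2 + real m2 * r_const n1 m2 * real (card A) +
        (2 * l - real m2) * (real (card (coloured F A)) + real (card A) - real n1 * real (card A))"
    if fin: "finite A" "finite B" and B: "card B = m2" and F: "realizes A B n1 n2 F"
    for A :: "'a set" and B :: "'b set" and n2 F
  proof -
    have "(\<Sum>T\<in>Pow B. excess l T) = (\<Sum>i\<le>m2. real (m2 choose i) * max 0 (real i - l))"
      using sum_Pow_card[OF fin(2), of "\<lambda>i. max 0 (real i - l)"] B by (simp add: excess_def)
    then have \<Phi>: "(\<Sum>T\<in>Pow B. excess l T) = real m2 * r_const n1 m2 - (real n1 - 2) * l - real m2"
      using r n1 by (simp add: of_nat_diff)
    have "real m2 / 2 \<le> l" by (rule l(1))
    then show ?thesis
      using duality_inequality[OF fin F, of l] l(2) unfolding B \<Phi> by (simp add: algebra_simps)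
  qed
  then show ?thesis using l by blast
qed

text \<open>The left-hand side is at most the number of components, to which
  \<open>card_comps_bound\<close> applies with \<open>1 / Suc s < \<eta>\<close>.\<close>

lemma comps_small:
  assumes "0 < \<eta>"
  shows "\<exists>K. \<forall>A B n2 F. finite (A :: 'a set) \<longrightarrow> finite (B :: 'b set) \<longrightarrow> card B = m2 \<longrightarrow> realizes A B n1 n2 F \<longrightarrow>
    real (card (coloured F A)) + real (card A) - real n1 * real (card A) \<le> K + \<eta> * real (card A)"
proof -
  obtain s where s: "1 / real (Suc s) < \<eta>" using assms by (metis nat_approx_posE)
  let ?K = "Suc s * 2 ^ (2 ^ s * 2 ^ m2) :: nat"
  have "real (card (coloured F A)) + real (card A) - real n1 * real (card A) \<le> real ?K + \<eta> * real (card A)"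
    if fin: "finite A" "finite B" and B: "card B = m2" and F: "realizes A B n1 n2 F"
    for A :: "'a set" and B :: "'b set" and n2 F
  proof -
    have "card (coloured F A) + card A \<le> n1 * card A + card (comps A F)"
      by (rule card_coloured_bound[OF fin F])
    then have "real (card (coloured F A) + card A) \<le> real (n1 * card A + card (comps A F))"
      by (simp only: of_nat_le_iff)
    moreover have "real (card (comps A F)) \<le> real ?K + \<eta> * real (card A)"
    proof -
      have "Suc s * card (comps A F) \<le> Suc s * ?K + card A"
        using card_comps_bound[OF fin F, of s] B by simp
      then have "real (Suc s * card (comps A F)) \<le> real (Suc s * ?K + card A)" by (simp only: of_nat_le_iff)
      then have "real (Suc s) * real (card (comps A F)) \<le> real (Suc s) * (real ?K + 1 / real (Suc s) * real (card A))"
        by (simp only: of_nat_mult of_nat_add distrib_left) simp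
      then have "real (card (comps A F)) \<le> real ?K + 1 / real (Suc s) * real (card A)"
        by (rule mult_left_le_imp_le) simp
      also have "\<dots> \<le> real ?K + \<eta> * real (card A)" using s by (intro add_left_mono mult_right_mono) auto
      finally show ?thesis .
    qed
    ultimately show ?thesis by simp
  qed
  then show ?thesis by blast
qed

text \<open>In \<open>duality_bound\<close> the charges for unmarked points and for large first
  components are nonnegative, and \<open>2 * l - m2 \<le> m2\<close> allows the error to be divided
  by \<open>m2\<close>.\<close>

lemma upper_bound:
  assumes "0 < \<eta>"
  shows "\<exists>K. \<forall>A B n2 F. finite (A :: 'a set) \<longrightarrow> finite (B :: 'b set) \<longrightarrow> card B = m2 \<longrightarrow> realizes A B n1 n2 F \<longrightarrow>
    real n2 \<le> r_const n1 m2 * real (card A) + K + \<eta> * real (card A)"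
proof -
  obtain K where K: "\<And>A B n2 F. finite (A :: 'a set) \<Longrightarrow> finite (B :: 'b set) \<Longrightarrow> card B = m2 \<Longrightarrow> realizes A B n1 n2 F \<Longrightarrow>
    real (card (coloured F A)) + real (card A) - real n1 * real (card A) \<le> K + \<eta> * real (card A)"
    using comps_small[OF assms] by blast
  obtain l where l: "real m2 / 2 \<le> l" "l \<le> real m2" and M: "\<And>A B n2 F. finite (A :: 'a set) \<Longrightarrow> finite (B :: 'b set) \<Longrightarrow>
      card B = m2 \<Longrightarrow> realizes A B n1 n2 F \<Longrightarrow>
      real m2 * real n2 + (real m2 - l) * real (card (unmarked A B F)) +
      (\<Sum>X\<in>{X \<in> F. 2 \<le> card (fst X)}. (real m2 - l) * (real (card (fst X)) - 2))
      \<le> real m2 * 2 ^ m2 + real m2 * r_const n1 m2 * real (card A) +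
        (2 * l - real m2) * (real (card (coloured F A)) + real (card A) - real n1 * real (card A))"
    using duality_bound by blast
  have "real n2 \<le> r_const n1 m2 * real (card A) + (2 ^ m2 + \<bar>K\<bar>) + \<eta> * real (card A)"
    if R: "finite A" "finite B" "card B = m2" "realizes A B n1 n2 F"
    for A :: "'a set" and B :: "'b set" and n2 F
  proof -
    have "(2 * l - real m2) * (real (card (coloured F A)) + real (card A) - real n1 * real (card A))
        \<le> (2 * l - real m2) * (\<bar>K\<bar> + \<eta> * real (card A))"
      using K[OF R] l by (intro mult_left_mono) linarith+
    also have "\<dots> \<le> real m2 * (\<bar>K\<bar> + \<eta> * real (card A))"
      using l assms by (intro mult_right_mono) auto
    moreover have "0 \<le> (\<Sum>X\<in>{X \<in> F. 2 \<le> card (fst X)}. (real m2 - l) * (real (card (fst X)) - 2))"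
      using l by (intro sum_nonneg mult_nonneg_nonneg) auto
    moreover have "0 \<le> (real m2 - l) * real (card (unmarked A B F))" using l by simp
    ultimately have "real m2 * real n2 \<le> real m2 * 2 ^ m2 + real m2 * r_const n1 m2 * real (card A) + real m2 * (\<bar>K\<bar> + \<eta> * real (card A))"
      using M[OF R] by linarith
    also have "\<dots> = real m2 * (r_const n1 m2 * real (card A) + (2 ^ m2 + \<bar>K\<bar>) + \<eta> * real (card A))" by (simp add: algebra_simps)
    finally show ?thesis using m2 by simp
  qed
  then show ?thesis by blast
qed

text \<open>For \<open>n1 \<ge> 3\<close> the charge for unmarked points forces roughly half of
  \<open>A\<close> to be marked. For \<open>n1 = 2\<close> this charge vanishes; instead there are
  only about \<open>card A\<close> coloured classes, and if nearly all of them missed an element of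
  \<open>B\<close>, then \<open>n2\<close> could not be close to \<open>card A\<close>.\<close>

lemma many_full_classes:
  shows "\<exists>m0. \<forall>A B n2 F. finite (A :: 'a set) \<longrightarrow> finite (B :: 'b set) \<longrightarrow> card B = m2 \<longrightarrow> realizes A B n1 n2 F \<longrightarrow>
    m0 \<le> card A \<longrightarrow> r_const n1 m2 * real (card A) - C0 \<le> real n2 \<longrightarrow> T0 \<le> card {X \<in> F. fst X \<noteq> {} \<and> snd X = B}"
proof (cases "n1 = 2")
  case True
  have r1: "r_const n1 m2 = 1" using True by (simp add: r_const_def)
  \<comment> \<open>Multiplied by \<open>m2\<close> this error is \<open>card A / 2\<close>, half of
    the \<open>card A\<close> incidences that are lost if every class misses an element of
    \<open>B\<close>.\<close>
  have \<eta>: "0 < 1 / (2 * real m2)" using m2 by simp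
  obtain K where K: "\<And>A B n2 F. finite (A :: 'a set) \<Longrightarrow> finite (B :: 'b set) \<Longrightarrow> card B = m2 \<Longrightarrow> realizes A B n1 n2 F \<Longrightarrow>
    real (card (coloured F A)) + real (card A) - real n1 * real (card A) \<le> K + 1 / (2 * real m2) * real (card A)"
    using comps_small[OF \<eta>] by blast
  define W where "W = real m2 * C0 + real m2 * 2 ^ m2 + real m2 * \<bar>K\<bar> + real T0"
  have "T0 \<le> card {X \<in> F. fst X \<noteq> {} \<and> snd X = B}"
    if R: "finite A" "finite B" "card B = m2" "realizes A B n1 n2 F" and m0: "nat \<lceil>2 * W\<rceil> \<le> card A"
      and n2: "r_const n1 m2 * real (card A) - C0 \<le> real n2"
    for A :: "'a set" and B :: "'b set" and n2 F
  proof -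
    let ?G = "{X \<in> F. fst X \<noteq> {} \<and> snd X = B}" and ?Q = "coloured F A" and ?F0 = "{X \<in> F. fst X = {}}"
    have finF: "finite F" using R realizes_finite by blast
    have sub: "F \<subseteq> Pow A \<times> Pow B" using R(4) by (simp add: realizes_def)
    have cT: "card (snd X) \<le> m2" if "X \<in> F" for X
      using card_mono[OF R(2) family_subset(2)[OF sub that]] R(3) by simp
    have "n2 * m2 = (\<Sum>X\<in>F. card (snd X))"
      using sum_card_snd[OF R(2) finF sub, of n2] R(3,4) by (simp add: realizes_def)
    also have "\<dots> \<le> (\<Sum>X\<in>F. (if fst X = {} then m2 else 0) + ((if X \<in> ?Q then m2 - 1 else 0) + (if X \<in> ?G then 1 else 0)))"
    proof (rule sum_mono)
      fix X assume X: "X \<in> F"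
      have "fst X \<subseteq> A" by (rule family_subset(1)[OF sub X])
      then have Q: "X \<in> ?Q \<longleftrightarrow> fst X \<noteq> {} \<and> snd X \<noteq> {}" using X by (auto simp: coloured_def)
      have G: "X \<in> ?G \<longleftrightarrow> fst X \<noteq> {} \<and> snd X = B" using X by simp
      have "card (snd X) < m2" if "snd X \<noteq> B"
        using family_subset(2)[OF sub X] that R(2,3) psubset_card_mono[of B "snd X"] by auto
      then show "card (snd X) \<le> (if fst X = {} then m2 else 0) + ((if X \<in> ?Q then m2 - 1 else 0) + (if X \<in> ?G then 1 else 0))"
        using cT[OF X] m2 R(3) unfolding Q G by (cases "snd X = {}"; cases "snd X = B"; cases "fst X = {}") auto
    qed
    also have "\<dots> = m2 * card ?F0 + ((m2 - 1) * card ?Q + card ?G)"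
    proof -
      have "F \<inter> {X. fst X = {}} = ?F0" "F \<inter> {X. X \<in> ?Q} = ?Q" "F \<inter> {X. X \<in> ?G} = ?G"
        by (auto simp: coloured_def)
      then show ?thesis using finF by (simp only: sum.distrib sum.If_cases) (simp add: mult.commute)
    qed
    also have "card ?F0 \<le> card (Pow B)"
    proof (rule card_inj_on_le[of snd])
      show "inj_on snd ?F0" by (auto simp: inj_on_def)
      show "snd ` ?F0 \<subseteq> Pow B" using family_subset(2)[OF sub] by blast
    qed (use R(2) in simp)
    finally have "n2 * m2 \<le> m2 * card (Pow B) + ((m2 - 1) * card ?Q + card ?G)" by simp
    then have "n2 * m2 \<le> m2 * 2 ^ m2 + ((m2 - 1) * card ?Q + card ?G)" using R(2,3) by (simp add: card_Pow)
    then have "real (n2 * m2) \<le> real (m2 * 2 ^ m2 + ((m2 - 1) * card ?Q + card ?G))" by (simp only: of_nat_le_iff)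
    then have 1: "real m2 * real n2 \<le> real m2 * 2 ^ m2 + (real m2 - 1) * real (card ?Q) + real (card ?G)"
      using m2 by (simp add: of_nat_diff mult.commute)
    have q: "real (card ?Q) \<le> real (card A) + (\<bar>K\<bar> + 1 / (2 * real m2) * real (card A))" using K[OF R] True by simp
    have "(real m2 - 1) * real (card ?Q) \<le> (real m2 - 1) * (real (card A) + (\<bar>K\<bar> + 1 / (2 * real m2) * real (card A)))"
      using q m2 by (intro mult_left_mono) auto
    also have "\<dots> = (real m2 - 1) * real (card A) + (real m2 - 1) * (\<bar>K\<bar> + 1 / (2 * real m2) * real (card A))"
      by (rule distrib_left)
    also have "\<dots> \<le> (real m2 - 1) * real (card A) + real m2 * (\<bar>K\<bar> + 1 / (2 * real m2) * real (card A))"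
      by (intro add_left_mono mult_right_mono) auto
    also have "\<dots> = real m2 * real (card A) - real (card A) / 2 + real m2 * \<bar>K\<bar>"
      using m2 by (simp add: field_simps)
    finally have 2: "(real m2 - 1) * real (card ?Q) \<le> real m2 * real (card A) - real (card A) / 2 + real m2 * \<bar>K\<bar>" .
    have "real m2 * (real (card A) - C0) \<le> real m2 * real n2" using n2 r1 by (intro mult_left_mono) auto
    then have 3: "real m2 * real (card A) - real m2 * C0 \<le> real m2 * real n2" by (simp add: right_diff_distrib)
    have "2 * W \<le> real (card A)" using m0 by linarith
    moreover have "real m2 * real (card A) - real m2 * C0 - real m2 * 2 ^ m2 -
        (real m2 * real (card A) - real (card A) / 2 + real m2 * \<bar>K\<bar>) \<le> real (card ?G)"
      using 1 2 3 by linarith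
    ultimately have "real T0 \<le> real (card ?G)" unfolding W_def by argo
    then show ?thesis by simp
  qed
  then show ?thesis by blast
next
  case False
  then have n3: "3 \<le> n1" using n1 by simp
  obtain l where l: "real m2 / 2 \<le> l" "l < real m2" and M: "\<And>A B n2 F. finite (A :: 'a set) \<Longrightarrow> finite (B :: 'b set) \<Longrightarrow>
      card B = m2 \<Longrightarrow> realizes A B n1 n2 F \<Longrightarrow>
      real m2 * real n2 + (real m2 - l) * real (card (unmarked A B F)) +
      (\<Sum>X\<in>{X \<in> F. 2 \<le> card (fst X)}. (real m2 - l) * (real (card (fst X)) - 2))
      \<le> real m2 * 2 ^ m2 + real m2 * r_const n1 m2 * real (card A) +
        (2 * l - real m2) * (real (card (coloured F A)) + real (card A) - real n1 * real (card A))"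
    using duality_bound n3 by blast
  \<comment> \<open>Chosen so that the error \<open>m2 * ?\<eta> * card A\<close> is half of
    \<open>(m2 - l) * card A\<close>, the charge that would arise if all points were
    unmarked.\<close>
  let ?\<eta> = "(real m2 - l) / (2 * real m2)"
  have \<eta>: "0 < ?\<eta>" using m2 l by simp
  obtain K where K: "\<And>A B n2 F. finite (A :: 'a set) \<Longrightarrow> finite (B :: 'b set) \<Longrightarrow> card B = m2 \<Longrightarrow> realizes A B n1 n2 F \<Longrightarrow>
    real (card (coloured F A)) + real (card A) - real n1 * real (card A) \<le> K + ?\<eta> * real (card A)"
    using comps_small[OF \<eta>] by blast
  define W where "W = (real m2 * 2 ^ m2 + real m2 * C0 + real m2 * \<bar>K\<bar>) / (real m2 - l) + real T0"
  have "T0 \<le> card {X \<in> F. fst X \<noteq> {} \<and> snd X = B}"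
    if R: "finite A" "finite B" "card B = m2" "realizes A B n1 n2 F" and m0: "nat \<lceil>2 * W\<rceil> \<le> card A"
      and n2: "r_const n1 m2 * real (card A) - C0 \<le> real n2"
    for A :: "'a set" and B :: "'b set" and n2 F
  proof -
    let ?G = "{X \<in> F. fst X \<noteq> {} \<and> snd X = B}" and ?L = "unmarked A B F"
    have finF: "finite F" using R realizes_finite by blast
    have "(2 * l - real m2) * (real (card (coloured F A)) + real (card A) - real n1 * real (card A))
        \<le> (2 * l - real m2) * (\<bar>K\<bar> + ?\<eta> * real (card A))"
      using K[OF R] l by (intro mult_left_mono) linarith+
    also have "\<dots> \<le> real m2 * (\<bar>K\<bar> + ?\<eta> * real (card A))"
      using l \<eta> by (intro mult_right_mono add_nonneg_nonneg mult_nonneg_nonneg) linarith+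
    also have "\<dots> = real m2 * \<bar>K\<bar> + (real m2 - l) * (real (card A) / 2)" using m2 by (simp add: field_simps)
    finally have 1: "(2 * l - real m2) * (real (card (coloured F A)) + real (card A) - real n1 * real (card A))
        \<le> real m2 * \<bar>K\<bar> + (real m2 - l) * (real (card A) / 2)" .
    have 2: "0 \<le> (\<Sum>X\<in>{X \<in> F. 2 \<le> card (fst X)}. (real m2 - l) * (real (card (fst X)) - 2))"
      using l by (intro sum_nonneg mult_nonneg_nonneg) auto
    have "real m2 * (r_const n1 m2 * real (card A) - C0) \<le> real m2 * real n2" using n2 by (intro mult_left_mono) auto
    then have 3: "real m2 * r_const n1 m2 * real (card A) - real m2 * C0 \<le> real m2 * real n2" by (simp add: right_diff_distrib mult.assoc)
    have "(real m2 - l) * real (card ?L) \<le> (real m2 * 2 ^ m2 + real m2 * C0 + real m2 * \<bar>K\<bar>) + (real m2 - l) * (real (card A) / 2)"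
      using M[OF R] 1 2 3 by linarith
    also have "\<dots> = (real m2 - l) * ((real m2 * 2 ^ m2 + real m2 * C0 + real m2 * \<bar>K\<bar>) / (real m2 - l) + real (card A) / 2)"
    proof -
      have "real m2 - l \<noteq> 0" using l by simp
      moreover have "x + d * y = d * (x / d + y)" if "d \<noteq> 0" for x y d :: real
        using that by (simp add: distrib_left)
      ultimately show ?thesis by blast
    qed
    finally have "real (card ?L) \<le> (real m2 * 2 ^ m2 + real m2 * C0 + real m2 * \<bar>K\<bar>) / (real m2 - l) + real (card A) / 2"
      by (rule mult_left_le_imp_le) (use l in simp)
    then have L: "real (card ?L) \<le> W - real T0 + real (card A) / 2" by (simp add: W_def)
    have "card (A - ?L) = card A - card ?L" using R(1) by (intro card_Diff_subset) (auto simp: unmarked_def)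
    moreover have "card (A - ?L) \<le> card ?G"
    proof (rule card_inj_on_le[of "\<lambda>a. ({a}, B)"])
      show "(\<lambda>a. ({a}, B)) ` (A - ?L) \<subseteq> ?G" by (auto simp: unmarked_def)
    qed (use finF in \<open>auto simp: inj_on_def\<close>)
    moreover have "2 * W \<le> real (card A)" using m0 by linarith
    moreover have "card ?L \<le> card A" using R(1) by (intro card_mono) (auto simp: unmarked_def)
    ultimately have "real T0 \<le> real (card ?G)" using L by linarith
    then show ?thesis by simp
  qed
  then show ?thesis by blast
qed

lemma descent:
  "\<exists>m0. \<forall>A B n2 F. finite (A :: 'a set) \<longrightarrow> finite (B :: 'b set) \<longrightarrow> card B = m2 \<longrightarrow> realizes A B n1 n2 F \<longrightarrow>
    m0 \<le> card A \<longrightarrow> r_const n1 m2 * real (card A) - C0 \<le> real n2 \<longrightarrow> (\<exists>F'. realizes A B n1 (n2 - 1) F')"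
proof -
  \<comment> \<open>\<open>J\<close> is the size demanded by \<open>path_replacement\<close>. Among
    \<open>T0\<close> classes of colour \<open>B\<close> one meets a component with more than
    \<open>J + 1\<close> points, by \<open>ex_large_comp\<close>; the summand 2 in \<open>T0\<close>
    serves the case \<open>n1 = 2\<close>.\<close>
  define J :: nat where "J = (2 ^ m2)\<^sup>2 + 2 ^ m2"
  define T0 where "T0 = n1 * ((J + 1) * (Suc (J + 1) * 2 ^ (2 ^ (J + 1) * 2 ^ m2))) + 2"
  obtain ma where ma: "\<And>A B n2 F. finite (A :: 'a set) \<Longrightarrow> finite (B :: 'b set) \<Longrightarrow> card B = m2 \<Longrightarrow> realizes A B n1 n2 F \<Longrightarrow>
    ma \<le> card A \<Longrightarrow> r_const n1 m2 * real (card A) - C0 \<le> real n2 \<Longrightarrow> T0 \<le> card {X \<in> F. fst X \<noteq> {} \<and> snd X = B}"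
    using many_full_classes[of C0 T0] by blast
  obtain l where l: "real m2 / 2 \<le> l" "l \<le> real m2" "3 \<le> n1 \<longrightarrow> l < real m2"
    and M: "\<And>A B n2 F. finite (A :: 'a set) \<Longrightarrow> finite (B :: 'b set) \<Longrightarrow>
      card B = m2 \<Longrightarrow> realizes A B n1 n2 F \<Longrightarrow>
      real m2 * real n2 + (real m2 - l) * real (card (unmarked A B F)) +
      (\<Sum>X\<in>{X \<in> F. 2 \<le> card (fst X)}. (real m2 - l) * (real (card (fst X)) - 2))
      \<le> real m2 * 2 ^ m2 + real m2 * r_const n1 m2 * real (card A) +
        (2 * l - real m2) * (real (card (coloured F A)) + real (card A) - real n1 * real (card A))"
    using duality_bound by blast
  define W where "W = real m2 * 2 ^ m2 + real m2 * C0 + real m2"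
  \<comment> \<open>Each unmarked point, and each point beyond two in a first component, costs
    \<open>m2 - l\<close> of a slack of at most \<open>W\<close>, so \<open>u\<close> bounds both.
    The divisor vanishes only for \<open>n1 = 2\<close>, where no chord is used.\<close>
  define u where "u = nat \<lceil>W / (real m2 - l)\<rceil>"
  define \<Delta> where "\<Delta> = 1 + n1 * (2 + u)"
  define s where "s = \<Delta> ^ (u\<^sup>2 + 2)"
  define mb where "mb = s * (Suc s * 2 ^ (2 ^ s * 2 ^ m2)) + u * \<Delta> ^ (2 * (u\<^sup>2 + 2)) + 1"
  have "\<exists>F'. realizes A B n1 (n2 - 1) F'"
    if R: "finite A" "finite B" "card B = m2" "realizes A B n1 n2 F"
      and m0: "ma + mb + J + 2 \<le> card A" and n2: "r_const n1 m2 * real (card A) - C0 \<le> real n2"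
    for A :: "'a set" and B :: "'b set" and n2 F
  proof -
    have sub: "F \<subseteq> Pow A \<times> Pow B" using R(4) by (simp add: realizes_def)
    have Bne: "B \<noteq> {}" using R(3) m2 by auto
    let ?G = "{X \<in> F. fst X \<noteq> {} \<and> snd X = B}"
    have G: "T0 \<le> card ?G" using ma[OF R] m0 n2 by simp
    have ne: "fst X \<noteq> {}" if "X \<in> F" "snd X = {}" for X
      using R(4) that by (metis prod.collapse realizes_def)
    \<comment> \<open>A balance of at least 2 provides a union of components with balance 1.
      Otherwise the last bracket in \<open>M\<close> is at most 1, so that the slack is bounded by a
      constant.\<close>
    show ?thesis
    proof (cases "n1 * card A + 2 \<le> card (coloured F A) + card A")
      case True
      have "n1 * ((J + 1) * (Suc (J + 1) * 2 ^ (2 ^ (J + 1) * 2 ^ card B))) < card ?G"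
        using G unfolding T0_def R(3) by linarith
      then obtain K0 X where K0: "K0 \<in> comps A F" "J + 1 < card K0" "X \<in> ?G" "fst X \<inter> K0 \<noteq> {}"
        using ex_large_comp[OF R(1,2,4), of ?G "J + 1"] by blast
      obtain D where D: "closed_in A F D" "K0 \<subseteq> D" "card (coloured F D) + card D = n1 * card D + 1"
        "\<And>X. X \<in> F \<Longrightarrow> snd X = {} \<Longrightarrow> fst X \<inter> D \<noteq> {}"
        using ex_union_comps[OF R(1,2,4) True K0(1)] by blast
      have finD: "finite D" using closed_in_subset[OF D(1)] R(1) finite_subset by blast
      have "card K0 \<le> card D" by (rule card_mono[OF finD D(2)])
      then have big: "(2 ^ card B)\<^sup>2 + 2 ^ card B < card D - 1" using K0(2) unfolding J_def R(3) by linarith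
      have finF: "finite F" using R realizes_finite by blast
      have "X \<in> {X \<in> F. fst X \<inter> D \<noteq> {} \<and> snd X = B}" using K0(3,4) D(2) by blast
      then have "1 \<le> card {X \<in> F. fst X \<inter> D \<noteq> {} \<and> snd X = B}"
        using finF by (metis (no_types, lifting) One_nat_def Suc_leI card_gt_0_iff empty_iff finite_subset mem_Collect_eq subsetI)
      then have "1 \<le> class_count D F B" by (simp add: class_count_def)
      then show ?thesis
        using descent_tree[OF R(1,2) Bne R(4) n1 D(1) D(4) big D(3)] by blast
    next
      case False
      then have Q: "card (coloured F A) + card A \<le> n1 * card A + 1" by simp
      have closedA: "closed_in A F A" using family_subset(1)[OF sub] by (auto simp: closed_in_def)
      have outA: "fst X \<inter> A \<noteq> {}" if "X \<in> F" "snd X = {}" for X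
        using ne[OF that] family_subset(1)[OF sub that(1)] by blast
      have bigA: "(2 ^ card B)\<^sup>2 + 2 ^ card B < card A - 1" using m0 unfolding J_def R(3) by linarith
      show ?thesis
      proof (cases "n1 = 2")
        case True
        have "{X \<in> F. fst X \<inter> A \<noteq> {} \<and> snd X = B} = ?G" using family_subset(1)[OF sub] by blast
        then have "2 \<le> class_count A F B" using G by (simp add: class_count_def T0_def)
        moreover have "card (coloured F A) \<le> card A + 1" using Q True by simp
        ultimately show ?thesis
          using descent_path_two[OF R(1,2) Bne R(4) n1 closedA outA bigA True] by blast
      next
        case False
        then have n3: "3 \<le> n1" using n1 by simp
        then have lm: "0 < real m2 - l" using l(3) by simp
        have "real (card (coloured F A) + card A) \<le> real (n1 * card A + 1)" using Q by (simp only: of_nat_le_iff)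
        then have "(2 * l - real m2) * (real (card (coloured F A)) + real (card A) - real n1 * real (card A))
            \<le> (2 * l - real m2) * 1"
          using l by (intro mult_left_mono) auto
        also have "\<dots> \<le> real m2" using l by simp
        finally have 1: "(2 * l - real m2) * (real (card (coloured F A)) + real (card A) - real n1 * real (card A)) \<le> real m2" .
        have "real m2 * (r_const n1 m2 * real (card A) - C0) \<le> real m2 * real n2" using n2 by (intro mult_left_mono) auto
        then have 3: "real m2 * r_const n1 m2 * real (card A) - real m2 * C0 \<le> real m2 * real n2" by (simp add: right_diff_distrib mult.assoc)
        let ?big = "{X \<in> F. 2 \<le> card (fst X)}" and ?f = "\<lambda>X. (real m2 - l) * (real (card (fst X)) - 2)"
        have slack: "(real m2 - l) * real (card (unmarked A B F)) + (\<Sum>X\<in>?big. ?f X) \<le> W"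
          using M[OF R] 1 3 unfolding W_def by linarith
        have nonneg: "0 \<le> ?f X" if "X \<in> ?big" for X using that lm by (intro mult_nonneg_nonneg) auto
        have le_u: "c \<le> u" if "(real m2 - l) * real c \<le> W" for c
        proof -
          have "real c \<le> W / (real m2 - l)" using that lm by (simp add: pos_le_divide_eq mult.commute)
          then show ?thesis unfolding u_def by linarith
        qed
        have cL: "card (unmarked A B F) \<le> u"
          by (rule le_u) (use slack sum_nonneg[of ?big ?f, OF nonneg] in linarith)
        have cX: "card (fst X) \<le> 2 + u" if "X \<in> F" for X
        proof (cases "2 \<le> card (fst X)")
          case True
          have "finite F" using R realizes_finite by blast
          then have "finite ?big" by simp
          then have "?f X \<le> (\<Sum>X\<in>?big. ?f X)" using True that nonneg by (intro member_le_sum) auto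
          moreover have "0 \<le> (real m2 - l) * real (card (unmarked A B F))" using lm by simp
          ultimately have "?f X \<le> W" using slack by linarith
          then have "(real m2 - l) * real (card (fst X) - 2) \<le> W" using True by (simp add: of_nat_diff)
          then have "card (fst X) - 2 \<le> u" by (rule le_u)
          then show ?thesis by simp
        qed simp
        show ?thesis
          by (rule descent_chord[OF R(1,2,4) cL cX \<Delta>_def])
            (use m0 in \<open>simp_all add: mb_def s_def R(3)\<close>)
      qed
    qed
  qed
  then show ?thesis by blast
qed

lemma explicit_range:
  "\<exists>C m0. \<forall>m1\<ge>m0. \<forall>B :: 'b set. \<forall>n2\<ge>1. finite B \<longrightarrow> card B = m2 \<longrightarrow>
    real n2 \<le> r_const n1 m2 * real m1 - C \<longrightarrow> (\<exists>F. realizes {..<m1} B n1 n2 F)"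
proof (cases "n1 = 2")
  case True
  have "\<exists>F. realizes {..<m1} B n1 n2 F"
    if R: "6 \<le> m1" "1 \<le> n2" "finite B" "card B = m2" "real n2 \<le> r_const n1 m2 * real m1 - (real m2 + 1)" for m1 n2 and B :: "'b set"
  proof -
    have "real n2 + real m2 + 1 \<le> real m1" using R(5) True by (simp add: r_const_def)
    then have "(n2 - 1) + card B + 2 \<le> m1" using R(2,4) by linarith
    then obtain F where "realizes {..<m1} B 2 (n2 - 1 + 1) F"
      using spider[OF R(3,1), of "n2 - 1"] by blast
    then show ?thesis using R(2) True by auto
  qed
  then show ?thesis
    by (intro exI[of _ "real m2 + 1"] exI[of _ "6 :: nat"] allI impI) simp
next
  case False
  then have n3: "3 \<le> n1" using n1 by simp
  from r_const_primal[OF n3 m2] obtain v L0 q where v: "v 0 = 0" "\<And>i. v i \<le> L0" "0 < L0" "1 \<le> q" "q \<le> n1 - 2"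
    "(\<Sum>i\<le>m2. (m2 choose i) * v i) = L0 * q"
    "r_const n1 m2 = real (\<Sum>i\<le>m2 - 1. ((m2 - 1) choose i) * v (Suc i)) / real L0 + real (n1 - q) / 2" by blast
  show ?thesis unfolding v(7) by (rule explicit_range_ge3[OF n3 m2 v(3,4,5,1,2,6)])
qed

lemma r_ge_1: "1 \<le> r_const n1 m2"
proof (cases "n1 = 2")
  case False
  then have n3: "3 \<le> n1" using n1 by simp
  from r_const_primal[OF n3 m2] obtain v L0 q where v: "q \<le> n1 - 2"
    "r_const n1 m2 = real (\<Sum>i\<le>m2 - 1. ((m2 - 1) choose i) * v (Suc i)) / real L0 + real (n1 - q) / 2" by blast
  have "2 \<le> real (n1 - q)" using v(1) n3 by simp
  moreover have "0 \<le> real (\<Sum>i\<le>m2 - 1. ((m2 - 1) choose i) * v (Suc i)) / real L0"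
    by (intro divide_nonneg_nonneg of_nat_0_le_iff)
  ultimately show ?thesis unfolding v(2) by linarith
qed (simp add: r_const_def)

end

section \<open>The threshold function\<close>

theorem theorem1p1:
  fixes n1 m2 :: nat
  assumes "n1 \<ge> 2" and "m2 \<ge> 1"
  shows "\<exists>\<epsilon> :: nat \<Rightarrow> real. \<epsilon> \<in> o(\<lambda>m1. real m1) \<and>
    (\<forall>\<^sub>F m1 in sequentially. \<forall>n2 :: nat. n2 \<ge> 1 \<longrightarrow>
      ((\<exists>P. distinguishing_partition (complete_multipartite m1 n1 m2 n2) P) \<longleftrightarrow>
       real n2 \<le> r_const n1 m2 * real m1 + \<epsilon> m1))"
proof -
  let ?r = "r_const n1 m2"
  let ?real = "\<lambda>m1 n2. \<exists>F. realizes {..<m1} {m1..<m1 + m2} n1 n2 F"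
  define good where "good m1 n2 \<longleftrightarrow> (\<exists>P. distinguishing_partition (complete_multipartite m1 n1 m2 n2) P)" for m1 n2
  obtain C ma where ma: "\<forall>m1\<ge>ma. \<forall>B :: nat set. \<forall>n2\<ge>1. finite B \<longrightarrow> card B = m2 \<longrightarrow>
      real n2 \<le> ?r * real m1 - C \<longrightarrow> (\<exists>F. realizes {..<m1} B n1 n2 F)"
    using explicit_range[OF assms, where 'b = nat] by (elim exE)
  have explicit: "?real m1 n2" if "ma \<le> m1" "1 \<le> n2" "real n2 \<le> ?r * real m1 - C" for m1 n2
    using ma[rule_format, OF that(1,2) _ _ that(3), of "{m1..<m1 + m2}"] by simp
  obtain mb where mb: "\<forall>A B n2 F. finite (A :: nat set) \<longrightarrow> finite (B :: nat set) \<longrightarrow> card B = m2 \<longrightarrow> realizes A B n1 n2 F \<longrightarrow>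
      mb \<le> card A \<longrightarrow> ?r * real (card A) - C \<le> real n2 \<longrightarrow> (\<exists>F'. realizes A B n1 (n2 - 1) F')"
    using descent[OF assms, where 'a = nat and 'b = nat, of C] by (elim exE)
  have pred: "?real m1 (n2 - 1)" if "mb \<le> m1" "?r * real m1 - C \<le> real n2" "?real m1 n2" for m1 n2
  proof -
    from that(3) obtain F where "realizes {..<m1} {m1..<m1 + m2} n1 n2 F" by (elim exE)
    then show ?thesis using mb[rule_format, of "{..<m1}" "{m1..<m1 + m2}" n2 F] that(1,2) by simp
  qed
  obtain mc :: nat where regular: "\<And>M. mc \<le> M \<Longrightarrow> \<exists>F. realizes {..<M} ({} :: nat set) n1 n1 F"
    using regular_family[OF assms(1), of n1] by blast
  define md where "md = nat \<lceil>real n1 + \<bar>C\<bar> + 2\<rceil>"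
  define m0 where "m0 = ma + mb + mc + md"
  have r1: "1 \<le> ?r" by (rule r_ge_1[OF assms])
  have good_iff: "good m1 n2 \<longleftrightarrow> ?real m1 n2" if "1 \<le> n2" "n2 \<noteq> n1" for m1 n2
    unfolding good_def using that assms by (intro distinguishing_partition_iff_realizes) auto
  have good_eq: "good m1 n1" if "m0 \<le> m1" for m1
  proof -
    have "mc \<le> m1 + m2" using that by (simp add: m0_def)
    then obtain F where "realizes {..<m1 + m2} ({} :: nat set) n1 n1 F" using regular by blast
    then show ?thesis unfolding good_def using assms by (intro distinguishing_partition_equal_parts) auto
  qed
  have top: "real n1 + 2 \<le> ?r * real m1 - C" if "m0 \<le> m1" for m1
  proof -
    have "real n1 + \<bar>C\<bar> + 2 \<le> real m1" using that unfolding m0_def md_def by linarith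
    also have "\<dots> \<le> ?r * real m1" using r1 mult_right_mono[of 1 ?r "real m1"] by simp
    finally show ?thesis by linarith
  qed
  have low: "good m1 n2" if "m0 \<le> m1" "1 \<le> n2" "real n2 \<le> ?r * real m1 - C" for m1 n2
  proof (cases "n2 = n1")
    case True
    then show ?thesis using good_eq that(1) by simp
  next
    case False
    have "ma \<le> m1" using that(1) by (simp add: m0_def)
    then show ?thesis using explicit that good_iff[OF that(2) False] by blast
  qed
  \<comment> \<open>Families describe the problem only for \<open>n2 \<noteq> n1\<close>; by
    \<open>top\<close> the steps beyond \<open>?r * real m1 - C\<close> involve only values greater
    than \<open>n1\<close>.\<close>
  have good_pred: "good m1 n2" if "m0 \<le> m1" "1 \<le> n2" "good m1 (Suc n2)" for m1 n2
  proof (cases "real n2 \<le> ?r * real m1 - C")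
    case True
    then show ?thesis using low that by blast
  next
    case False
    then have "real n1 + 2 < real n2" using top[OF that(1)] by linarith
    then have ne: "n2 \<noteq> n1" "Suc n2 \<noteq> n1" by auto
    have "?real m1 (Suc n2)" using good_iff[of "Suc n2"] that(3) ne(2) by simp
    then have "?real m1 (Suc n2 - 1)" using False that(1) by (intro pred) (auto simp: m0_def)
    then show ?thesis using good_iff[OF that(2) ne(1)] by simp
  qed
  have down: "good m1 n" if "m0 \<le> m1" "1 \<le> n" "n \<le> n2" "good m1 n2" for m1 n n2
    using that(3,4)
  proof (induction n2 rule: dec_induct)
    case (step k)
    then show ?case using good_pred[of m1 k] that(1,2) by simp
  qed
  have upper: "\<exists>K. \<forall>m1 n2. m0 \<le> m1 \<longrightarrow> 1 \<le> n2 \<longrightarrow> good m1 n2 \<longrightarrow> real n2 \<le> ?r * real m1 + K + \<eta> * real m1"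
    if \<eta>: "0 < \<eta>" for \<eta> :: real
  proof -
    obtain K where K: "\<And>A B n2 F. finite (A :: nat set) \<Longrightarrow> finite (B :: nat set) \<Longrightarrow> card B = m2 \<Longrightarrow> realizes A B n1 n2 F \<Longrightarrow>
      real n2 \<le> ?r * real (card A) + K + \<eta> * real (card A)" using upper_bound[OF assms \<eta>] by blast
    \<comment> \<open>The summand with \<open>C\<close> covers \<open>n2 = n1\<close>, where no
      family is available and \<open>top\<close> is used instead.\<close>
    have "real n2 \<le> ?r * real m1 + \<bar>K\<bar> + \<bar>C\<bar> + \<eta> * real m1" if R: "m0 \<le> m1" "1 \<le> n2" "good m1 n2" for m1 n2
    proof (cases "n2 = n1")
      case True
      have "0 \<le> \<eta> * real m1" using \<eta> by simp
      then show ?thesis using top[OF R(1)] True by linarith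
    next
      case False
      then obtain F where "realizes {..<m1} {m1..<m1 + m2} n1 n2 F" using good_iff[OF R(2)] R(3) by blast
      then have "real n2 \<le> ?r * real (card {..<m1}) + K + \<eta> * real (card {..<m1})" by (intro K) auto
      then show ?thesis by simp
    qed
    then show ?thesis by (intro exI[of _ "\<bar>K\<bar> + \<bar>C\<bar>"]) (simp add: add.assoc)
  qed
  \<comment> \<open>From \<open>m0\<close> on the maximum exists, and by \<open>down\<close> the
    admissible values are exactly those from 1 to \<open>N m1\<close>; smaller \<open>m1\<close> do
    not affect the claim.\<close>
  define N where "N m1 = Max {n. 1 \<le> n \<and> good m1 n}" for m1
  have fin: "finite {n. 1 \<le> n \<and> good m1 n}" if m1: "m0 \<le> m1" for m1
  proof -
    obtain K where K: "\<And>n2. 1 \<le> n2 \<Longrightarrow> good m1 n2 \<Longrightarrow> real n2 \<le> ?r * real m1 + K + 1 * real m1"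
      using upper[of 1] m1 by auto
    have "{n. 1 \<le> n \<and> good m1 n} \<subseteq> {..nat \<lfloor>?r * real m1 + K + 1 * real m1\<rfloor>}"
    proof
      fix n assume "n \<in> {n. 1 \<le> n \<and> good m1 n}"
      then have "real n \<le> ?r * real m1 + K + 1 * real m1" using K by blast
      then show "n \<in> {..nat \<lfloor>?r * real m1 + K + 1 * real m1\<rfloor>}" by (simp only: atMost_iff le_nat_floor)
    qed
    then show ?thesis using finite_subset by blast
  qed
  have good1: "good m1 1" if "m0 \<le> m1" for m1
    by (rule low[OF that]) (use top[OF that] in auto)
  have N: "1 \<le> N m1" "good m1 (N m1)" if "m0 \<le> m1" for m1
    using Max_in[OF fin[OF that]] good1[OF that] unfolding N_def by auto
  have N_iff: "good m1 n \<longleftrightarrow> n \<le> N m1" if "m0 \<le> m1" "1 \<le> n" for m1 n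
  proof
    assume "good m1 n"
    then show "n \<le> N m1" unfolding N_def using fin[OF that(1)] that(2) by (intro Max_ge) auto
  next
    assume "n \<le> N m1"
    then show "good m1 n" using down[OF that] N[OF that(1)] by blast
  qed
  define \<epsilon> where "\<epsilon> m1 = real (N m1) - ?r * real m1" for m1
  \<comment> \<open>From below the error is even bounded, by the explicit range. Only the upper
    estimate involves the number of components and is merely \<open>o(m1)\<close>.\<close>
  have \<epsilon>_lower: "- (\<bar>C\<bar> + 1) \<le> \<epsilon> m1" if m1: "m0 \<le> m1" for m1
  proof -
    let ?n = "nat \<lfloor>?r * real m1 - C\<rfloor>"
    have n: "real ?n \<le> ?r * real m1 - C" "?r * real m1 - C < real ?n + 1" "1 \<le> ?n"
      using top[OF m1] by linarith+
    then have "?n \<le> N m1" using low[OF m1] N_iff[OF m1] by blast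
    then have "real ?n \<le> real (N m1)" by simp
    then show ?thesis using n(2) unfolding \<epsilon>_def by linarith
  qed
  have "\<epsilon> \<in> o(\<lambda>m1. real m1)"
  proof (rule landau_o.smallI)
    fix c :: real assume c: "0 < c"
    obtain K where K: "\<And>m1 n2. m0 \<le> m1 \<Longrightarrow> 1 \<le> n2 \<Longrightarrow> good m1 n2 \<Longrightarrow> real n2 \<le> ?r * real m1 + K + c / 2 * real m1"
      using upper[of "c / 2"] c by auto
    define m where "m = max m0 (nat \<lceil>(\<bar>K\<bar> + \<bar>C\<bar> + 1) / (c / 2)\<rceil>)"
    have "norm (\<epsilon> m1) \<le> c * norm (real m1)" if "m \<le> m1" for m1
    proof -
      have m1: "m0 \<le> m1" using that by (simp add: m_def)
      have "(\<bar>K\<bar> + \<bar>C\<bar> + 1) / (c / 2) \<le> real m1" using that unfolding m_def by linarith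
      then have "\<bar>K\<bar> + \<bar>C\<bar> + 1 \<le> real m1 * (c / 2)" using c by (simp only: pos_divide_le_eq half_gt_zero)
      then have b: "\<bar>K\<bar> + \<bar>C\<bar> + 1 \<le> c / 2 * real m1" by (simp add: mult.commute)
      moreover have "\<epsilon> m1 \<le> K + c / 2 * real m1" using K[OF m1 N[OF m1]] unfolding \<epsilon>_def by linarith
      moreover note \<epsilon>_lower[OF m1]
      moreover have "c / 2 * real m1 + c / 2 * real m1 = c * real m1" by simp
      ultimately have "\<bar>\<epsilon> m1\<bar> \<le> c * real m1" by linarith
      then show ?thesis by simp
    qed
    then show "\<forall>\<^sub>F m1 in sequentially. norm (\<epsilon> m1) \<le> c * norm (real m1)"
      unfolding eventually_sequentially by blast
  qed
  moreover have "\<forall>\<^sub>F m1 in sequentially. \<forall>n2 :: nat. n2 \<ge> 1 \<longrightarrow>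
      ((\<exists>P. distinguishing_partition (complete_multipartite m1 n1 m2 n2) P) \<longleftrightarrow>
       real n2 \<le> ?r * real m1 + \<epsilon> m1)"
    unfolding eventually_sequentially
  proof (intro exI[of _ m0] allI impI)
    fix m1 n2 :: nat assume "m0 \<le> m1" "1 \<le> n2"
    then have "good m1 n2 \<longleftrightarrow> n2 \<le> N m1" by (rule N_iff)
    also have "\<dots> \<longleftrightarrow> real n2 \<le> ?r * real m1 + \<epsilon> m1" by (simp add: \<epsilon>_def)
    finally show "(\<exists>P. distinguishing_partition (complete_multipartite m1 n1 m2 n2) P) \<longleftrightarrow>
       real n2 \<le> ?r * real m1 + \<epsilon> m1" unfolding good_def .
  qed
  ultimately show ?thesis by blast
qed

end
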